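(* The problems of counting $k$-paths and $k$-cycles in a graph $G$ modulo $2$ (given $G$ and $k$) can be solved in time $k^{O(k)}\cdot|V(G)|^{k/6+O(1)}$.
   Context: Graphs are finite, undirected, simple. A $k$-path (resp. $k$-cycle) is a path (resp. cycle) with $k$ edges; counting $k$-paths (resp. $k$-cycles) in $G$ means counting subgraphs of $G$ isomorphic to the path (resp. cycle) with $k$ edges. *)

theory Defs
  imports Complex_Main "HOL-Library.Discrete_Functions"
begin

section \<open>Simple graphs and subgraph counts\<close>

text \<open>A graph is a pair of a vertex set and a set of edges, an edge being a two-element set.\<close>

type_synonym 'a ugraph = "'a set \<times> 'a set set"

abbreviation verts :: "'a ugraph \<Rightarrow> 'a set" where "verts G \<equiv> fst G"
abbreviation edges :: "'a ugraph \<Rightarrow> 'a set set" where "edges G \<equiv> snd G"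

definition simple_graph :: "'a ugraph \<Rightarrow> bool" where
  "simple_graph G \<longleftrightarrow> finite (verts G) \<and> (\<forall>e\<in>edges G. e \<subseteq> verts G \<and> card e = 2)"

definition subgraph :: "'a ugraph \<Rightarrow> 'a ugraph \<Rightarrow> bool" where
  "subgraph S G \<longleftrightarrow> simple_graph S \<and> verts S \<subseteq> verts G \<and> edges S \<subseteq> edges G"

definition graph_iso :: "'a ugraph \<Rightarrow> 'b ugraph \<Rightarrow> bool" where
  "graph_iso G H \<longleftrightarrow> (\<exists>f. bij_betw f (verts G) (verts H) \<and> edges H = (\<lambda>e. f ` e) ` edges G)"

definition count_subgraphs :: "'a ugraph \<Rightarrow> 'b ugraph \<Rightarrow> nat" where
  "count_subgraphs H G = card {S. subgraph S G \<and> graph_iso H S}"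

definition path_graph :: "nat \<Rightarrow> nat ugraph" where
  "path_graph k = ({..k}, {{i, Suc i} |i. i < k})"

text \<open>This is a simple graph, and the cycle with \<open>k\<close> edges, only for \<open>k \<ge> 3\<close>.\<close>

definition cycle_graph :: "nat \<Rightarrow> nat ugraph" where
  "cycle_graph k = ({..<k}, {{i, Suc i mod k} |i. i < k})"


section \<open>Random access machines with logarithmic cost\<close>

text \<open>
  Algorithms are random access machine programs with the logarithmic cost criterion: registers and
  memory cells hold arbitrary natural numbers, and every operation costs the bit lengths of the
  numbers and memory addresses it touches. Control flow is structured. Jumps can be expressed by
  keeping a program counter in a register, at the price of a constant factor that depends on the
  program only. A program can mention only finitely many registers, by literal index; the memory
  is accessed indirectly.
\<close>

datatype binop = Add | Sub | Mul | Div

fun binop_val :: "binop \<Rightarrow> nat \<Rightarrow> nat \<Rightarrow> nat" where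
  "binop_val Add a b = a + b"
| "binop_val Sub a b = a - b"
| "binop_val Mul a b = a * b"
| "binop_val Div a b = a div b"

datatype prog =
    Const nat nat
  | Op binop nat nat nat
  | Load nat nat
  | Store nat nat
  | Seq prog prog
  | Cond nat prog prog
  | While nat prog

type_synonym state = "(nat \<Rightarrow> nat) \<times> (nat \<Rightarrow> nat)"

text \<open>The number of binary digits, with length one for zero.\<close>

definition bitlen :: "nat \<Rightarrow> nat" where
  "bitlen a = Suc (floor_log a)"

text \<open>
  \<open>exec p s t s'\<close>: started in state \<open>s = (r, m)\<close> (registers, memory), the program \<open>p\<close> halts after
  time \<open>t\<close> in state \<open>s'\<close>.
\<close>

inductive exec :: "prog \<Rightarrow> state \<Rightarrow> nat \<Rightarrow> state \<Rightarrow> bool" where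
  Const: "exec (Const x a) (r, m) (bitlen a) (r(x := a), m)"
| Op: "exec (Op f x y z) (r, m) (bitlen (r y) + bitlen (r z)) (r(x := binop_val f (r y) (r z)), m)"
| Load: "exec (Load x y) (r, m) (bitlen (r y) + bitlen (m (r y))) (r(x := m (r y)), m)"
| Store: "exec (Store x y) (r, m) (bitlen (r x) + bitlen (r y)) (r, m(r x := r y))"
| Seq: "exec p s t s' \<Longrightarrow> exec q s' t' s'' \<Longrightarrow> exec (Seq p q) s (t + t') s''"
| CondT: "r x \<noteq> 0 \<Longrightarrow> exec p (r, m) t s' \<Longrightarrow> exec (Cond x p q) (r, m) (bitlen (r x) + t) s'"
| CondF: "r x = 0 \<Longrightarrow> exec q (r, m) t s' \<Longrightarrow> exec (Cond x p q) (r, m) (bitlen (r x) + t) s'"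
| WhileF: "r x = 0 \<Longrightarrow> exec (While x p) (r, m) (bitlen (r x)) (r, m)"
| WhileT: "r x \<noteq> 0 \<Longrightarrow> exec p (r, m) t s' \<Longrightarrow> exec (While x p) s' t' s''
           \<Longrightarrow> exec (While x p) (r, m) (bitlen (r x) + t + t') s''"

lemma exec_deterministic:
  "exec p s t s' \<Longrightarrow> exec p s u s'' \<Longrightarrow> u = t \<and> s'' = s'"
proof (induction arbitrary: u s'' rule: exec.induct)
  case Const
  from Const.prems show ?case by cases auto
next
  case Op
  from Op.prems show ?case by cases auto
next
  case Load
  from Load.prems show ?case by cases auto
next
  case Store
  from Store.prems show ?case by cases auto
next
  case (Seq p s t s' q t' s'')
  from Seq.prems show ?case by cases (metis Seq.IH)
next
  case (CondT r x p m t s' q)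
  from CondT.prems show ?case by cases (use CondT.hyps in \<open>simp_all add: CondT.IH\<close>)
next
  case (CondF r x q m t s' p)
  from CondF.prems show ?case by cases (use CondF.hyps in \<open>simp_all add: CondF.IH\<close>)
next
  case WhileF
  from WhileF.prems show ?case by cases (use WhileF.hyps in simp_all)
next
  case (WhileT r x p m t s' t' s'')
  from WhileT.prems show ?case
  proof cases
    case WhileF
    then show ?thesis using WhileT.hyps by simp
  next
    case (WhileT t1 s1 t2)
    then show ?thesis using WhileT.IH by metis
  qed
qed


section \<open>Solving parametrised graph problems\<close>

text \<open>
  An input is a graph with vertex set \<open>{..<n}\<close> together with a parameter \<open>k\<close>. Registers 0 and 1
  hold \<open>n\<close> and \<open>k\<close>, the memory holds the adjacency matrix row by row, and everything else is zero.
\<close>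

definition input_state :: "nat ugraph \<Rightarrow> nat \<Rightarrow> state" where
  "input_state G k =
     (let n = card (verts G) in
      ((\<lambda>_. 0)(0 := n, 1 := k),
       (\<lambda>a. if a < n * n \<and> {a div n, a mod n} \<in> edges G then 1 else 0)))"

text \<open>
  The output is read from register 0. The domain \<open>K\<close> consists of the admissible parameters, and
  \<open>T n k\<close> bounds the running time on \<open>n\<close>-vertex graphs.
\<close>

definition solves_in_time ::
  "prog \<Rightarrow> nat set \<Rightarrow> (nat ugraph \<Rightarrow> nat \<Rightarrow> nat) \<Rightarrow> (nat \<Rightarrow> nat \<Rightarrow> real) \<Rightarrow> bool" where
  "solves_in_time p K f T \<longleftrightarrow>
     (\<forall>G. \<forall>k\<in>K. simple_graph G \<and> verts G = {..<card (verts G)} \<longrightarrow>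
        (\<exists>t r m. exec p (input_state G k) t (r, m) \<and> r 0 = f G k \<and>
                 real t \<le> T (card (verts G)) k))"

text \<open>
  A bound of the form \<open>k\<^sup>O\<^sup>(\<^sup>k\<^sup>) n\<^sup>k\<^sup>/\<^sup>6\<^sup>+\<^sup>O\<^sup>(\<^sup>1\<^sup>)\<close>: the constants \<open>a\<close>, \<open>b\<close> and \<open>c\<close> depend neither on \<open>n\<close> nor on \<open>k\<close>.
  The factor \<open>a\<close> matters only when both \<open>k\<close> and \<open>n\<close> are at most one, and the graph without
  vertices is charged like a graph with one vertex. For \<open>k = 0\<close> the first power is one.
\<close>

definition path_cycle_bound :: "nat \<Rightarrow> nat \<Rightarrow> nat \<Rightarrow> nat \<Rightarrow> nat \<Rightarrow> real" where
  "path_cycle_bound a b c n k =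
     real a * real k ^ (b * k) * real (max 1 n) powr (real k / 6 + real c)"

end

theory Submission
  imports Defs "HOL-Library.FuncSet" "HOL-Combinatorics.Permutations"
begin

text \<open>
  After the endpoints are fixed (for a cycle: its least vertex and the two neighbours of that
  vertex), paths are counted as walks \<open>v\<close> on the positions \<open>0, \<dots>, K\<close>. Modulo two the number of
  injective walks equals the number of pairs \<open>(M, v)\<close> where \<open>M\<close> is an involution of the positions
  with \<open>v \<circ> M = v\<close>, because a walk that is constant on two positions has an even number of such \<open>M\<close>.
  Reversing the walk between a position and its partner cancels most of these pairs; what survives
  are the \<open>M\<close> whose pairs are either hairs \<open>(i, i + 2)\<close> or contain the tip \<open>i + 1\<close> of a hair.
  The walks compatible with such an \<open>M\<close> are the homomorphisms from a graph with at most
  \<open>(K + 1) / 2\<close> vertices of degree three (the hubs), which lie along a path, each with one chord.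
  Guessing the values on every third hub costs \<open>n\<^sup>K\<^sup>/\<^sup>6\<^sup>+\<^sup>O\<^sup>(\<^sup>1\<^sup>)\<close> and leaves only
  variables of degree at most two once those between the hubs have been eliminated, so the
  remaining sum is evaluated by variable elimination. All \<open>M\<close> are enumerated, which costs
  \<open>K\<^sup>O\<^sup>(\<^sup>K\<^sup>)\<close>.
\<close>

section \<open>Parity of injective walks\<close>

text \<open>Working modulo 2 pays twice: unwanted configurations cancel in pairs, and the number of
  values that extend a partial solution at an eliminated variable matters only through its parity,
  so summing out a variable with two neighbours leaves an ordinary yes/no constraint between them.
  The cancellation meets two obstacles. Reversing positions i, i+1, i+2 of a walk with equal ends
  changes nothing, and there is no second inner position to exchange with i+1; hence hairs survive.
  If i is the middle of a pair (i-1, i+1), reversing a segment that starts at i moves i+1 and tears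
  that pair apart, so the first reversible position could change and the map would not undo itself;
  hence pairs whose lower end is a tip survive. The exponent 1/6 is 1/2 times 1/3. The partner of a
  hub is never a hub, so at most half of the positions are hubs. Fixing every third hub leaves runs
  of two along the path: a remaining hub keeps at most one neighbour on the path and one across its
  chord, hence degree two, and elimination never raises a degree.\<close>

lemma even_card_involution:
  assumes "finite A" and "\<And>x. x \<in> A \<Longrightarrow> f x \<in> A \<and> f x \<noteq> x \<and> f (f x) = x"
  shows "even (card A)"
  using assms
proof (induction A rule: finite_psubset_induct)
  case (psubset A)
  show ?case
  proof (cases "A = {}")
    case False
    then obtain x where x: "x \<in> A" by blast
    let ?B = "A - {x, f x}"
    have fx: "f x \<in> A" "f x \<noteq> x" "f (f x) = x" using psubset.prems x by auto
    have "even (card ?B)"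
    proof (rule psubset.IH)
      show "?B \<subset> A" using x by blast
      show "f y \<in> ?B \<and> f y \<noteq> y \<and> f (f y) = y" if "y \<in> ?B" for y
        using that psubset.prems[of y] fx(3) by auto
    qed
    moreover have "card A = card ?B + 2"
      using x fx psubset.hyps card_Diff_subset[of "{x, f x}" A]
        card_mono[of A "{x, f x}"] by auto
    ultimately show ?thesis by simp
  qed simp
qed

text \<open>In a group, an element \<open>\<tau>\<close> of order two pairs up the solutions of
  \<open>M \<circ> M = id\<close>. Multiplying by \<open>\<tau>\<close> yields another solution
  exactly when the two commute; conjugating always does, but moves \<open>M\<close> only when they
  do not commute. Each branch preserves the test, so the map undoes itself.\<close>

definition toggle :: "('a \<Rightarrow> 'a) \<Rightarrow> ('a \<Rightarrow> 'a) \<Rightarrow> 'a \<Rightarrow> 'a" where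
  "toggle \<tau> M = (if \<tau> \<circ> M = M \<circ> \<tau> then \<tau> \<circ> M else \<tau> \<circ> M \<circ> \<tau>)"

lemma toggle_facts:
  assumes t: "\<tau> \<circ> \<tau> = id" "\<tau> \<noteq> id" and M: "M \<circ> M = id"
  shows "toggle \<tau> M \<circ> toggle \<tau> M = id" "toggle \<tau> M \<noteq> M" "toggle \<tau> (toggle \<tau> M) = M"
proof -
  have tt: "\<tau> (\<tau> x) = x" and MM: "M (M x) = x" for x
    using t(1) M by (metis comp_apply id_apply)+
  show "toggle \<tau> M \<circ> toggle \<tau> M = id"
    using tt MM by (auto simp: toggle_def fun_eq_iff)
  show "toggle \<tau> M \<noteq> M"
  proof (cases "\<tau> \<circ> M = M \<circ> \<tau>")
    case True
    have "\<tau> \<circ> M \<noteq> M"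
    proof
      assume "\<tau> \<circ> M = M"
      then have "\<tau> x = x" for x by (metis MM comp_apply)
      then show False using t(2) by auto
    qed
    then show ?thesis using True by (simp add: toggle_def)
  next
    case False
    have "\<tau> \<circ> M \<circ> \<tau> \<noteq> M"
    proof
      assume "\<tau> \<circ> M \<circ> \<tau> = M"
      then have "\<tau> (M (\<tau> x)) = M x" for x by (metis comp_apply)
      then have "\<tau> (M x) = M (\<tau> x)" for x by (metis tt)
      then show False using False by (auto simp: fun_eq_iff)
    qed
    then show ?thesis using False by (simp add: toggle_def)
  qed
  show "toggle \<tau> (toggle \<tau> M) = M"
  proof (cases "\<tau> \<circ> M = M \<circ> \<tau>")
    case True
    then have *: "\<tau> (M x) = M (\<tau> x)" for x by (metis comp_apply)
    have "\<tau> \<circ> (\<tau> \<circ> M) = (\<tau> \<circ> M) \<circ> \<tau>" using * tt by (auto simp: fun_eq_iff)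
    then show ?thesis using True tt by (auto simp: toggle_def fun_eq_iff)
  next
    case False
    have "\<tau> \<circ> (\<tau> \<circ> M \<circ> \<tau>) \<noteq> (\<tau> \<circ> M \<circ> \<tau>) \<circ> \<tau>"
    proof
      assume "\<tau> \<circ> (\<tau> \<circ> M \<circ> \<tau>) = (\<tau> \<circ> M \<circ> \<tau>) \<circ> \<tau>"
      then have "\<tau> (\<tau> (M (\<tau> x))) = \<tau> (M (\<tau> (\<tau> x)))" for x by (metis comp_apply)
      then show False using False tt by (auto simp: fun_eq_iff)
    qed
    then show ?thesis using False tt by (auto simp: toggle_def fun_eq_iff)
  qed
qed

text \<open>Used with a reversal \<open>\<rho>\<close>: toggling a palindromic configuration must
  leave it palindromic.\<close>

lemma toggle_commute:
  assumes "\<rho> \<circ> \<tau> = \<tau> \<circ> \<rho>" "\<rho> \<circ> M = M \<circ> \<rho>"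
  shows "\<rho> \<circ> toggle \<tau> M = toggle \<tau> M \<circ> \<rho>"
proof -
  have "\<rho> (\<tau> x) = \<tau> (\<rho> x)" "\<rho> (M x) = M (\<rho> x)" for x
    using assms by (metis comp_apply)+
  then show ?thesis by (auto simp: toggle_def fun_eq_iff)
qed

lemma comp_toggle:
  assumes "v \<circ> \<tau> = v" "v \<circ> M = v"
  shows "v \<circ> toggle \<tau> M = v"
proof -
  have "v \<circ> (\<tau> \<circ> M) = v" "v \<circ> (\<tau> \<circ> M \<circ> \<tau>) = v"
    by (simp_all only: o_assoc assms)
  then show ?thesis unfolding toggle_def by presburger
qed

section \<open>Involutions compatible with a walk\<close>

definition involutions :: "nat \<Rightarrow> (nat \<Rightarrow> nat) set" where
  "involutions K = {M. M \<circ> M = id \<and> (\<forall>i>K. M i = i)}"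

lemma involutionsD:
  assumes "M \<in> involutions K"
  shows "M (M i) = i" "i > K \<Longrightarrow> M i = i" "i \<le> K \<Longrightarrow> M i \<le> K" "M i \<noteq> i \<Longrightarrow> i \<le> K"
proof -
  show a: "M (M i) = i" for i using assms unfolding involutions_def by (metis (mono_tags, lifting) comp_apply id_apply mem_Collect_eq)
  show b: "i > K \<Longrightarrow> M i = i" for i using assms by (auto simp: involutions_def)
  show "M i \<le> K" if "i \<le> K"
  proof (rule ccontr)
    assume "\<not> M i \<le> K"
    then have "M (M i) = M i" using b by simp
    then show False using a[of i] that \<open>\<not> M i \<le> K\<close> by simp
  qed
  show "M i \<noteq> i \<Longrightarrow> i \<le> K" using b not_le by blast
qed

lemma finite_involutions: "finite (involutions K)"
proof (rule finite_subset)
  show "involutions K \<subseteq> {p. p permutes {..K}}"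
  proof
    fix M assume "M \<in> involutions K"
    note D = involutionsD[OF this]
    have "M permutes {..K}"
      unfolding permutes_def using D by (metis atMost_iff not_le)
    then show "M \<in> {p. p permutes {..K}}" by simp
  qed
qed (simp add: finite_permutations)

lemma toggle_involutions:
  assumes "M \<in> involutions K" "\<tau> \<in> involutions K"
  shows "toggle \<tau> M \<in> involutions K"
proof -
  note D = involutionsD[OF assms(1)] and E = involutionsD[OF assms(2)]
  show ?thesis
  proof (cases "\<tau> \<circ> M = M \<circ> \<tau>")
    case True
    then have "\<tau> (M (\<tau> (M i))) = i" for i
      using D(1) E(1) by (metis comp_apply)
    then show ?thesis
      using D(2) E(2) True by (simp add: involutions_def toggle_def fun_eq_iff del: o_apply) (simp add: o_def)
  next
    case False
    then show ?thesis
      using D(1,2) E(1,2) by (simp add: involutions_def toggle_def fun_eq_iff)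
  qed
qed

lemma transpose_involutions: "a \<le> K \<Longrightarrow> b \<le> K \<Longrightarrow> transpose a b \<in> involutions K"
  by (auto simp: involutions_def Transposition.transpose_def)

definition walk_maps :: "nat \<Rightarrow> 'a set \<Rightarrow> ('a \<Rightarrow> 'a \<Rightarrow> bool) \<Rightarrow> 'a \<Rightarrow> 'a \<Rightarrow> (nat \<Rightarrow> 'a) set" where
  "walk_maps K V adj s t =
     {v \<in> {..K} \<rightarrow>\<^sub>E V. v 0 = s \<and> v K = t \<and> (\<forall>i<K. adj (v i) (v (Suc i)))}"

definition folded_walks ::
    "nat \<Rightarrow> 'a set \<Rightarrow> ('a \<Rightarrow> 'a \<Rightarrow> bool) \<Rightarrow> 'a \<Rightarrow> 'a \<Rightarrow> ((nat \<Rightarrow> nat) \<times> (nat \<Rightarrow> 'a)) set" where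
  "folded_walks K V adj s t =
     {(M, v). M \<in> involutions K \<and> v \<in> walk_maps K V adj s t \<and> v \<circ> M = v}"

lemma finite_walk_maps: "finite V \<Longrightarrow> finite (walk_maps K V adj s t)"
  unfolding walk_maps_def by (rule finite_subset[OF _ finite_PiE[of "{..K}" "\<lambda>_. V"]]) auto

lemma finite_folded_walks: "finite V \<Longrightarrow> finite (folded_walks K V adj s t)"
  unfolding folded_walks_def
  by (rule finite_subset[OF _ finite_cartesian_product[OF finite_involutions finite_walk_maps]]) auto

lemma parity_injective_walks:
  assumes "finite V"
  shows "odd (card {v \<in> walk_maps K V adj s t. inj_on v {..K}}) \<longleftrightarrow> odd (card (folded_walks K V adj s t))"
proof -
  let ?X = "folded_walks K V adj s t"
  let ?B = "{x \<in> ?X. \<not> inj_on (snd x) {..K}}"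
  \<comment> \<open>The colliding pair is chosen from the walk alone, so toggling \<open>M\<close>
    leaves the choice unchanged.\<close>
  define col where "col v = (SOME p. fst p \<le> K \<and> snd p \<le> K \<and> fst p \<noteq> snd p \<and> v (fst p) = v (snd p))"
    for v :: "nat \<Rightarrow> 'a"
  define \<tau> where "\<tau> v = transpose (fst (col v)) (snd (col v))" for v :: "nat \<Rightarrow> 'a"
  have col: "fst (col v) \<le> K \<and> snd (col v) \<le> K \<and> fst (col v) \<noteq> snd (col v) \<and> v (fst (col v)) = v (snd (col v))"
    if "\<not> inj_on v {..K}" for v
  proof -
    obtain i j where "i \<le> K" "j \<le> K" "i \<noteq> j" "v i = v j" using \<open>\<not> inj_on v {..K}\<close> by (auto simp: inj_on_def)
    then have "\<exists>p. fst p \<le> K \<and> snd p \<le> K \<and> fst p \<noteq> snd p \<and> v (fst p) = v (snd p)"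
      by (intro exI[of _ "(i, j)"]) simp
    from someI_ex[OF this] show ?thesis unfolding col_def .
  qed
  have fin: "finite ?X" by (rule finite_folded_walks[OF assms])
  have "even (card ?B)"
  proof (rule even_card_involution[where f = "\<lambda>x. (toggle (\<tau> (snd x)) (fst x), snd x)"])
    show "finite ?B" using fin by simp
    fix x assume x: "x \<in> ?B"
    obtain M v where xe: "x = (M, v)" by force
    from x xe have M: "M \<in> involutions K" and v: "v \<in> walk_maps K V adj s t" and vM: "v \<circ> M = v"
      and ni: "\<not> inj_on v {..K}" by (auto simp: folded_walks_def)
    note c = col[OF ni]
    have t: "\<tau> v \<in> involutions K" using c by (simp add: \<tau>_def transpose_involutions)
    have t1: "\<tau> v \<circ> \<tau> v = id" by (simp add: \<tau>_def)
    have t2: "\<tau> v \<noteq> id" using c by (simp add: \<tau>_def transpose_eq_id_iff)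
    have vt: "v \<circ> \<tau> v = v" using c by (auto simp: \<tau>_def fun_eq_iff Transposition.transpose_def)
    have MM: "M \<circ> M = id" using M by (simp add: involutions_def)
    show "(toggle (\<tau> (snd x)) (fst x), snd x) \<in> ?B \<and> (toggle (\<tau> (snd x)) (fst x), snd x) \<noteq> x \<and>
       (toggle (\<tau> (snd (toggle (\<tau> (snd x)) (fst x), snd x))) (fst (toggle (\<tau> (snd x)) (fst x), snd x)),
         snd (toggle (\<tau> (snd x)) (fst x), snd x)) = x"
      using toggle_facts[OF t1 t2 MM] toggle_involutions[OF M t] comp_toggle[OF vt vM] v ni
      by (simp add: xe folded_walks_def)
  qed
  moreover have "card ?X = card (?X - ?B) + card ?B"
    using card_Diff_subset[of ?B ?X] card_mono[OF fin, of ?B] fin by auto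
  moreover have "card (?X - ?B) = card {v \<in> walk_maps K V adj s t. inj_on v {..K}}"
  proof -
    have "?X - ?B = (\<lambda>v. (id, v)) ` {v \<in> walk_maps K V adj s t. inj_on v {..K}}"
    proof (intro equalityI subsetI)
      fix x assume x: "x \<in> ?X - ?B"
      obtain M v where xe: "x = (M, v)" by force
      from x xe have M: "M \<in> involutions K" and v: "v \<in> walk_maps K V adj s t" and vM: "v \<circ> M = v"
        and inj: "inj_on v {..K}" by (auto simp: folded_walks_def)
      have "M i = i" for i
      proof (cases "i \<le> K")
        case True
        then show ?thesis
          using involutionsD(3)[OF M True] inj vM by (auto simp: inj_on_def fun_eq_iff)
      qed (use involutionsD(2)[OF M] in auto)
      then have "M = id" by auto
      then show "x \<in> (\<lambda>v. (id, v)) ` {v \<in> walk_maps K V adj s t. inj_on v {..K}}"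
        using xe v inj by auto
    qed (auto simp: folded_walks_def involutions_def)
    then show ?thesis by (simp add: card_image inj_on_def)
  qed
  ultimately show ?thesis by simp
qed

text \<open>Only the values of \<open>M\<close> at \<open>i - 1\<close> and \<open>i\<close> enter,
  so a change of \<open>M\<close> that keeps its values up to the first stuck position keeps that
  position. The two exceptions are the obstacles to cancellation: a pair at distance two, and a
  lower end in the middle of such a pair.\<close>

definition stuck :: "(nat \<Rightarrow> nat) \<Rightarrow> nat \<Rightarrow> bool" where
  "stuck M i \<longleftrightarrow> i < M i \<and> M i \<noteq> i + 2 \<and> \<not> (1 \<le> i \<and> M (i - 1) = i + 1)"

definition reflect :: "nat \<Rightarrow> nat \<Rightarrow> nat \<Rightarrow> nat" where
  "reflect i j p = (if i \<le> p \<and> p \<le> j then i + j - p else p)"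

lemma reflect_simps:
  "reflect i j (reflect i j p) = p" "i \<le> j \<Longrightarrow> reflect i j i = j" "i \<le> j \<Longrightarrow> reflect i j j = i"
  "p < i \<Longrightarrow> reflect i j p = p" "j < p \<Longrightarrow> reflect i j p = p"
  by (auto simp: reflect_def)

text \<open>Inside the segment the edges are traversed backwards, which uses symmetry of
  \<open>adj\<close>; at its borders the equality of the end vertices keeps the adjoining
  edges.\<close>

lemma walk_maps_reflect:
  assumes v: "v \<in> walk_maps K V adj s t" and ij: "i \<le> j" "j \<le> K" and eq: "v i = v j"
    and sym: "\<And>a b. a \<in> V \<Longrightarrow> b \<in> V \<Longrightarrow> adj a b \<Longrightarrow> adj b a"
  shows "v \<circ> reflect i j \<in> walk_maps K V adj s t"
proof -
  have vin: "v p \<in> V" if "p \<le> K" for p using v that by (auto simp: walk_maps_def PiE_def Pi_def)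
  have vout: "v p = undefined" if "p > K" for p
    using v that by (auto simp: walk_maps_def PiE_def extensional_def)
  have adj: "adj (v p) (v (Suc p))" if "p < K" for p using v that by (auto simp: walk_maps_def)
  have edge: "adj (v (reflect i j p)) (v (reflect i j (Suc p)))" if p: "p < K" for p
  proof -
    consider "Suc p < i" | "Suc p = i" | "i \<le> p" "p < j" | "p = j" | "j < p" by linarith
    then show ?thesis
    proof cases
      case 1 then show ?thesis using adj[OF p] by (simp add: reflect_simps)
    next
      case 2 then show ?thesis using adj[OF p] eq ij by (simp add: reflect_def)
    next
      case 3
      have "Suc (i + j - Suc p) = i + j - p" using 3 by linarith
      then have "adj (v (i + j - Suc p)) (v (i + j - p))" using adj[of "i + j - Suc p"] 3 ij by auto
      then have "adj (v (i + j - p)) (v (i + j - Suc p))" using 3 ij using sym[OF vin vin] by simp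
      then show ?thesis using 3 by (simp add: reflect_def)
    next
      case 4 then show ?thesis using adj[OF p] eq ij by (simp add: reflect_def)
    next
      case 5 then show ?thesis using adj[OF p] by (simp add: reflect_simps)
    qed
  qed
  have "v (reflect i j p) \<in> V" if "p \<le> K" for p using that ij vin by (auto simp: reflect_def)
  moreover have "v (reflect i j p) = undefined" if "p > K" for p
    using that ij vout by (simp add: reflect_def)
  moreover have "v (reflect i j 0) = v 0" "v (reflect i j K) = v K" using eq ij by (auto simp: reflect_def)
  moreover have "v 0 = s" "v K = t" using v by (auto simp: walk_maps_def)
  ultimately show ?thesis using edge
    by (auto simp: walk_maps_def PiE_def Pi_def extensional_def)
qed

text \<open>The pair \<open>(i, j)\<close> is kept. If an earlier position has its partner strictly
  inside the segment, it is not a hair \<open>(i - 1, i + 1)\<close>, because \<open>i\<close> is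
  stuck; so it is the middle of a pair that ends before \<open>i\<close>, and that pair is
  untouched. The first stuck position and its partner are therefore the same before and after, which
  makes the reversal self-inverse.\<close>

lemma stuck_conj:
  assumes M: "M \<in> involutions K" and st: "stuck M i" and least: "\<And>p. p < i \<Longrightarrow> \<not> stuck M p"
    and j: "j = M i"
  defines "M' \<equiv> reflect i j \<circ> M \<circ> reflect i j"
  shows "M' \<in> involutions K" "M' i = j" "stuck M' i" "\<And>p. p < i \<Longrightarrow> \<not> stuck M' p"
proof -
  note D = involutionsD[OF M]
  have Mj: "M j = i" using D(1) j by simp
  have ij: "i < j" using st j by (simp add: stuck_def)
  then have jK: "j \<le> K" using D(4)[of j] Mj by simp
  show "M' \<in> involutions K"
    using D(1,2) ij jK by (simp add: involutions_def M'_def fun_eq_iff reflect_simps)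
  show M'i: "M' i = j" using ij Mj by (simp add: M'_def reflect_simps)
  \<comment> \<open>The second conjunct forbids a new pair \<open>(i - 1, i + 1)\<close>, which
    would stop \<open>i\<close> from being stuck.\<close>
  have low: "\<not> stuck M' p \<and> (Suc p = i \<longrightarrow> M' p \<noteq> Suc i)" if p: "p < i" for p
  proof -
    have M'p: "M' p = reflect i j (M p)" using p by (simp add: M'_def reflect_simps)
    have np: "M p \<noteq> i" "M p \<noteq> j" using Mj j p ij by (metis D(1) nat_less_le less_trans)+
    have ns: "\<not> stuck M p" using least p by blast
    show ?thesis
    proof (cases "i < M p \<and> M p < j")
      case False
      then have "M' p = M p" using np M'p by (auto simp: reflect_def)
      moreover have "M' (p - 1) = Suc p" if "1 \<le> p" "M (p - 1) = Suc p" "Suc p \<noteq> i"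
        using that p by (simp add: M'_def reflect_simps)
      moreover have "Suc p \<noteq> i" if "1 \<le> p" "M (p - 1) = Suc p"
      proof
        assume "Suc p = i"
        then have "p - 1 = M i" using that D(1)[of "p - 1"] by simp
        then show False using j ij p by simp
      qed
      moreover have "M p \<noteq> Suc i" if "Suc p = i" using st that by (auto simp: stuck_def)
      ultimately show ?thesis using ns unfolding stuck_def by auto
    next
      case True
      have "M p = p + 2 \<or> 1 \<le> p \<and> M (p - 1) = p + 1"
        using ns True p by (auto simp: stuck_def)
      then show ?thesis
      proof
        assume a: "M p = p + 2"
        then have "Suc p = i" using True p by linarith
        then show ?thesis using st a by (auto simp: stuck_def)
      next
        assume a: "1 \<le> p \<and> M (p - 1) = p + 1"
        have si: "Suc p \<noteq> i"
        proof
          assume "Suc p = i"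
          then have "p - 1 = M i" using a D(1)[of "p - 1"] by simp
          then show False using j ij p by simp
        qed
        then have "M' (p - 1) = Suc p" using a p by (simp add: M'_def reflect_simps)
        then show ?thesis using a si by (auto simp: stuck_def)
      qed
    qed
  qed
  then show "\<And>p. p < i \<Longrightarrow> \<not> stuck M' p" by blast
  show "stuck M' i"
    using st M'i j low[of "i - 1"] by (auto simp: stuck_def)
qed

text \<open>Positions before \<open>i\<close> are fixed by the reversal, hence so are their
  partners; these avoid \<open>i + 1\<close> and \<open>j - 1\<close>, which the reversal swaps and
  which are distinct because \<open>i + 4 \<le> j\<close>. The exchange commutes with the reversal,
  so the symmetry survives.\<close>

lemma stuck_toggle:
  assumes M: "M \<in> involutions K" and st: "stuck M i" and least: "\<And>p. p < i \<Longrightarrow> \<not> stuck M p"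
    and j: "j = M i" and sym: "reflect i j \<circ> M \<circ> reflect i j = M" and d: "i + 4 \<le> j"
  defines "\<tau> \<equiv> transpose (i + 1) (j - 1)"
  shows "\<And>q. q \<le> i \<Longrightarrow> toggle \<tau> M q = M q"
    and "reflect i j \<circ> toggle \<tau> M \<circ> reflect i j = toggle \<tau> M"
proof -
  note D = involutionsD[OF M]
  let ?\<rho> = "reflect i j"
  have rr: "?\<rho> (?\<rho> x) = x" for x by (simp add: reflect_simps)
  have rM: "?\<rho> (M x) = M (?\<rho> x)" for x
    using fun_cong[OF sym, of "?\<rho> x"] by (simp add: rr)
  have "?\<rho> (\<tau> x) = \<tau> (?\<rho> x)" for x
    using d by (auto simp: \<tau>_def Transposition.transpose_def reflect_def)
  then have "?\<rho> \<circ> toggle \<tau> M = toggle \<tau> M \<circ> ?\<rho>"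
    using rM by (intro toggle_commute) auto
  then have "?\<rho> (toggle \<tau> M x) = toggle \<tau> M (?\<rho> x)" for x by (metis comp_apply)
  then show "?\<rho> \<circ> toggle \<tau> M \<circ> ?\<rho> = toggle \<tau> M" by (auto simp: rr)
  fix q assume q: "q \<le> i"
  have nM: "M q \<noteq> i + 1 \<and> M q \<noteq> j - 1"
  proof (cases "q = i")
    case True then show ?thesis using j d by auto
  next
    case False
    then have "?\<rho> q = q" using q by (simp add: reflect_simps)
    then have "?\<rho> (M q) = M q" using rM by metis
    then show ?thesis using d by (auto simp: reflect_def split: if_splits)
  qed
  have "\<tau> (M q) = M q" "\<tau> q = q" using nM q d by (auto simp: \<tau>_def)
  then show "toggle \<tau> M q = M q" by (simp add: toggle_def)
qed

text \<open>
  Reversing the closed walk between the first stuck position and its partner pairs up the stuck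
  configurations. A configuration fixed by the reversal is a palindrome there, and then the
  second position and the last but one carry the same vertex and can be toggled.
\<close>

lemma parity_unstuck:
  assumes fin: "finite V" and sym: "\<And>a b. a \<in> V \<Longrightarrow> b \<in> V \<Longrightarrow> adj a b \<Longrightarrow> adj b a"
    and irr: "\<And>a. \<not> adj a a"
  shows "odd (card (folded_walks K V adj s t)) \<longleftrightarrow>
         odd (card {(M, v) \<in> folded_walks K V adj s t. \<forall>i. \<not> stuck M i})"
proof -
  let ?X = "folded_walks K V adj s t"
  let ?B = "{x \<in> ?X. \<exists>i. stuck (fst x) i}"
  define a where "a M = (LEAST i. stuck M i)" for M
  define \<rho> where "\<rho> M = reflect (a M) (M (a M))" for M
  define \<tau> where "\<tau> M = transpose (a M + 1) (M (a M) - 1)" for M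
  \<comment> \<open>Both branches keep the first stuck position and its partner, and a configuration
    fixed by the reversal stays fixed after the toggle. Hence the second application of
    \<open>f\<close> takes the same branch as the first.\<close>
  define f where "f x = (case x of (M, v) \<Rightarrow>
      if (\<rho> M \<circ> M \<circ> \<rho> M, v \<circ> \<rho> M) = (M, v) then (toggle (\<tau> M) M, v)
      else (\<rho> M \<circ> M \<circ> \<rho> M, v \<circ> \<rho> M))" for x :: "(nat \<Rightarrow> nat) \<times> (nat \<Rightarrow> 'a)"
  have finX: "finite ?X" by (rule finite_folded_walks[OF fin])
  have aI: "a M = i" if "stuck M i" "\<And>p. p < i \<Longrightarrow> \<not> stuck M p" for M i
    unfolding a_def using that by (intro Least_equality) (auto simp: not_less[symmetric])
  have "even (card ?B)"
  proof (rule even_card_involution[where f = f])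
    show "finite ?B" using finX by simp
    fix x assume x: "x \<in> ?B"
    obtain M v where xe: "x = (M, v)" by force
    from x xe have M: "M \<in> involutions K" and v: "v \<in> walk_maps K V adj s t" and vM: "v \<circ> M = v"
      and ex: "\<exists>i. stuck M i" by (auto simp: folded_walks_def)
    define i where "i = a M"
    define j where "j = M i"
    have st: "stuck M i" unfolding i_def a_def using ex by (rule LeastI_ex)
    have least: "\<not> stuck M p" if "p < i" for p using that unfolding i_def a_def by (rule not_less_Least)
    note D = involutionsD[OF M]
    have ij: "i < j" using st by (auto simp: stuck_def j_def)
    have jK: "j \<le> K" using ij D(1) D(2)[of j] j_def by (metis not_le nat_less_le)
    have eq: "v i = v j" using vM j_def by (metis comp_apply)
    have r: "\<rho> M = reflect i j" and tt: "\<tau> M = transpose (i + 1) (j - 1)"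
      by (simp_all add: \<rho>_def \<tau>_def i_def j_def)
    note C = stuck_conj[OF M st least j_def]
    let ?M' = "reflect i j \<circ> M \<circ> reflect i j"
    show "f x \<in> ?B \<and> f x \<noteq> x \<and> f (f x) = x"
    proof (cases "(?M', v \<circ> reflect i j) = (M, v)")
      case False
      have aM': "a ?M' = i" by (rule aI[OF C(3,4)])
      have rM': "\<rho> ?M' = reflect i j" using aM' C(2) by (simp add: \<rho>_def)
      have fx: "f x = (?M', v \<circ> reflect i j)" using False by (simp only: f_def xe prod.case r if_False)
      have "v \<circ> reflect i j \<circ> ?M' = v \<circ> reflect i j"
        using vM by (auto simp: fun_eq_iff reflect_simps)
      then have "f x \<in> ?B"
        using C(1,3) walk_maps_reflect[OF v less_imp_le[OF ij] jK eq sym] by (auto simp: fx folded_walks_def)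
      moreover have "f x \<noteq> x" using fx xe False by simp
      moreover have "f (f x) = x"
      proof -
        have 1: "reflect i j \<circ> ?M' \<circ> reflect i j = M" "v \<circ> reflect i j \<circ> reflect i j = v"
          by (auto simp: fun_eq_iff reflect_simps)
        have "f (f x) = (reflect i j \<circ> ?M' \<circ> reflect i j, v \<circ> reflect i j \<circ> reflect i j)"
          by (subst fx, simp only: f_def prod.case rM' 1 False[symmetric] if_False)
        then show ?thesis using 1 xe by simp
      qed
      ultimately show ?thesis by blast
    next
      case True
      then have sM: "?M' = M" and sv: "v \<circ> reflect i j = v" by auto
      have pal: "v (reflect i j p) = v p" for p using sv by (metis comp_apply)
      \<comment> \<open>A palindrome of odd length would carry the same vertex on its two middle
        positions, which is a loop.\<close>
      have "even (j - i)"
      proof (rule ccontr)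
        assume "odd (j - i)"
        then obtain e where e: "j - i = 2 * e + 1" by (rule oddE)
        have "reflect i j (i + e) = Suc (i + e)" using e ij by (auto simp: reflect_def)
        then have "v (i + e) = v (Suc (i + e))" using pal by metis
        moreover have "adj (v (i + e)) (v (Suc (i + e)))"
          using v e jK ij by (auto simp: walk_maps_def)
        ultimately show False using irr by simp
      qed
      moreover have "j \<noteq> i + 2" using st by (auto simp: stuck_def j_def)
      ultimately have d: "i + 4 \<le> j" using ij by presburger
      let ?t = "transpose (i + 1) (j - 1)"
      note T = stuck_toggle[OF M st least j_def sM d]
      have tI: "?t \<in> involutions K" using d jK by (intro transpose_involutions) auto
      have t1: "?t \<circ> ?t = id" by simp
      have t2: "?t \<noteq> id" using d by (simp add: transpose_eq_id_iff)
      have MM: "M \<circ> M = id" using M by (simp add: involutions_def)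
      have "reflect i j (i + 1) = j - 1" using d by (simp add: reflect_def)
      then have "v (i + 1) = v (j - 1)" using pal by metis
      then have vt: "v \<circ> ?t = v" by (auto simp: fun_eq_iff Transposition.transpose_def)
      let ?M2 = "toggle ?t M"
      have s2: "stuck ?M2 p = stuck M p" if "p \<le> i" for p
        using T(1)[of p] T(1)[of "p - 1"] that by (auto simp: stuck_def)
      have a2: "a ?M2 = i" using s2 st least by (intro aI) auto
      have j2: "?M2 i = j" using T(1)[of i] by (simp add: j_def)
      have fx: "f x = (?M2, v)" using True by (simp add: f_def xe r tt)
      have r2: "\<rho> ?M2 = reflect i j" and tt2: "\<tau> ?M2 = ?t" using a2 j2 by (simp_all add: \<rho>_def \<tau>_def)
      have "stuck ?M2 i" using s2 st by simp
      then have "f x \<in> ?B" using fx toggle_involutions[OF M tI] comp_toggle[OF vt vM] v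
        by (auto simp: folded_walks_def)
      moreover have "f x \<noteq> x" using fx xe toggle_facts(2)[OF t1 t2 MM] by simp
      moreover have "f (f x) = (toggle ?t ?M2, v)"
        by (subst fx, simp only: f_def prod.case r2 tt2 T(2) sv simp_thms if_True)
      then have "f (f x) = x" using xe toggle_facts(3)[OF t1 t2 MM] by simp
      ultimately show ?thesis by blast
    qed
  qed
  moreover have "card ?X = card (?X - ?B) + card ?B"
    using card_Diff_subset[of ?B ?X] card_mono[OF finX, of ?B] finX by auto
  moreover have "?X - ?B = {(M, v) \<in> ?X. \<forall>i. \<not> stuck M i}" by auto
  ultimately show ?thesis by simp
qed

section \<open>Binary constraints and variable elimination\<close>

type_synonym csp = "nat \<Rightarrow> nat \<Rightarrow> nat \<Rightarrow> nat \<Rightarrow> bool"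

text \<open>Every ordered pair of variables carries a constraint, so a relation may be stored in
  either direction, and the diagonal \<open>R x x\<close> acts as a unary constraint.\<close>

definition sols :: "nat \<Rightarrow> nat \<Rightarrow> csp \<Rightarrow> (nat \<Rightarrow> nat) set" where
  "sols N n R = {z \<in> {..<N} \<rightarrow>\<^sub>E {..<n}. \<forall>x<N. \<forall>y<N. R x y (z x) (z y)}"

text \<open>A semantic notion of edge: constraints that hold for all values do not count, so the
  constraint graph can be read off the table at any time.\<close>

definition linked :: "nat \<Rightarrow> csp \<Rightarrow> nat \<Rightarrow> nat \<Rightarrow> bool" where
  "linked n R x y \<longleftrightarrow> x \<noteq> y \<and> (\<exists>u<n. \<exists>v<n. \<not> (R x y u v \<and> R y x v u))"

primrec search :: "(nat \<Rightarrow> bool) \<Rightarrow> nat \<Rightarrow> nat \<Rightarrow> nat" where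
  "search P d 0 = d"
| "search P d (Suc i) = (if P i then i else search P d i)"

text \<open>Sums \<open>x\<close> out modulo 2. The variable is not removed but forced to 0, so that
  the index set never changes. The new constraint sits at the ordered pair \<open>(a, b)\<close>;
  for \<open>a = b\<close> it is unary, and \<open>a = b = x\<close> encodes a variable without
  neighbours, where only the parity of its own admissible values is tested.\<close>

definition project :: "nat \<Rightarrow> csp \<Rightarrow> nat \<Rightarrow> nat \<Rightarrow> nat \<Rightarrow> csp" where
  "project n R x a b = (\<lambda>y z u v.
     (if y = x \<or> z = x then y = z \<longrightarrow> u = 0 else R y z u v) \<and>
     (y = a \<and> z = b \<longrightarrow> odd (\<Sum>w<n. of_bool (R x x w w \<and>
        (a \<noteq> x \<longrightarrow> R x a w u \<and> R a x u w \<and> R x b w v \<and> R b x v w)) :: nat)))"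

text \<open>\<open>search\<close> returns the greatest hit. The defaults encode small degrees: no
  neighbour makes both partners equal to \<open>x\<close>, a single neighbour makes them equal to
  each other.\<close>

definition second_partner :: "nat \<Rightarrow> nat \<Rightarrow> csp \<Rightarrow> nat \<Rightarrow> nat" where
  "second_partner N n R x = search (linked n R x) x N"

definition first_partner :: "nat \<Rightarrow> nat \<Rightarrow> csp \<Rightarrow> nat \<Rightarrow> nat" where
  "first_partner N n R x =
     search (\<lambda>y. y \<noteq> second_partner N n R x \<and> linked n R x y) (second_partner N n R x) N"

definition eliminate :: "nat \<Rightarrow> nat \<Rightarrow> csp \<Rightarrow> nat \<Rightarrow> csp" where
  "eliminate N n R x = project n R x (first_partner N n R x) (second_partner N n R x)"

text \<open>Substitution of \<open>g\<close> for \<open>s\<close>: constraints between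
  \<open>s\<close> and another variable become unary there, and \<open>s\<close> remains as a dummy
  with value 0 that remembers whether \<open>g\<close> was admissible.\<close>

definition pin :: "csp \<Rightarrow> nat \<Rightarrow> nat \<Rightarrow> csp" where
  "pin R s g = (\<lambda>y z u v.
     if y = s \<or> z = s then y = z \<longrightarrow> u = 0 \<and> R s s g g
     else R y z u v \<and> (y = z \<longrightarrow> R y s u g \<and> R s y g u))"

lemma linked_sym: "linked n R x y \<longleftrightarrow> linked n R y x"
  unfolding linked_def by blast

lemma finite_sols: "finite (sols N n R)"
  unfolding sols_def by (rule finite_subset[OF _ finite_PiE[of "{..<N}" "\<lambda>_. {..<n}"]]) auto

lemma solsD:
  assumes "z \<in> sols N n R"
  shows "x < N \<Longrightarrow> z x < n" "x \<ge> N \<Longrightarrow> z x = undefined"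
    "x < N \<Longrightarrow> y < N \<Longrightarrow> R x y (z x) (z y)"
  using assms by (auto simp: sols_def PiE_def Pi_def extensional_def)

lemma solsI:
  assumes "\<And>x. x < N \<Longrightarrow> z x < n" "\<And>x. x \<ge> N \<Longrightarrow> z x = undefined"
    "\<And>x y. x < N \<Longrightarrow> y < N \<Longrightarrow> R x y (z x) (z y)"
  shows "z \<in> sols N n R"
  using assms by (auto simp: sols_def PiE_def Pi_def extensional_def)

lemma sols_cong:
  assumes "\<And>x y u v. x < N \<Longrightarrow> y < N \<Longrightarrow> u < n \<Longrightarrow> v < n \<Longrightarrow> R x y u v \<longleftrightarrow> R' x y u v"
  shows "sols N n R = sols N n R'"
proof -
  have "z \<in> sols N n R'" if "z \<in> sols N n R" "\<And>x y u v. x < N \<Longrightarrow> y < N \<Longrightarrow> u < n \<Longrightarrow> v < n \<Longrightarrow> R x y u v \<longleftrightarrow> R' x y u v"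
    for z and R R' :: csp
    using solsD[OF that(1)] that(2) by (intro solsI) metis+
  from this[of _ R R'] this[of _ R' R] show ?thesis using assms by blast
qed

lemma odd_sum_iff: "finite A \<Longrightarrow> odd (sum f A) \<longleftrightarrow> odd (card {a \<in> A. odd (f a)})" for f :: "'a \<Rightarrow> nat"
  by (simp add: even_sum_iff)

text \<open>Solutions are fibred over their restriction away from \<open>x\<close>. The size of a
  fibre depends only on the values at the two neighbours, and modulo 2 only the fibres of odd size
  count.\<close>

lemma parity_project:
  assumes n: "0 < n" and x: "x < N" and ab: "a < N" "b < N" "a = x \<longleftrightarrow> b = x"
    and free: "\<And>y. y < N \<Longrightarrow> linked n R x y \<Longrightarrow> y = a \<or> y = b"
  shows "odd (card (sols N n R)) \<longleftrightarrow> odd (card (sols N n (project n R x a b)))"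
proof -
  define P where "P z w \<longleftrightarrow> R x x w w \<and>
    (a \<noteq> x \<longrightarrow> R x a w (z a) \<and> R a x (z a) w \<and> R x b w (z b) \<and> R b x (z b) w)" for z :: "nat \<Rightarrow> nat" and w
  define W where "W z = {w \<in> {..<n}. P z w}" for z
  define B where "B = sols N n (\<lambda>y y' u v. if y = x \<or> y' = x then y = y' \<longrightarrow> u = 0 else R y y' u v)"
  have finB: "finite B" unfolding B_def by (rule finite_sols)
  have "bij_betw (\<lambda>z. (z(x := 0), z x)) (sols N n R) (Sigma B W)"
  proof (rule bij_betw_byWitness[where f' = "\<lambda>(z, w). z(x := w)"])
    show "\<forall>z\<in>sols N n R. (\<lambda>(z, w). z(x := w)) (z(x := 0), z x) = z" by simp
    have z0: "z x = 0" if "z \<in> B" for z using solsD(3)[OF that[unfolded B_def] x x] by simp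
    then show "\<forall>p\<in>Sigma B W. (\<lambda>z. (z(x := 0), z x)) ((\<lambda>(z, w). z(x := w)) p) = p" by auto
    show "(\<lambda>z. (z(x := 0), z x)) ` sols N n R \<subseteq> Sigma B W"
    proof clarsimp
      fix z assume z: "z \<in> sols N n R"
      note D = solsD[OF z]
      show "z(x := 0) \<in> B \<and> z x \<in> W (z(x := 0))"
      proof
        show "z(x := 0) \<in> B" unfolding B_def by (rule solsI) (use D n x in auto)
        show "z x \<in> W (z(x := 0))" using D x ab by (auto simp: W_def P_def)
      qed
    qed
    show "(\<lambda>(z, w). z(x := w)) ` Sigma B W \<subseteq> sols N n R"
    proof clarsimp
      fix z w assume z: "z \<in> B" and w: "w \<in> W z"
      note D = solsD[OF z[unfolded B_def]]
      have w': "w < n" "P z w" using w by (auto simp: W_def)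
      have link: "R x y w (z y) \<and> R y x (z y) w" if y: "y < N" "y \<noteq> x" for y
      proof (cases "linked n R x y")
        case True
        then have "y = a \<or> y = b" by (rule free[OF y(1)])
        then show ?thesis using w'(2) y ab unfolding P_def by blast
      next
        case False
        then show ?thesis using w'(1) D(1)[OF y(1)] y(2) by (auto simp: linked_def)
      qed
      have "R x x w w" using w' by (simp add: P_def)
      then show "z(x := w) \<in> sols N n R"
        by (intro solsI) (use D w' x link in \<open>auto split: if_splits\<close>)
    qed
  qed
  then have "card (sols N n R) = card (Sigma B W)" by (rule bij_betw_same_card)
  also have "\<dots> = (\<Sum>z\<in>B. card (W z))" using finB by (simp add: W_def)
  finally have "odd (card (sols N n R)) \<longleftrightarrow> odd (card {z \<in> B. odd (card (W z))})"
    using odd_sum_iff[OF finB] by simp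
  moreover have "{z \<in> B. odd (card (W z))} = sols N n (project n R x a b)"
  proof -
    have cw: "card (W z) = (\<Sum>w<n. of_bool (R x x w w \<and>
        (a \<noteq> x \<longrightarrow> R x a w (z a) \<and> R a x (z a) w \<and> R x b w (z b) \<and> R b x (z b) w)))" for z
      by (simp add: W_def P_def sum.inter_filter[symmetric] of_bool_def)
    show ?thesis
    proof (intro equalityI subsetI)
      fix z assume "z \<in> {z \<in> B. odd (card (W z))}"
      then have z: "z \<in> B" "odd (card (W z))" by auto
      note D = solsD[OF z(1)[unfolded B_def]]
      show "z \<in> sols N n (project n R x a b)"
        by (rule solsI) (use D z(2) in \<open>auto simp: project_def cw\<close>)
    next
      fix z assume z: "z \<in> sols N n (project n R x a b)"
      note D = solsD[OF z]
      have "z \<in> B" unfolding B_def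
        by (rule solsI) (use D in \<open>auto simp: project_def\<close>)
      moreover have "odd (card (W z))" using D(3)[OF ab(1,2)] by (simp add: project_def cw)
      ultimately show "z \<in> {z \<in> B. odd (card (W z))}" by simp
    qed
  qed
  ultimately show ?thesis by simp
qed

lemma card_sols_pin:
  assumes n: "0 < n" and s: "s < N"
  shows "card (sols N n R) = (\<Sum>g<n. card (sols N n (pin R s g)))"
proof -
  have "card (sols N n (pin R s g)) = card {z \<in> sols N n R. z s = g}" if g: "g < n" for g
  proof -
    have "bij_betw (\<lambda>z. z(s := 0)) {z \<in> sols N n R. z s = g} (sols N n (pin R s g))"
    proof (rule bij_betw_byWitness[where f' = "\<lambda>z. z(s := g)"])
      show "\<forall>z\<in>{z \<in> sols N n R. z s = g}. (z(s := 0))(s := g) = z" by auto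
      show "\<forall>z\<in>sols N n (pin R s g). (z(s := g))(s := 0) = z"
      proof
        fix z assume "z \<in> sols N n (pin R s g)"
        from solsD(3)[OF this s s] have "z s = 0" by (simp add: pin_def)
        then show "(z(s := g))(s := 0) = z" by auto
      qed
      show "(\<lambda>z. z(s := 0)) ` {z \<in> sols N n R. z s = g} \<subseteq> sols N n (pin R s g)"
      proof clarsimp
        fix z assume z: "z \<in> sols N n R" "g = z s"
        note D = solsD[OF z(1)]
        show "z(s := 0) \<in> sols N n (pin R s (z s))"
          by (rule solsI) (use D n s in \<open>auto simp: pin_def\<close>)
      qed
      show "(\<lambda>z. z(s := g)) ` sols N n (pin R s g) \<subseteq> {z \<in> sols N n R. z s = g}"
      proof clarsimp
        fix z assume z: "z \<in> sols N n (pin R s g)"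
        note D = solsD[OF z]
        have D': "R x x (z x) (z x) \<and> R x s (z x) g \<and> R s x g (z x)" if "x < N" "x \<noteq> s" for x
          using D(3)[OF that(1) that(1)] that by (auto simp: pin_def)
        have D'': "R x y (z x) (z y)" if "x < N" "y < N" "x \<noteq> s" "y \<noteq> s" for x y
          using D(3)[OF that(1,2)] that by (auto simp: pin_def)
        have Ds: "R s s g g" using D(3)[OF s s] by (simp add: pin_def)
        show "z(s := g) \<in> sols N n R"
          by (rule solsI) (use D D' D'' Ds g s in auto)
      qed
    qed
    from bij_betw_same_card[OF this] show ?thesis by (rule sym)
  qed
  moreover have "card (sols N n R) = (\<Sum>g<n. card {z \<in> sols N n R. z s = g})"
  proof -
    have "sols N n R = (\<Union>g<n. {z \<in> sols N n R. z s = g})" using solsD(1)[OF _ s] by auto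
    then have "card (sols N n R) = card (\<Union>g<n. {z \<in> sols N n R. z s = g})" by simp
    also have "\<dots> = (\<Sum>g<n. card {z \<in> sols N n R. z s = g})"
      by (rule card_UN_disjoint) (auto intro: finite_subset[OF _ finite_sols])
    finally show ?thesis .
  qed
  ultimately show ?thesis by simp
qed

section \<open>Degrees of the constraint graph under elimination\<close>

lemma search_cases: "search P d m = d \<and> (\<forall>i<m. \<not> P i) \<or> search P d m < m \<and> P (search P d m)"
proof (induction m)
  case (Suc m)
  then show ?case by (cases "P m") (auto simp: less_Suc_eq)
qed simp

definition neighbours :: "nat \<Rightarrow> nat \<Rightarrow> csp \<Rightarrow> nat \<Rightarrow> nat set" where
  "neighbours N n R x = {y \<in> {..<N}. linked n R x y}"

lemma finite_neighbours: "finite (neighbours N n R x)"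
  by (simp add: neighbours_def)

lemma neighbours_sym: "x < N \<Longrightarrow> y \<in> neighbours N n R x \<Longrightarrow> x \<in> neighbours N n R y"
  by (auto simp: neighbours_def linked_sym)

lemma partners:
  fixes R :: csp and n :: nat
  assumes x: "x < N"
  defines "a \<equiv> first_partner N n R x" and "b \<equiv> second_partner N n R x"
  shows "a < N" "b < N" "a = x \<longleftrightarrow> b = x" "a \<noteq> b \<Longrightarrow> a \<in> neighbours N n R x"
    "b \<noteq> x \<Longrightarrow> b \<in> neighbours N n R x"
    "card (neighbours N n R x) \<le> 2 \<Longrightarrow> neighbours N n R x \<subseteq> {a, b}"
proof -
  let ?N = "neighbours N n R x"
  have nx: "\<not> linked n R x x" by (simp add: linked_def)
  have b: "b = x \<and> ?N = {} \<or> b \<in> ?N"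
    using search_cases[of "linked n R x" x N] by (auto simp: b_def second_partner_def neighbours_def)
  have a: "a = b \<and> ?N \<subseteq> {b} \<or> a \<noteq> b \<and> a \<in> ?N"
  proof -
    have "a = search (\<lambda>y. y \<noteq> b \<and> linked n R x y) b N"
      by (simp add: a_def b_def first_partner_def)
    then have "a = b \<and> (\<forall>i<N. \<not> (i \<noteq> b \<and> linked n R x i)) \<or> a < N \<and> a \<noteq> b \<and> linked n R x a"
      using search_cases[of "\<lambda>y. y \<noteq> b \<and> linked n R x y" b N] by simp
    then show ?thesis
    proof
      assume "a = b \<and> (\<forall>i<N. \<not> (i \<noteq> b \<and> linked n R x i))"
      then show ?thesis unfolding neighbours_def by blast
    qed (simp add: neighbours_def)
  qed
  show "b < N" "a < N" using a b x by (auto simp: neighbours_def)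
  show "a = x \<longleftrightarrow> b = x" using a b nx by (auto simp: neighbours_def)
  show "a \<noteq> b \<Longrightarrow> a \<in> ?N" "b \<noteq> x \<Longrightarrow> b \<in> ?N" using a b by auto
  assume le: "card ?N \<le> 2"
  show "?N \<subseteq> {a, b}"
  proof
    fix y assume y: "y \<in> ?N"
    show "y \<in> {a, b}"
    proof (rule ccontr)
      assume ny: "y \<notin> {a, b}"
      then have "a \<noteq> b" "a \<in> ?N" "b \<in> ?N" using a b y by auto
      then have "{a, b, y} \<subseteq> ?N" "card {a, b, y} = 3" using y ny by auto
      then show False using le card_mono[OF finite_neighbours, of "{a, b, y}" N n R x] by simp
    qed
  qed
qed

lemma parity_eliminate:
  assumes "0 < n" "x < N" "card (neighbours N n R x) \<le> 2"
  shows "odd (card (sols N n R)) \<longleftrightarrow> odd (card (sols N n (eliminate N n R x)))"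
  unfolding eliminate_def
  using partners(1-3)[OF assms(2), of n R] partners(6)[OF assms(2,3)]
  by (intro parity_project assms(1,2)) (auto simp: neighbours_def)

lemma linked_eliminate:
  assumes x: "x < N" and l: "linked n (eliminate N n R x) y z" and yz: "y < N" "z < N"
  shows "y \<noteq> x \<and> z \<noteq> x \<and> (linked n R y z \<or> y \<in> neighbours N n R x \<and> z \<in> neighbours N n R x)"
proof -
  let ?a = "first_partner N n R x" and ?b = "second_partner N n R x"
  note p = partners[OF x, of n R]
  have "y \<noteq> z" using l by (simp add: linked_def)
  obtain u v where uv: "u < n" "v < n" "\<not> (eliminate N n R x y z u v \<and> eliminate N n R x z y v u)"
    using l by (auto simp: linked_def)
  have xab: "\<not> (x = ?a \<and> z = ?b)" "\<not> (x = ?b \<and> z = ?a)" if "z \<noteq> x" for z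
    using p(3) that by metis+
  have "y \<noteq> x"
  proof
    assume "y = x"
    then show False using uv(3) \<open>y \<noteq> z\<close> xab[of z] by (auto simp: eliminate_def project_def)
  qed
  moreover have "z \<noteq> x"
  proof
    assume "z = x"
    then show False using uv(3) \<open>y \<noteq> z\<close> xab[of y] by (auto simp: eliminate_def project_def)
  qed
  moreover have "linked n R y z" if "\<not> (y = ?a \<and> z = ?b)" "\<not> (z = ?a \<and> y = ?b)"
    using uv that calculation \<open>y \<noteq> z\<close> unfolding eliminate_def project_def linked_def by auto
  moreover have "?a \<in> neighbours N n R x \<and> ?b \<in> neighbours N n R x" if "y = ?a \<and> z = ?b \<or> z = ?a \<and> y = ?b"
    using p(4,5) that \<open>y \<noteq> z\<close> calculation(1,2) by metis
  ultimately show ?thesis by metis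
qed

text \<open>A partner of \<open>x\<close> loses the neighbour \<open>x\<close> and gains at most the
  other partner; all other variables gain nothing. Once every degree is at most two, any order of
  elimination works.\<close>

lemma neighbours_eliminate:
  assumes x: "x < N" and y: "y < N"
  shows "card (neighbours N n (eliminate N n R x) y) \<le> card (neighbours N n R y)"
proof -
  let ?R = "eliminate N n R x"
  let ?a = "first_partner N n R x" and ?b = "second_partner N n R x"
  note p = partners[OF x, of n R]
  have old: "linked n R y z" if "linked n ?R y z" "\<not> (y = ?a \<and> z = ?b)" "\<not> (z = ?a \<and> y = ?b)" "z < N" for z
  proof -
    have "y \<noteq> x" "z \<noteq> x" "y \<noteq> z" using linked_eliminate[OF x that(1) y that(4)] that(1) by (auto simp: linked_def)
    then show ?thesis using that(1-3) unfolding eliminate_def project_def linked_def by auto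
  qed
  show ?thesis
  proof (cases "?a \<noteq> ?b \<and> y \<in> {?a, ?b}")
    case True
    define c where "c = (if y = ?a then ?b else ?a)"
    have xy: "x \<in> neighbours N n R y"
    proof -
      have "?b \<noteq> x" using True p(3) by metis
      then have "y \<in> neighbours N n R x" using True p(4,5) by auto
      then show ?thesis by (rule neighbours_sym[OF x])
    qed
    have "neighbours N n ?R y \<subseteq> insert c (neighbours N n R y - {x})"
      using old linked_eliminate[OF x _ y] True by (auto simp: neighbours_def c_def)
    then have "card (neighbours N n ?R y) \<le> card (insert c (neighbours N n R y - {x}))"
      by (intro card_mono) (auto simp: finite_neighbours)
    also have "\<dots> \<le> Suc (card (neighbours N n R y - {x}))" by (rule card_insert_le_m1) auto
    also have "\<dots> = card (neighbours N n R y)"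
      using xy finite_neighbours by (metis card.remove)
    finally show ?thesis .
  next
    case False
    have "linked n R y z" if "linked n ?R y z" "z < N" for z
    proof -
      have "y \<noteq> z" using that(1) by (simp add: linked_def)
      then show ?thesis using old[OF that(1) _ _ that(2)] False by auto
    qed
    then have "neighbours N n ?R y \<subseteq> neighbours N n R y" by (auto simp: neighbours_def)
    then show ?thesis by (intro card_mono finite_neighbours)
  qed
qed

lemma linked_pin: "linked n (pin R s g) y z \<Longrightarrow> linked n R y z \<and> y \<noteq> s \<and> z \<noteq> s"
  unfolding linked_def pin_def by (auto split: if_splits)

section \<open>Hubs of a folded walk\<close>

text \<open>The second conjunct breaks ties in chains of overlapping pairs
  \<open>(x - 1, x + 1)\<close>, \<open>(x, x + 2)\<close>: the tip of one hair is never the base of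
  another.\<close>

definition hair :: "(nat \<Rightarrow> nat) \<Rightarrow> nat \<Rightarrow> bool" where
  "hair M x \<longleftrightarrow> M x = x + 2 \<and> \<not> (1 \<le> x \<and> M (x - 1) = x + 1)"

definition tip :: "(nat \<Rightarrow> nat) \<Rightarrow> nat \<Rightarrow> bool" where
  "tip M x \<longleftrightarrow> 1 \<le> x \<and> hair M (x - 1)"

text \<open>Without stuck positions, these are the bases of hairs and the positions, other than
  tips, that are paired with a tip: the candidates for degree three. The far end of a hair is left
  out because \<open>fold_csp\<close> drops its edge from the tip.\<close>

definition hub :: "(nat \<Rightarrow> nat) \<Rightarrow> nat \<Rightarrow> bool" where
  "hub M x \<longleftrightarrow> M x \<noteq> x \<and> \<not> tip M x \<and> \<not> (2 \<le> x \<and> hair M (x - 2))"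

primrec rank :: "(nat \<Rightarrow> nat) \<Rightarrow> nat \<Rightarrow> nat" where
  "rank M 0 = 0"
| "rank M (Suc x) = rank M x + of_bool (hub M x)"

text \<open>Ranks start at 0, so with residue 2 the number of pinned hubs below \<open>m\<close> is
  exactly \<open>rank M m div 3\<close>.\<close>

definition pinned :: "(nat \<Rightarrow> nat) \<Rightarrow> nat \<Rightarrow> bool" where
  "pinned M x \<longleftrightarrow> hub M x \<and> rank M x mod 3 = 2"

text \<open>The edge leaving a tip is omitted: the position after the tip carries the vertex of the
  base, so this edge is the one entering the tip, reversed. The omission brings tips and far ends of
  hairs down to degree two. The parameter \<open>lo\<close> bounds all vertices from below, which
  cycles need.\<close>

definition fold_csp :: "(nat \<Rightarrow> nat \<Rightarrow> bool) \<Rightarrow> nat \<Rightarrow> nat \<Rightarrow> nat \<Rightarrow> nat \<Rightarrow> (nat \<Rightarrow> nat) \<Rightarrow> csp" where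
  "fold_csp adj K lo s t M = (\<lambda>x y u v.
     (y = Suc x \<and> \<not> tip M x \<longrightarrow> adj u v) \<and> (y = M x \<longrightarrow> u = v) \<and>
     (x = y \<longrightarrow> lo \<le> u \<and> (x = 0 \<longrightarrow> u = s) \<and> (x = K \<longrightarrow> u = t)))"

lemma sols_fold_csp:
  assumes M: "M \<in> involutions K" and sym: "\<And>u v. u < n \<Longrightarrow> v < n \<Longrightarrow> adj u v \<Longrightarrow> adj v u"
  shows "sols (Suc K) n (fold_csp adj K lo s t M) = {v \<in> walk_maps K {lo..<n} adj s t. v \<circ> M = v}"
proof (intro equalityI subsetI)
  note D = involutionsD[OF M]
  fix z assume z: "z \<in> sols (Suc K) n (fold_csp adj K lo s t M)"
  note S = solsD[OF z]
  have ends: "lo \<le> z x" "x = 0 \<longrightarrow> z x = s" "x = K \<longrightarrow> z x = t" if "x \<le> K" for x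
    using S(3)[of x x] that by (auto simp: fold_csp_def)
  have eq: "z (M x) = z x" for x
  proof (cases "x \<le> K")
    case True
    then show ?thesis using S(3)[of x "M x"] D(3)[OF True] by (simp add: fold_csp_def)
  qed (use D(2) in simp)
  have e1: "adj (z x) (z (Suc x))" if "x < K" "\<not> tip M x" for x
    using S(3)[of x "Suc x"] that by (simp add: fold_csp_def)
  have e2: "adj (z x) (z (Suc x))" if x: "x < K" "tip M x" for x
  proof -
    obtain y where y: "x = Suc y" "hair M y" using x(2) by (cases x) (auto simp: tip_def)
    have "\<not> tip M y" using y(2) by (cases y) (auto simp: tip_def hair_def)
    then have "adj (z y) (z x)" using e1[of y] x(1) y(1) by simp
    moreover have "z (Suc x) = z y" using eq[of y] y by (simp add: hair_def)
    ultimately show ?thesis using sym S(1)[of x] S(1)[of y] x(1) y(1) by simp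
  qed
  have "z \<circ> M = z" using eq by auto
  moreover have "z \<in> walk_maps K {lo..<n} adj s t"
    unfolding walk_maps_def PiE_def Pi_def extensional_def
    using e1 e2 ends S(1,2) by (auto simp: less_Suc_eq_le not_le) blast
  ultimately show "z \<in> {v \<in> walk_maps K {lo..<n} adj s t. v \<circ> M = v}" by simp
next
  fix z assume z: "z \<in> {v \<in> walk_maps K {lo..<n} adj s t. v \<circ> M = v}"
  then have eq: "z (M x) = z x" for x by (metis (mono_tags, lifting) comp_apply mem_Collect_eq)
  show "z \<in> sols (Suc K) n (fold_csp adj K lo s t M)"
    by (rule solsI) (use z eq in \<open>auto simp: walk_maps_def fold_csp_def PiE_def Pi_def extensional_def less_Suc_eq_le\<close>)
qed

section \<open>Structure of involutions without stuck positions\<close>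

locale unstuck =
  fixes M :: "nat \<Rightarrow> nat" and K :: nat
  assumes inv: "M \<in> involutions K" and unstuck: "\<And>i. \<not> stuck M i"
begin

lemmas D = involutionsD[OF inv]

lemma hair_not_tip: "hair M x \<Longrightarrow> \<not> tip M x"
  by (cases x) (auto simp: tip_def hair_def)

lemma tip_not_hair: "hair M x \<Longrightarrow> tip M (Suc x)"
  by (simp add: tip_def)

text \<open>The exception in \<open>stuck\<close> mentions only the pair
  \<open>(x - 1, x + 1)\<close>. This pair is a true hair, since otherwise \<open>x\<close> would be
  paired with \<open>x - 2\<close> and not upwards.\<close>

lemma upward: "x < M x \<Longrightarrow> hair M x \<or> tip M x"
proof -
  assume up: "x < M x"
  show ?thesis
  proof (cases "1 \<le> x \<and> M (x - 1) = x + 1")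
    case True
    have "\<not> (1 \<le> x - 1 \<and> M (x - 1 - 1) = x - 1 + 1)"
    proof
      assume a: "1 \<le> x - 1 \<and> M (x - 1 - 1) = x - 1 + 1"
      moreover have "x - 1 - 1 = x - 2" "x - 1 + 1 = x" using a by auto
      ultimately have "M (x - 2) = x" by metis
      then have "M x = x - 2" using D(1) by metis
      then show False using up by simp
    qed
    then have "hair M (x - 1)" using True by (auto simp: hair_def)
    then show ?thesis using True by (simp add: tip_def)
  next
    case False
    then show ?thesis using unstuck[of x] up by (auto simp: stuck_def hair_def)
  qed
qed

text \<open>The last claim halves the number of hubs: the partner of a hub is the far end of its
  hair or a tip.\<close>

lemma hubD:
  assumes "hub M x"
  shows "M x \<noteq> x" "\<not> tip M x" "x \<le> K" "hair M x \<or> tip M (M x)" "\<not> hub M (M x)"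
proof -
  show nx: "M x \<noteq> x" and nt: "\<not> tip M x" using assms by (auto simp: hub_def)
  show "x \<le> K" using D(4) nx by blast
  have "\<not> hair M (M x)"
  proof
    assume h: "hair M (M x)"
    then have "x = M x + 2" using D(1)[of x] by (simp add: hair_def)
    then have "2 \<le> x" "x - 2 = M x" by linarith+
    then show False using h assms by (simp add: hub_def)
  qed
  then have "M x < x \<Longrightarrow> tip M (M x)" using upward[of "M x"] D(1) by auto
  moreover have "x < M x \<Longrightarrow> hair M x" using upward nt by blast
  ultimately show ht: "hair M x \<or> tip M (M x)" using nx by linarith
  show "\<not> hub M (M x)" using ht by (auto simp: hub_def hair_def)
qed

lemma rank_eq_card: "rank M m = card {x. x < m \<and> hub M x}"
proof (induction m)
  case (Suc m)
  have "{x. x < Suc m \<and> hub M x} = {x. x < m \<and> hub M x} \<union> (if hub M m then {m} else {})"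
    by (auto simp: less_Suc_eq)
  then show ?case using Suc by (simp add: card_Un_disjoint)
qed simp

lemma rank_bound: "rank M (Suc K) div 3 \<le> Suc K div 6"
proof -
  let ?H = "{x. x < Suc K \<and> hub M x}"
  have inj: "inj_on M ?H" by (metis D(1) inj_onI)
  have "?H \<inter> M ` ?H = {}" using hubD(5) by blast
  then have "2 * card ?H = card (?H \<union> M ` ?H)"
    using card_image[OF inj] by (simp add: card_Un_disjoint)
  also have "\<dots> \<le> card {..K}"
    by (rule card_mono) (use D(3) in \<open>auto simp: less_Suc_eq_le\<close>)
  finally have "2 * rank M (Suc K) \<le> Suc K" by (simp add: rank_eq_card del: rank.simps)
  then show ?thesis by linarith
qed

lemma rank_mono: "x \<le> y \<Longrightarrow> rank M x \<le> rank M y"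
  by (rule lift_Suc_mono_le) simp

lemma rank_inj: "hub M x \<Longrightarrow> hub M y \<Longrightarrow> rank M x = rank M y \<Longrightarrow> x = y"
proof (rule ccontr)
  have *: False if "hub M x" "x < y" "rank M x = rank M y" for x y
    using that rank_mono[of "Suc x" y] by simp
  assume "hub M x" "hub M y" "rank M x = rank M y" "x \<noteq> y"
  then show False using *[of x y] *[of y x] by linarith
qed

text \<open>Closure of path adjacency under elimination of non-hubs: the tips are taken off the
  path, and two positions stay related as long as no hub separates them.\<close>

definition clear :: "nat \<Rightarrow> nat \<Rightarrow> bool" where
  "clear y z \<longleftrightarrow> \<not> tip M y \<and> \<not> tip M z \<and> (\<forall>w. y < w \<and> w < z \<or> z < w \<and> w < y \<longrightarrow> \<not> hub M w)"

lemma rank_clear: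
  assumes "hub M y" "y < z" "clear y z"
  shows "rank M z = Suc (rank M y)"
proof -
  have "rank M (Suc y + i) = Suc (rank M y)" if "Suc y + i \<le> z" for i
    using that
  proof (induction i)
    case (Suc i)
    then have "\<not> hub M (Suc y + i)" using assms(3) by (auto simp: clear_def)
    then show ?case using Suc by simp
  qed (use assms(1) in simp)
  from this[of "z - Suc y"] show ?thesis using assms(2) by simp
qed

text \<open>Names a chord by one of its tips. For a hub this is the tip of its own hair or, if it is
  no base, the tip it is paired with. Comparing keys up to \<open>M\<close> then identifies
  everything attached to one chord: its ends and the bases of the tips among them. This makes
  \<open>chord\<close> transitive, as elimination of tips requires.\<close>

definition key :: "nat \<Rightarrow> nat" where
  "key x = (if tip M x then x else if hair M x then Suc x else M x)"

definition chord :: "nat \<Rightarrow> nat \<Rightarrow> bool" where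
  "chord y z \<longleftrightarrow> (tip M y \<or> hub M y) \<and> (tip M z \<or> hub M z) \<and> (key z = key y \<or> key z = M (key y))"

lemma chord_join: "chord x y \<Longrightarrow> chord x z \<Longrightarrow> chord y z"
  unfolding chord_def by (metis D(1))

lemma chord_sym: "chord x y \<Longrightarrow> chord y x"
  unfolding chord_def by (metis D(1))

text \<open>If \<open>y\<close> and \<open>z\<close> lie on different sides of \<open>x\<close>, the
  only additional position between them is \<open>x\<close>, which is no hub.\<close>

lemma clear_join: "clear x y \<Longrightarrow> clear x z \<Longrightarrow> \<not> hub M x \<Longrightarrow> clear y z"
  unfolding clear_def by (metis nat_neq_iff)

lemma clear_sym: "clear x y \<Longrightarrow> clear y x"
  unfolding clear_def by blast

lemma hair_hub: "hair M x \<Longrightarrow> hub M x"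
proof -
  assume h: "hair M x"
  have "\<not> (2 \<le> x \<and> hair M (x - 2))"
  proof
    assume "2 \<le> x \<and> hair M (x - 2)"
    then have "M (x - 2) = x" by (auto simp: hair_def)
    then have "M x = x - 2" using D(1) by metis
    moreover have "M x = x + 2" using h by (simp add: hair_def)
    ultimately show False by linarith
  qed
  then show ?thesis using h hair_not_tip by (auto simp: hub_def hair_def)
qed

text \<open>Start of the invariant for the first pass. A hair counts as a path edge because only its
  tip lies between its ends; the edge from base to tip and the pairs whose lower end is a tip are
  chords.\<close>

lemma edges_fold_csp:
  assumes l: "linked n (fold_csp adj K lo s t M) y z"
  shows "clear y z \<or> chord y z"
proof -
  have suc: "clear y (Suc y) \<or> chord y (Suc y)" if "\<not> tip M y" for y
  proof (cases "tip M (Suc y)")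
    case True
    then have "hair M y" by (simp add: tip_def)
    then show ?thesis using True that hair_hub by (auto simp: chord_def key_def)
  next
    case False
    then show ?thesis using that by (auto simp: clear_def)
  qed
  have mate: "clear y (M y) \<or> chord y (M y)" if up: "y < M y" for y
  proof -
    consider "tip M y" | "hair M y" "\<not> tip M y" using upward[OF up] by blast
    then show ?thesis
    proof cases
      case 1
      show ?thesis
      proof (cases "tip M (M y)")
        case True
        then show ?thesis using 1 by (auto simp: chord_def key_def)
      next
        case False
        have "\<not> hair M (M y)" using up D(1)[of y] by (auto simp: hair_def)
        moreover have "hub M (M y)"
        proof -
          have "\<not> (2 \<le> M y \<and> hair M (M y - 2))"
          proof
            assume a: "2 \<le> M y \<and> hair M (M y - 2)"
            then have "M (M y - 2) = M y" by (auto simp: hair_def)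
            then have "M y - 2 = y" using D(1) by metis
            then show False using a 1 hair_not_tip by auto
          qed
          then show ?thesis using False up D(1)[of y] by (simp add: hub_def)
        qed
        ultimately show ?thesis using 1 False D(1)[of y] by (auto simp: chord_def key_def)
      qed
    next
      case 2
      then have "M y = y + 2" by (simp add: hair_def)
      moreover have "\<not> tip M (y + 2)" using \<open>M y = y + 2\<close> by (auto simp: tip_def hair_def)
      moreover have "\<not> hub M (Suc y)" using tip_not_hair[OF 2(1)] by (simp add: hub_def)
      then have "\<forall>w. y < w \<and> w < y + 2 \<or> y + 2 < w \<and> w < y \<longrightarrow> \<not> hub M w"
        by (metis Suc_lessI add_2_eq_Suc' less_Suc_eq_le nat_less_le not_less order.asym)
      ultimately show ?thesis using 2 by (simp add: clear_def)
    qed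
  qed
  have ne: "y \<noteq> z" and "z = Suc y \<and> \<not> tip M y \<or> y = Suc z \<and> \<not> tip M z \<or> z = M y"
    using l D(1) by (auto simp: linked_def fold_csp_def)
  then consider "z = Suc y" "\<not> tip M y" | "y = Suc z" "\<not> tip M z" | "z = M y" "y < M y" | "z = M y" "M y < y"
    using ne by linarith
  then show ?thesis
  proof cases
    case 1 then show ?thesis using suc by blast
  next
    case 2 then show ?thesis using suc clear_sym chord_sym by blast
  next
    case 3 then show ?thesis using mate by blast
  next
    case 4
    then have "clear (M y) (M (M y)) \<or> chord (M y) (M (M y))" using mate[of "M y"] D(1) by simp
    then show ?thesis using 4 D(1) clear_sym chord_sym by simp blast
  qed
qed

text \<open>Non-hubs are of three kinds: an unpaired position has only its path neighbours, a tip
  has lost its successor, and the far end of a hair has lost its predecessor.\<close>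

lemma degree_fold_csp:
  assumes "\<not> hub M x"
  shows "card (neighbours N n (fold_csp adj K lo s t M) x) \<le> 2"
proof -
  let ?N = "neighbours N n (fold_csp adj K lo s t M) x"
  have sub: "y = Suc x \<and> \<not> tip M x \<or> x = Suc y \<and> \<not> tip M y \<or> y = M x \<and> M x \<noteq> x" if "y \<in> ?N" for y
    using that D(1) by (auto simp: neighbours_def linked_def fold_csp_def)
  have "\<exists>a b. ?N \<subseteq> {a, b}"
  proof -
    consider "M x = x" | "tip M x" | "2 \<le> x" "hair M (x - 2)" using assms by (auto simp: hub_def)
    then show ?thesis
    proof cases
      case 1
      then have "?N \<subseteq> {Suc x, x - 1}" using sub by fastforce
      then show ?thesis by blast
    next
      case 2
      then have "?N \<subseteq> {M x, x - 1}" using sub by fastforce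
      then show ?thesis by blast
    next
      case 3
      then have "tip M (x - 1)" by (simp add: tip_def numeral_2_eq_2)
      then have "?N \<subseteq> {Suc x, M x}" using sub by fastforce
      then show ?thesis by blast
    qed
  qed
  then obtain a b where "?N \<subseteq> {a, b}" by blast
  then have "card ?N \<le> card {a, b}" by (intro card_mono) auto
  also have "\<dots> \<le> 2" by (simp add: card_insert_if)
  finally show ?thesis .
qed

lemma degree_hubs:
  assumes y: "hub M y" "\<not> pinned M y"
  shows "card {z. z < N \<and> z \<noteq> y \<and> hub M z \<and> \<not> pinned M z \<and> (clear y z \<or> chord y z)} \<le> 2"
proof -
  \<comment> \<open>Rank of the only path neighbour that is not pinned: the next hub for residue 0,
    the previous one for residue 1.\<close>
  define r where "r = (if rank M y mod 3 = 0 then Suc (rank M y) else rank M y - 1)"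
  \<comment> \<open>The hub at the other end of the chord. From a base the chord leaves through the
    tip \<open>Suc y\<close>, and an end that is itself a tip is replaced by its base. An unpaired
    tip gives \<open>c = y\<close>, which is harmless.\<close>
  define c where "c = (if hair M y then if tip M (M (Suc y)) then M (Suc y) - 1 else M (Suc y) else M y - 1)"
  let ?A = "{z. z < N \<and> hub M z \<and> rank M z = r}"
  have A: "card ?A \<le> 1" using rank_inj by (auto simp: card_le_Suc0_iff_eq)
  have rank: "rank M z = r" if z: "z \<noteq> y" "hub M z" "\<not> pinned M z" "clear y z" for z
  proof (cases "y < z")
    case True
    then have "rank M z = Suc (rank M y)" using rank_clear y(1) z(4) by blast
    moreover have "rank M y mod 3 = 0"
      using y z \<open>rank M z = Suc (rank M y)\<close> unfolding pinned_def by (auto simp: mod_Suc split: if_splits)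
    ultimately show ?thesis by (simp add: r_def)
  next
    case False
    then have s: "rank M y = Suc (rank M z)" using rank_clear[of z y] z clear_sym by simp
    then have "rank M y mod 3 \<noteq> 0"
      using y z unfolding pinned_def by (auto simp: mod_Suc split: if_splits)
    then show ?thesis using s by (simp add: r_def)
  qed
  have mate: "z = c" if z: "z \<noteq> y" "hub M z" "chord y z" for z
  proof -
    have nt: "\<not> tip M y" "\<not> tip M z" using hubD(2) y(1) z(2) by auto
    have k: "key z = key y \<or> key z = M (key y)" using z(3) by (simp add: chord_def)
    have kz: "tip M (key z)" using hubD(4)[OF z(2)] nt(2) tip_not_hair by (auto simp: key_def)
    show ?thesis
    proof (cases "hair M y")
      case hy: True
      then have ky: "key y = Suc y" using nt by (simp add: key_def)
      show ?thesis
      proof (cases "hair M z")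
        case True
        then have "key z = Suc z" using nt by (simp add: key_def)
        then have "Suc z = M (Suc y)" using k ky z(1) by auto
        then show ?thesis using hy kz \<open>key z = Suc z\<close> by (auto simp: c_def)
      next
        case False
        then have kz': "key z = M z" using nt by (simp add: key_def)
        have "M z \<noteq> M (Suc y)"
        proof
          assume "M z = M (Suc y)"
          then have "z = Suc y" using D(1) by metis
          then show False using nt(2) tip_not_hair[OF hy] by simp
        qed
        then have "M z = Suc y" using k ky kz' by simp
        then have "z = M (Suc y)" using D(1) by metis
        then show ?thesis using hy nt(2) by (simp add: c_def)
      qed
    next
      case hy: False
      then have ky: "key y = M y" using nt by (simp add: key_def)
      have "key z \<noteq> y" using kz nt(1) by auto
      then have kk: "key z = M y" using k ky D(1) by simp
      have "hair M z"
      proof (rule ccontr)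
        assume "\<not> hair M z"
        then have "M z = M y" using kk nt by (simp add: key_def)
        then show False using D(1) z(1) by metis
      qed
      then have "Suc z = M y" using kk nt by (simp add: key_def)
      then show ?thesis using hy by (auto simp: c_def)
    qed
  qed
  have "{z. z < N \<and> z \<noteq> y \<and> hub M z \<and> \<not> pinned M z \<and> (clear y z \<or> chord y z)} \<subseteq> insert c ?A"
    using rank mate by blast
  then have "card {z. z < N \<and> z \<noteq> y \<and> hub M z \<and> \<not> pinned M z \<and> (clear y z \<or> chord y z)} \<le> card (insert c ?A)"
    by (intro card_mono) auto
  also have "\<dots> \<le> Suc (card ?A)" by (rule card_insert_le_m1) auto
  finally show ?thesis using A by simp
qed

end

section \<open>Evaluation by guessing and elimination\<close>

primrec iter :: "(nat \<Rightarrow> 'a \<Rightarrow> 'a) \<Rightarrow> 'a \<Rightarrow> nat \<Rightarrow> 'a" where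
  "iter f a 0 = a"
| "iter f a (Suc i) = f i (iter f a i)"

text \<open>Forgets the entries outside the index range. After it a system is determined by a finite
  table of bits, so it equals its own decoded encoding and the program can follow every step
  exactly.\<close>

definition trunc :: "nat \<Rightarrow> nat \<Rightarrow> csp \<Rightarrow> csp" where
  "trunc N n R = (\<lambda>x y u v. x < N \<and> y < N \<and> u < n \<and> v < n \<and> R x y u v)"

definition digit :: "nat \<Rightarrow> nat \<Rightarrow> nat \<Rightarrow> nat" where
  "digit b c i = c div b ^ i mod b"

text \<open>Pinned hubs have ranks 2, 5, 8 and so on, so \<open>rank M x div 3\<close> numbers them
  from 0 and selects the base \<open>n\<close> digit of the guess that serves as their
  value.\<close>

definition pins :: "(nat \<Rightarrow> nat) \<Rightarrow> nat \<Rightarrow> nat \<Rightarrow> nat \<Rightarrow> csp \<Rightarrow> nat \<Rightarrow> csp" where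
  "pins M N n g = iter (\<lambda>x R. if pinned M x then trunc N n (pin R x (digit n g (rank M x div 3))) else R)"

definition pass1 :: "(nat \<Rightarrow> nat) \<Rightarrow> nat \<Rightarrow> nat \<Rightarrow> csp \<Rightarrow> nat \<Rightarrow> csp" where
  "pass1 M N n = iter (\<lambda>x R. if hub M x then R else trunc N n (eliminate N n R x))"

text \<open>All variables are eliminated, also the pinned hubs and those removed by
  \<open>pass1\<close>: these are isolated by then, and a further elimination does not affect the
  parity.\<close>

definition pass2 :: "nat \<Rightarrow> nat \<Rightarrow> csp \<Rightarrow> nat \<Rightarrow> csp" where
  "pass2 N n = iter (\<lambda>x R. trunc N n (eliminate N n R x))"

definition accepts :: "nat \<Rightarrow> csp \<Rightarrow> bool" where
  "accepts N R \<longleftrightarrow> (\<forall>x<N. \<forall>y<N. R x y 0 0)"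

lemma sols_trunc: "sols N n (trunc N n R) = sols N n R"
  by (rule sols_cong) (simp add: trunc_def)

lemma linked_trunc: "x < N \<Longrightarrow> y < N \<Longrightarrow> linked n (trunc N n R) x y \<longleftrightarrow> linked n R x y"
  unfolding linked_def trunc_def by blast

lemma neighbours_trunc: "x < N \<Longrightarrow> neighbours N n (trunc N n R) x = neighbours N n R x"
  using linked_trunc by (auto simp: neighbours_def)

section \<open>Guesses as digit expansions\<close>

lemma sum_mod_div:
  fixes f :: "nat \<Rightarrow> nat \<Rightarrow> 'a::comm_monoid_add"
  shows "(\<Sum>g<a * b. f (g mod a) (g div a)) = (\<Sum>i<a. \<Sum>j<b. f i j)"
proof (induction b)
  case (Suc b)
  have "(\<Sum>g<a * Suc b. f (g mod a) (g div a)) =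
      (\<Sum>g<a * b. f (g mod a) (g div a)) + (\<Sum>g=a * b..<a * b + a. f (g mod a) (g div a))"
    by (simp add: lessThan_atLeast0 sum.atLeastLessThan_concat add.commute)
  also have "(\<Sum>g=a * b..<a * b + a. f (g mod a) (g div a)) = (\<Sum>i<a. f i b)"
    using sum.shift_bounds_nat_ivl[of "\<lambda>g. f (g mod a) (g div a)" 0 "a * b" a]
    by (simp add: lessThan_atLeast0 add.commute)
  finally show ?case using Suc by (simp add: sum.distrib)
qed simp

lemma digit_mod: "i < r \<Longrightarrow> digit n (g mod n ^ r) i = digit n g i"
proof -
  assume i: "i < r"
  then have r: "n ^ r = n ^ i * n ^ (r - i)" by (simp flip: power_add)
  have "n dvd n ^ (r - i)" using i by (simp add: dvd_power)
  then show ?thesis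
    by (cases "n = 0") (use i in \<open>simp_all add: digit_def r mod_mult2_eq mod_mod_cancel power_0_left\<close>)
qed

lemma rank_Suc_div: "rank M (Suc m) div 3 = rank M m div 3 + of_bool (pinned M m)"
proof -
  have "Suc a div 3 = a div 3 + of_bool (a mod 3 = 2)" for a :: nat
    by (simp add: div_Suc mod_Suc)
  then show ?thesis by (simp add: pinned_def)
qed

text \<open>The steps before \<open>m\<close> read only the lowest \<open>rank M m div 3\<close>
  digits of the guess.\<close>

lemma pins_mod:
  assumes "rank M m div 3 \<le> r"
  shows "pins M N n (g mod n ^ r) R m = pins M N n g R m"
  using assms
proof (induction m)
  case (Suc m)
  have "rank M m div 3 \<le> rank M (Suc m) div 3" by (rule div_le_mono) simp
  then have IH: "pins M N n (g mod n ^ r) R m = pins M N n g R m" using Suc by simp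
  show ?case
  proof (cases "pinned M m")
    case True
    then have "rank M m div 3 < r" using Suc.prems by (simp add: rank_Suc_div del: rank.simps)
    then show ?thesis using IH True by (simp add: pins_def digit_mod)
  next
    case False
    then show ?thesis using IH by (simp add: pins_def)
  qed
qed (simp add: pins_def)

text \<open>Passing a pinned hub adds one digit: the low part \<open>g mod n ^ r\<close> of a guess
  has been used by the earlier steps, and its top digit is the value of the new hub.\<close>

lemma card_sols_pins:
  assumes n: "0 < n" and m: "m \<le> N"
  shows "card (sols N n R) = (\<Sum>g<n ^ (rank M m div 3). card (sols N n (pins M N n g R m)))"
  using m
proof (induction m)
  case (Suc m)
  let ?r = "rank M m div 3"
  have IH: "card (sols N n R) = (\<Sum>g<n ^ ?r. card (sols N n (pins M N n g R m)))" using Suc by simp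
  show ?case
  proof (cases "pinned M m")
    case True
    then have r: "rank M (Suc m) div 3 = Suc ?r" by (simp add: rank_Suc_div del: rank.simps)
    have "(\<Sum>g<n ^ Suc ?r. card (sols N n (pins M N n g R (Suc m)))) =
        (\<Sum>g<n ^ ?r * n. card (sols N n (pin (pins M N n (g mod n ^ ?r) R m) m (g div n ^ ?r))))"
    proof (rule sum.cong)
      fix g assume "g \<in> {..<n ^ ?r * n}"
      then have "g div n ^ ?r < n" using n by (simp add: less_mult_imp_div_less mult.commute)
      then have "digit n g ?r = g div n ^ ?r" by (simp add: digit_def)
      moreover have "pins M N n g R (Suc m) = trunc N n (pin (pins M N n g R m) m (digit n g ?r))"
        using True by (simp add: pins_def)
      ultimately show "card (sols N n (pins M N n g R (Suc m))) =
          card (sols N n (pin (pins M N n (g mod n ^ ?r) R m) m (g div n ^ ?r)))"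
        by (simp add: sols_trunc pins_mod)
    qed (simp add: mult.commute)
    also have "\<dots> = (\<Sum>g<n ^ ?r. \<Sum>h<n. card (sols N n (pin (pins M N n g R m) m h)))"
      by (rule sum_mod_div)
    also have "\<dots> = (\<Sum>g<n ^ ?r. card (sols N n (pins M N n g R m)))"
      using Suc.prems by (simp add: card_sols_pin[OF n, of m N, symmetric])
    finally show ?thesis using IH r by simp
  next
    case False
    then have "rank M (Suc m) div 3 = ?r" by (simp add: rank_Suc_div del: rank.simps)
    moreover have "pins M N n g R (Suc m) = pins M N n g R m" for g using False by (simp add: pins_def)
    ultimately show ?thesis using IH by simp
  qed
qed (simp add: pins_def)

lemma linked_pins:
  assumes "linked n (pins M N n g R m) y z" "y < N" "z < N"
  shows "linked n R y z \<and> (pinned M y \<longrightarrow> m \<le> y) \<and> (pinned M z \<longrightarrow> m \<le> z)"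
  using assms(1)
proof (induction m)
  case (Suc m)
  show ?case
  proof (cases "pinned M m")
    case True
    then have "linked n (pin (pins M N n g R m) m (digit n g (rank M m div 3))) y z"
      using Suc.prems assms by (simp add: pins_def linked_trunc)
    from linked_pin[OF this] show ?thesis using Suc.IH by auto
  next
    case False
    then have "linked n (pins M N n g R m) y z" using Suc.prems by (simp add: pins_def)
    then show ?thesis using Suc.IH False by (metis Suc_leI le_neq_implies_less)
  qed
qed (simp add: pins_def)

context unstuck
begin

text \<open>The two kinds of links do not mix at an eliminated variable: a tip has only
  \<open>chord\<close> links, any other non-hub only \<open>clear\<close> links. So the link created
  between its two neighbours is again of that kind.\<close>

lemma pass1_invariant:
  assumes n: "0 < n"
    and link: "\<And>y z. y < N \<Longrightarrow> z < N \<Longrightarrow> linked n R y z \<Longrightarrow> \<not> pinned M y \<and> \<not> pinned M z \<and> (clear y z \<or> chord y z)"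
    and deg: "\<And>x. x < N \<Longrightarrow> \<not> hub M x \<Longrightarrow> card (neighbours N n R x) \<le> 2"
    and m: "m \<le> N"
  shows "(\<forall>y<N. \<forall>z<N. linked n (pass1 M N n R m) y z \<longrightarrow>
            (y < m \<longrightarrow> hub M y) \<and> (z < m \<longrightarrow> hub M z) \<and> \<not> pinned M y \<and> \<not> pinned M z \<and> (clear y z \<or> chord y z)) \<and>
         (\<forall>x<N. \<not> hub M x \<longrightarrow> card (neighbours N n (pass1 M N n R m) x) \<le> 2) \<and>
         (odd (card (sols N n (pass1 M N n R m))) \<longleftrightarrow> odd (card (sols N n R)))"
  using m
proof (induction m)
  case 0
  then show ?case using link deg by (simp add: pass1_def)
next
  case (Suc m)
  let ?Q = "pass1 M N n R m"
  have mN: "m < N" using Suc by simp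
  have IH1: "(y < m \<longrightarrow> hub M y) \<and> (z < m \<longrightarrow> hub M z) \<and> \<not> pinned M y \<and> \<not> pinned M z \<and> (clear y z \<or> chord y z)"
    if "y < N" "z < N" "linked n ?Q y z" for y z
    using Suc that by simp
  have IH2: "card (neighbours N n ?Q x) \<le> 2" if "x < N" "\<not> hub M x" for x using Suc that by simp
  have IH3: "odd (card (sols N n ?Q)) \<longleftrightarrow> odd (card (sols N n R))" using Suc by simp
  show ?case
  proof (cases "hub M m")
    case True
    then have e: "pass1 M N n R (Suc m) = ?Q" by (simp add: pass1_def)
    have "(y < Suc m \<longrightarrow> hub M y) \<and> (z < Suc m \<longrightarrow> hub M z) \<and> \<not> pinned M y \<and> \<not> pinned M z \<and> (clear y z \<or> chord y z)"
      if "y < N" "z < N" "linked n ?Q y z" for y z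
      using IH1[OF that] True by (auto simp: less_Suc_eq)
    then show ?thesis unfolding e using IH2 IH3 by blast
  next
    case False
    then have e: "pass1 M N n R (Suc m) = trunc N n (eliminate N n ?Q m)" by (simp add: pass1_def)
    have "(y < Suc m \<longrightarrow> hub M y) \<and> (z < Suc m \<longrightarrow> hub M z) \<and> \<not> pinned M y \<and> \<not> pinned M z \<and> (clear y z \<or> chord y z)"
      if yz: "y < N" "z < N" and l: "linked n (eliminate N n ?Q m) y z" for y z
    proof -
      have ne: "y \<noteq> m" "z \<noteq> m" and c: "linked n ?Q y z \<or> y \<in> neighbours N n ?Q m \<and> z \<in> neighbours N n ?Q m"
        using linked_eliminate[OF mN l yz] by auto
      show ?thesis
      proof (cases "linked n ?Q y z")
        case True
        then show ?thesis using IH1[OF yz] ne by auto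
      next
        case False
        then have l: "linked n ?Q m y" "linked n ?Q m z" using c by (auto simp: neighbours_def)
        note a = IH1[OF mN yz(1) l(1)] and b = IH1[OF mN yz(2) l(2)]
        have "clear y z \<or> chord y z"
        proof (cases "tip M m")
          case True
          then have "chord m y" "chord m z" using a b by (auto simp: clear_def)
          then show ?thesis using chord_join by blast
        next
          case nt: False
          then have "clear m y" "clear m z" using a b \<open>\<not> hub M m\<close> by (auto simp: chord_def)
          then show ?thesis using clear_join \<open>\<not> hub M m\<close> by blast
        qed
        then show ?thesis using a b ne by auto
      qed
    qed
    moreover have "card (neighbours N n (eliminate N n ?Q m) x) \<le> 2" if "x < N" "\<not> hub M x" for x
      using neighbours_eliminate[OF mN that(1), of n ?Q] IH2[OF that] by linarith
    moreover have "odd (card (sols N n (eliminate N n ?Q m))) \<longleftrightarrow> odd (card (sols N n R))"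
      using parity_eliminate[OF n mN IH2[OF mN False]] IH3 by simp
    ultimately show ?thesis by (simp add: e sols_trunc linked_trunc neighbours_trunc)
  qed
qed

end

text \<open>The degree bound is self-sustaining by \<open>neighbours_eliminate\<close>, so the
  variables can be taken in their natural order.\<close>

lemma pass2_invariant:
  assumes n: "0 < n"
    and deg: "\<And>x. x < N \<Longrightarrow> card (neighbours N n R x) \<le> 2"
    and m: "m \<le> N"
  shows "(\<forall>y<N. \<forall>z<N. linked n (pass2 N n R m) y z \<longrightarrow> m \<le> y \<and> m \<le> z) \<and>
         (\<forall>x<N. card (neighbours N n (pass2 N n R m) x) \<le> 2) \<and>
         (\<forall>x<m. \<forall>u. pass2 N n R m x x u u \<longrightarrow> u = 0) \<and>
         (odd (card (sols N n (pass2 N n R m))) \<longleftrightarrow> odd (card (sols N n R)))"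
  using m
proof (induction m)
  case 0
  then show ?case using deg by (simp add: pass2_def)
next
  case (Suc m)
  let ?Q = "pass2 N n R m"
  have mN: "m < N" using Suc by simp
  have IH1: "m \<le> y \<and> m \<le> z" if "y < N" "z < N" "linked n ?Q y z" for y z
    using Suc that by simp
  have IH2: "card (neighbours N n ?Q x) \<le> 2" if "x < N" for x using Suc that by simp
  have IH4: "u = 0" if "x < m" "?Q x x u u" for x u using Suc that by simp
  have IH3: "odd (card (sols N n ?Q)) \<longleftrightarrow> odd (card (sols N n R))" using Suc by simp
  have e: "pass2 N n R (Suc m) = trunc N n (eliminate N n ?Q m)" by (simp add: pass2_def)
  have "Suc m \<le> y \<and> Suc m \<le> z" if yz: "y < N" "z < N" and l: "linked n (eliminate N n ?Q m) y z" for y z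
  proof -
    have ne: "y \<noteq> m" "z \<noteq> m" and c: "linked n ?Q y z \<or> linked n ?Q m y \<and> linked n ?Q m z"
      using linked_eliminate[OF mN l yz] by (auto simp: neighbours_def)
    then show ?thesis using IH1[OF yz] IH1[OF mN yz(1)] IH1[OF mN yz(2)] by auto
  qed
  moreover have "card (neighbours N n (eliminate N n ?Q m) x) \<le> 2" if "x < N" for x
    using neighbours_eliminate[OF mN that(1), of n ?Q] IH2[OF that] by linarith
  moreover have "u = 0" if "x < Suc m" "trunc N n (eliminate N n ?Q m) x x u u" for x u
    using that IH4[of x u] by (cases "x = m") (auto simp: trunc_def eliminate_def project_def)
  moreover have "odd (card (sols N n (eliminate N n ?Q m))) \<longleftrightarrow> odd (card (sols N n R))"
    using parity_eliminate[OF n mN IH2[OF mN]] IH3 by simp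
  ultimately show ?case by (simp add: e sols_trunc linked_trunc neighbours_trunc)
qed

text \<open>With every variable forced to 0 there is one candidate left, so the number of solutions
  is 0 or 1 and its parity is a direct test.\<close>

lemma accepts_iff:
  assumes n: "0 < n" and zero: "\<And>x u. x < N \<Longrightarrow> R x x u u \<Longrightarrow> u = 0"
  shows "odd (card (sols N n R)) \<longleftrightarrow> accepts N R"
proof -
  let ?z = "\<lambda>x. if x < N then 0 else undefined"
  have "z = ?z" if "z \<in> sols N n R" for z
    using solsD[OF that] zero by (auto simp: fun_eq_iff not_less)
  then have sub: "sols N n R \<subseteq> {?z}" by blast
  have "?z \<in> sols N n R \<longleftrightarrow> accepts N R"
  proof
    assume "?z \<in> sols N n R"
    from solsD(3)[OF this] show "accepts N R" by (auto simp: accepts_def)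
  next
    assume "accepts N R"
    then show "?z \<in> sols N n R" by (intro solsI) (use n in \<open>auto simp: accepts_def\<close>)
  qed
  then show ?thesis using sub by (cases "?z \<in> sols N n R") (auto simp: subset_singleton_iff)
qed

definition guess :: "nat \<Rightarrow> nat \<Rightarrow> (nat \<Rightarrow> nat) \<Rightarrow> nat \<Rightarrow> csp \<Rightarrow> bool" where
  "guess N n M g R = accepts N (pass2 N n (pass1 M N n (pins M N n g R N) N) N)"

context unstuck
begin

lemma parity_guess:
  fixes adj :: "nat \<Rightarrow> nat \<Rightarrow> bool" and lo s t n :: nat
  assumes n: "0 < n"
  defines "R \<equiv> trunc (Suc K) n (fold_csp adj K lo s t M)"
  shows "odd (card (sols (Suc K) n R)) \<longleftrightarrow>
         odd (\<Sum>g<n ^ (rank M (Suc K) div 3). of_bool (guess (Suc K) n M g R) :: nat)"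
proof -
  let ?N = "Suc K"
  have "odd (card (sols ?N n (pins M ?N n g R ?N))) \<longleftrightarrow> guess ?N n M g R" for g
  proof -
    let ?P = "pins M ?N n g R ?N"
    let ?Q = "pass1 M ?N n ?P ?N"
    have linkP: "linked n (fold_csp adj K lo s t M) y z \<and> \<not> pinned M y \<and> \<not> pinned M z"
      if "y < ?N" "z < ?N" "linked n ?P y z" for y z
      using linked_pins[OF that(3,1,2)] that by (auto simp: R_def linked_trunc)
    have degP: "card (neighbours ?N n ?P x) \<le> 2" if "x < ?N" "\<not> hub M x" for x
    proof -
      have "neighbours ?N n ?P x \<subseteq> neighbours ?N n (fold_csp adj K lo s t M) x"
        using linkP that(1) by (auto simp: neighbours_def)
      then have "card (neighbours ?N n ?P x) \<le> card (neighbours ?N n (fold_csp adj K lo s t M) x)"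
        by (intro card_mono finite_neighbours)
      then show ?thesis using degree_fold_csp[OF that(2), of ?N n adj lo s t] by linarith
    qed
    have Q: "(\<forall>y<?N. \<forall>z<?N. linked n ?Q y z \<longrightarrow>
            (y < ?N \<longrightarrow> hub M y) \<and> (z < ?N \<longrightarrow> hub M z) \<and> \<not> pinned M y \<and> \<not> pinned M z \<and> (clear y z \<or> chord y z))"
      "odd (card (sols ?N n ?Q)) \<longleftrightarrow> odd (card (sols ?N n ?P))"
      using pass1_invariant[OF n, of ?N ?P ?N] linkP degP edges_fold_csp by blast+
    \<comment> \<open>After the first pass only unpinned hubs are still linked, which is the
      situation of \<open>degree_hubs\<close>.\<close>
    have degQ: "card (neighbours ?N n ?Q y) \<le> 2" if y: "y < ?N" for y
    proof (cases "neighbours ?N n ?Q y = {}")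
      case False
      then have h: "hub M y" "\<not> pinned M y" using Q(1) y by (auto simp: neighbours_def)
      have "neighbours ?N n ?Q y \<subseteq> {z. z < ?N \<and> z \<noteq> y \<and> hub M z \<and> \<not> pinned M z \<and> (clear y z \<or> chord y z)}"
        using Q(1) y by (auto simp: neighbours_def linked_def)
      then have "card (neighbours ?N n ?Q y) \<le>
          card {z. z < ?N \<and> z \<noteq> y \<and> hub M z \<and> \<not> pinned M z \<and> (clear y z \<or> chord y z)}"
        by (intro card_mono) auto
      then show ?thesis using degree_hubs[OF h, of ?N] by linarith
    qed simp
    have "(\<forall>x<?N. \<forall>u. pass2 ?N n ?Q ?N x x u u \<longrightarrow> u = 0)"
      "odd (card (sols ?N n (pass2 ?N n ?Q ?N))) \<longleftrightarrow> odd (card (sols ?N n ?Q))"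
      using pass2_invariant[OF n degQ, of ?N] by blast+
    then show ?thesis using accepts_iff[OF n, of ?N "pass2 ?N n ?Q ?N"] Q(2) by (simp add: guess_def)
  qed
  then have "odd (card (sols ?N n R)) \<longleftrightarrow>
      odd (card {g \<in> {..<n ^ (rank M ?N div 3)}. guess ?N n M g R})"
    unfolding card_sols_pins[OF n order_refl, of ?N R M] by (subst odd_sum_iff) simp_all
  also have "\<dots> \<longleftrightarrow> odd (\<Sum>g<n ^ (rank M ?N div 3). of_bool (guess ?N n M g R) :: nat)"
    by (subst odd_sum_iff) simp_all
  finally show ?thesis .
qed

end

text \<open>The base \<open>N\<close> digits of \<open>c\<close> are the values of a map on the
  positions; beyond them it is the identity, as in \<open>involutions\<close>. A sum over
  involutions thus becomes a sum over numbers below \<open>N ^ N\<close>.\<close>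

definition decode :: "nat \<Rightarrow> nat \<Rightarrow> nat \<Rightarrow> nat" where
  "decode N c x = (if x < N then digit N c x else x)"

definition valid :: "nat \<Rightarrow> (nat \<Rightarrow> nat) \<Rightarrow> bool" where
  "valid N M \<longleftrightarrow> (\<forall>x<N. M (M x) = x \<and> \<not> stuck M x)"

text \<open>The empty range for invalid codes does two things: such codes contribute 0, and the
  number of guesses obeys the bound \<open>N div 6\<close> on the exponent, which is available for
  unstuck involutions only.\<close>

definition walk_parity :: "(nat \<Rightarrow> nat \<Rightarrow> bool) \<Rightarrow> nat \<Rightarrow> nat \<Rightarrow> nat \<Rightarrow> nat \<Rightarrow> nat \<Rightarrow> nat" where
  "walk_parity adj n N lo s t =
     (\<Sum>c<N ^ N. (\<Sum>g<(if valid N (decode N c) then n ^ (rank (decode N c) N div 3) else 0).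
        of_bool (guess N n (decode N c) g (trunc N n (fold_csp adj (N - 1) lo s t (decode N c)))))) mod 2"

lemma digit_inject:
  assumes "c < N ^ m" "c' < N ^ m" "\<And>i. i < m \<Longrightarrow> digit N c i = digit N c' i"
  shows "c = c'"
  using assms
proof (induction m arbitrary: c c')
  case (Suc m)
  have N: "0 < N" using Suc.prems(1) by (cases N) auto
  have top: "digit N d m = d div N ^ m" if "d < N ^ Suc m" for d
    using that N by (simp add: digit_def less_mult_imp_div_less)
  have "c mod N ^ m = c' mod N ^ m"
    by (rule Suc.IH) (use N Suc.prems(3) in \<open>simp_all add: digit_mod\<close>)
  moreover have "c div N ^ m = c' div N ^ m"
    unfolding top[OF Suc.prems(1), symmetric] top[OF Suc.prems(2), symmetric]
    by (rule Suc.prems(3)) simp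
  ultimately have "c div N ^ m * N ^ m + c mod N ^ m = c' div N ^ m * N ^ m + c' mod N ^ m" by simp
  then show ?case by (simp only: div_mult_mod_eq)
qed simp

lemma digit_surj:
  assumes "\<And>i. i < m \<Longrightarrow> f i < N"
  shows "\<exists>c<N ^ m. \<forall>i<m. digit N c i = f i"
  using assms
proof (induction m)
  case (Suc m)
  then obtain c where c: "c < N ^ m" "\<And>i. i < m \<Longrightarrow> digit N c i = f i" by auto
  have fm: "f m < N" using Suc.prems by simp
  define d where "d = c + f m * N ^ m"
  have "d < Suc (f m) * N ^ m" using c(1) by (simp add: d_def)
  also have "\<dots> \<le> N ^ Suc m" using fm by (simp add: mult_le_mono1 Suc_leI del: mult_Suc)
  finally have "d < N ^ Suc m" .
  moreover have "digit N d i = f i" if i: "i < Suc m" for i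
  proof (cases "i = m")
    case True
    then show ?thesis using c(1) fm by (simp add: digit_def d_def)
  next
    case False
    then have "i < m" using i by simp
    moreover have "d mod N ^ m = c" using c(1) by (simp add: d_def)
    ultimately show ?thesis using c(2) digit_mod[of i m N d] by simp
  qed
  ultimately show ?case by blast
qed simp

lemma unstuck_decode:
  assumes "valid (Suc K) (decode (Suc K) c)"
  shows "unstuck (decode (Suc K) c) K"
proof
  let ?M = "decode (Suc K) c"
  have out: "?M x = x" if "x > K" for x using that by (simp add: decode_def)
  have "?M (?M x) = x" for x using assms out by (cases "x \<le> K") (auto simp: valid_def)
  then show "?M \<in> involutions K" using out by (auto simp: involutions_def fun_eq_iff)
  show "\<not> stuck ?M x" for x
    using assms out[of x] by (cases "x \<le> K") (auto simp: valid_def stuck_def)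
qed

lemma bij_decode:
  "bij_betw (decode (Suc K)) {c. c < Suc K ^ Suc K \<and> valid (Suc K) (decode (Suc K) c)}
     {M \<in> involutions K. \<forall>i. \<not> stuck M i}"
proof -
  let ?N = "Suc K"
  have out: "decode ?N c x = x" if "x > K" for c x using that by (simp add: decode_def)
  show ?thesis
    unfolding bij_betw_def
  proof
    show "inj_on (decode ?N) {c. c < ?N ^ ?N \<and> valid ?N (decode ?N c)}"
    proof (rule inj_onI)
      fix c c' assume a: "c \<in> {c. c < ?N ^ ?N \<and> valid ?N (decode ?N c)}"
        "c' \<in> {c. c < ?N ^ ?N \<and> valid ?N (decode ?N c)}" and e: "decode ?N c = decode ?N c'"
      have "digit ?N c i = digit ?N c' i" if "i < ?N" for i
        using fun_cong[OF e, of i] that by (simp add: decode_def)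
      then show "c = c'" using a by (intro digit_inject[of c ?N ?N c']) auto
    qed
    show "decode ?N ` {c. c < ?N ^ ?N \<and> valid ?N (decode ?N c)} = {M \<in> involutions K. \<forall>i. \<not> stuck M i}"
    proof (intro equalityI subsetI)
      fix M assume "M \<in> decode ?N ` {c. c < ?N ^ ?N \<and> valid ?N (decode ?N c)}"
      then obtain c where c: "M = decode ?N c" "valid ?N M" by auto
      interpret unstuck M K using unstuck_decode c by simp
      show "M \<in> {M \<in> involutions K. \<forall>i. \<not> stuck M i}" using inv unstuck by simp
    next
      fix M assume M: "M \<in> {M \<in> involutions K. \<forall>i. \<not> stuck M i}"
      then have inv: "M \<in> involutions K" by simp
      note D = involutionsD[OF inv]
      have "\<And>i. i < ?N \<Longrightarrow> M i < ?N" using D(3) by (simp add: less_Suc_eq_le)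
      from digit_surj[of ?N M ?N, OF this] obtain c where c: "c < ?N ^ ?N" "\<forall>i<?N. digit ?N c i = M i" by blast
      have "decode ?N c = M" using c(2) D(2) by (auto simp: decode_def fun_eq_iff)
      moreover have "valid ?N M" using M D(1) by (auto simp: valid_def)
      ultimately show "M \<in> decode ?N ` {c. c < ?N ^ ?N \<and> valid ?N (decode ?N c)}" using c(1) by force
    qed
  qed
qed

lemma walk_parity_correct:
  assumes n: "0 < n" and sym: "\<And>u v. u < n \<Longrightarrow> v < n \<Longrightarrow> adj u v \<Longrightarrow> adj v u" and irr: "\<And>u. \<not> adj u u"
  shows "walk_parity adj n (Suc K) lo s t =
    card {v \<in> walk_maps K {lo..<n} adj s t. inj_on v {..K}} mod 2"
proof -
  let ?N = "Suc K" and ?V = "{lo..<n}"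
  let ?G = "{M \<in> involutions K. \<forall>i. \<not> stuck M i}"
  let ?f = "\<lambda>M. card {v \<in> walk_maps K ?V adj s t. v \<circ> M = v}"
  let ?g = "\<lambda>M. \<Sum>g<n ^ (rank M ?N div 3). of_bool (guess ?N n M g (trunc ?N n (fold_csp adj K lo s t M))) :: nat"
  have finG: "finite ?G" using finite_involutions by simp
  have "odd (card {v \<in> walk_maps K ?V adj s t. inj_on v {..K}}) \<longleftrightarrow>
      odd (card {(M, v) \<in> folded_walks K ?V adj s t. \<forall>i. \<not> stuck M i})"
    unfolding parity_injective_walks[OF finite_atLeastLessThan]
    by (rule parity_unstuck) (use sym irr in auto)
  \<comment> \<open>Fibring over \<open>M\<close> makes each fibre the solution set of one
    constraint system.\<close>
  also have "{(M, v) \<in> folded_walks K ?V adj s t. \<forall>i. \<not> stuck M i} =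
      Sigma ?G (\<lambda>M. {v \<in> walk_maps K ?V adj s t. v \<circ> M = v})"
    by (auto simp: folded_walks_def)
  also have "card \<dots> = (\<Sum>M\<in>?G. ?f M)"
    by (rule card_SigmaI[OF finG]) (auto intro: finite_subset[OF _ finite_walk_maps[of ?V]])
  also have "odd \<dots> \<longleftrightarrow> odd (card {M \<in> ?G. odd (?f M)})" by (rule odd_sum_iff[OF finG])
  also have "{M \<in> ?G. odd (?f M)} = {M \<in> ?G. odd (?g M)}"
  proof -
    have "odd (?f M) \<longleftrightarrow> odd (?g M)" if M: "M \<in> ?G" for M
    proof -
      interpret unstuck M K using M by unfold_locales auto
      have "?f M = card (sols ?N n (trunc ?N n (fold_csp adj K lo s t M)))"
        using sols_fold_csp[of M K n adj lo s t, OF inv sym] by (simp add: sols_trunc)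
      then show ?thesis using parity_guess[OF n, of adj lo s t] by simp
    qed
    then show ?thesis by blast
  qed
  also have "odd (card \<dots>) \<longleftrightarrow> odd (\<Sum>M\<in>?G. ?g M)" by (rule odd_sum_iff[OF finG, symmetric])
  also have "(\<Sum>M\<in>?G. ?g M) = (\<Sum>c | c < ?N ^ ?N \<and> valid ?N (decode ?N c). ?g (decode ?N c))"
    by (rule sum.reindex_bij_betw[OF bij_decode, symmetric])
  also have "\<dots> = (\<Sum>c<?N ^ ?N. if valid ?N (decode ?N c) then ?g (decode ?N c) else 0)"
    by (subst sum.inter_filter[symmetric]) (auto intro!: sum.cong)
  also have "\<dots> = (\<Sum>c<?N ^ ?N. (\<Sum>g<(if valid ?N (decode ?N c) then n ^ (rank (decode ?N c) ?N div 3) else 0).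
        of_bool (guess ?N n (decode ?N c) g (trunc ?N n (fold_csp adj (?N - 1) lo s t (decode ?N c))))))"
    by (rule sum.cong) auto
  finally show ?thesis unfolding walk_parity_def by (simp add: mod2_eq_if)
qed

section \<open>Code generators with time bounds\<close>

text \<open>Positivity of \<open>k\<close> reflects the convention that zero has length one.\<close>

lemma bitlen_le_iff: "0 < k \<Longrightarrow> bitlen a \<le> k \<longleftrightarrow> a < 2 ^ k"
proof -
  assume k: "0 < k"
  show ?thesis
  proof
    assume "bitlen a \<le> k"
    then have "(2::nat) * 2 ^ floor_log a \<le> 2 ^ k"
      unfolding bitlen_def by (metis power_Suc power_increasing one_le_numeral)
    then show "a < 2 ^ k" using floor_log_exp2_gt[of a] by linarith
  next
    assume a: "a < 2 ^ k"
    show "bitlen a \<le> k"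
    proof (cases "a = 0")
      case True
      then show ?thesis using k by (simp add: bitlen_def)
    next
      case False
      then have "2 ^ floor_log a < (2::nat) ^ k" using floor_log_exp2_le[of a] a by linarith
      then show ?thesis by (simp add: bitlen_def Suc_le_eq)
    qed
  qed
qed

lemma bitlen_pos: "0 < bitlen a"
  by (simp add: bitlen_def)

lemma less_bitlen: "a < 2 ^ bitlen a"
  using bitlen_le_iff[OF bitlen_pos, of a a] by simp

lemma bitlen_mono: "a \<le> b \<Longrightarrow> bitlen a \<le> bitlen b"
  by (simp add: bitlen_def floor_log_le_iff)

lemma bitlen_le_Suc: "bitlen a \<le> Suc a"
  using bitlen_le_iff[of "Suc a" a] less_exp[of a] by (simp add: less_le_trans)

lemma bitlen_mult: "bitlen (a * b) \<le> bitlen a + bitlen b"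
  using less_bitlen[of a] less_bitlen[of b] bitlen_pos[of a]
  by (subst bitlen_le_iff) (auto simp: power_add intro: mult_strict_mono)

lemma bitlen_add: "bitlen (a + b) \<le> bitlen a + bitlen b"
proof -
  have 1: "a + 1 \<le> 2 ^ bitlen a" and 2: "b + 1 \<le> 2 ^ bitlen b"
    using less_bitlen[of a] less_bitlen[of b] by simp_all
  have "a + b < (a + 1) * (b + 1)" by simp
  also have "\<dots> \<le> 2 ^ bitlen a * 2 ^ bitlen b" using 1 2 by (rule mult_le_mono)
  finally show ?thesis using bitlen_pos[of a] by (subst bitlen_le_iff) (auto simp: power_add)
qed

lemma bitlen_small [simp]: "bitlen 0 = 1" "bitlen (Suc 0) = 1" "bitlen 1 = 1"
  by (simp_all add: bitlen_def)

text \<open>The result is no longer than both operands together, so the cost of an instruction also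
  bounds the length of what it produces.\<close>

lemma bitlen_binop: "bitlen (binop_val f a b) \<le> bitlen a + bitlen b"
proof (cases f)
  case Sub
  then show ?thesis using bitlen_mono[of "a - b" a] by simp
next
  case Div
  then show ?thesis using bitlen_mono[of "a div b" a] by simp
qed (simp_all add: bitlen_add bitlen_mult)

lemma pow_sum_le:
  assumes "2 \<le> (q::nat)"
  shows "q ^ a + q ^ b \<le> q ^ Suc (a + b)"
proof -
  have "q ^ a \<le> q ^ (a + b)" "q ^ b \<le> q ^ (a + b)" using assms by (simp_all add: power_increasing)
  then have "q ^ a + q ^ b \<le> 2 * q ^ (a + b)" by linarith
  also have "\<dots> \<le> q * q ^ (a + b)" using assms by (rule mult_le_mono1)
  finally show ?thesis by simp
qed

lemma le_pow: "2 \<le> (q::nat) \<Longrightarrow> a \<le> q ^ a"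
  using less_exp[of a] power_mono[of 2 q a] by (meson le_trans less_imp_le zero_le)

section \<open>Instances, generated programs and their running time\<close>

type_synonym inst = "(nat \<Rightarrow> nat) \<times> nat \<times> nat"

abbreviation mem :: "inst \<Rightarrow> nat \<Rightarrow> nat" where "mem I \<equiv> fst I"
abbreviation siz :: "inst \<Rightarrow> nat" where "siz I \<equiv> fst (snd I)"
abbreviation len :: "inst \<Rightarrow> nat" where "len I \<equiv> snd (snd I)"

text \<open>The summand 2 lets a single power of the scale absorb any constant and any sum of
  powers, also when both parameters are 0.\<close>

definition scale :: "inst \<Rightarrow> nat" where "scale I = siz I + len I + 2"

lemma scale_ge_2: "2 \<le> scale I" by (simp add: scale_def)

definition binary_memory :: "inst \<Rightarrow> bool" where "binary_memory I \<longleftrightarrow> (\<forall>a. mem I a \<le> 1)"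

text \<open>
  A code generator \<open>C\<close> receives the registers \<open>loc j\<close> of the variables and the first free
  register \<open>q\<close>, where the generated program leaves its result; registers below \<open>q\<close> are kept.
\<close>

definition frame :: "inst \<Rightarrow> nat \<Rightarrow> (nat \<Rightarrow> nat) \<Rightarrow> (nat \<Rightarrow> nat) \<Rightarrow> nat \<Rightarrow> (nat \<Rightarrow> nat) \<Rightarrow> bool" where
  "frame I d \<rho> loc q r \<longleftrightarrow>
     2 \<le> q \<and> r 0 = siz I \<and> r 1 = len I \<and> (\<forall>j<d. loc j < q \<and> r (loc j) = \<rho> j)"

text \<open>Registers are the only work space: the memory is returned unchanged, so the adjacency
  matrix stays readable. Since \<open>T\<close> also bounds the length of the result, instructions
  that consume the result can be charged to \<open>T\<close>.\<close>

definition runs ::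
    "inst \<Rightarrow> ((nat \<Rightarrow> nat) \<Rightarrow> nat \<Rightarrow> prog) \<Rightarrow> nat \<Rightarrow> (nat \<Rightarrow> nat) \<Rightarrow> nat \<Rightarrow> nat \<Rightarrow> bool" where
  "runs I C d \<rho> v T \<longleftrightarrow> bitlen v \<le> T \<and> (\<forall>loc q r. frame I d \<rho> loc q r \<longrightarrow>
     (\<exists>t r'. exec (C loc q) (r, mem I) t (r', mem I) \<and> r' q = v \<and> (\<forall>i<q. r' i = r i) \<and> t \<le> T))"

definition admissible :: "inst \<Rightarrow> nat \<Rightarrow> (nat \<Rightarrow> nat) \<Rightarrow> nat \<Rightarrow> bool" where
  "admissible I d \<rho> b \<longleftrightarrow> binary_memory I \<and> (\<forall>j<d. bitlen (\<rho> j) \<le> scale I ^ b)"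

definition dominated :: "(inst \<Rightarrow> nat) \<Rightarrow> (inst \<Rightarrow> nat) \<Rightarrow> bool" where
  "dominated W T \<longleftrightarrow> (\<exists>c. \<forall>I. T I \<le> W I * scale I ^ c)"

text \<open>The program is fixed before the exponent \<open>b\<close> that bounds the lengths of its
  variables; only the time bound depends on \<open>b\<close>. Hence a program can be called on
  arguments longer than the original input without changing its code.\<close>

definition computable :: "(inst \<Rightarrow> nat) \<Rightarrow> nat \<Rightarrow> (inst \<Rightarrow> (nat \<Rightarrow> nat) \<Rightarrow> nat) \<Rightarrow> bool" where
  "computable W d f \<longleftrightarrow> (\<exists>C. \<forall>b. \<exists>T. dominated W T \<and>
     (\<forall>I \<rho>. admissible I d \<rho> b \<longrightarrow> runs I C d \<rho> (f I \<rho>) (T I)))"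

abbreviation ptime :: "nat \<Rightarrow> (inst \<Rightarrow> (nat \<Rightarrow> nat) \<Rightarrow> nat) \<Rightarrow> bool" where
  "ptime \<equiv> computable (\<lambda>_. 1)"

lemma computableE:
  assumes "computable W d f"
  obtains C T where "\<And>b. dominated W (T b)"
    "\<And>b I \<rho>. admissible I d \<rho> b \<Longrightarrow> runs I C d \<rho> (f I \<rho>) (T b I)"
  using assms unfolding computable_def by metis

lemma computableI:
  assumes "\<And>b. dominated W (T b)" "\<And>b I \<rho>. admissible I d \<rho> b \<Longrightarrow> runs I C d \<rho> (f I \<rho>) (T b I)"
  shows "computable W d f"
  using assms unfolding computable_def by blast

lemma dominated_add:
  assumes "dominated W S" "dominated W T"
  shows "dominated W (\<lambda>I. S I + T I)"
proof -
  obtain c e where "\<And>I. S I \<le> W I * scale I ^ c" "\<And>I. T I \<le> W I * scale I ^ e"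
    using assms unfolding dominated_def by blast
  then have "S I + T I \<le> W I * (scale I ^ c + scale I ^ e)" for I by (simp add: add_mono distrib_left)
  then have "S I + T I \<le> W I * scale I ^ Suc (c + e)" for I
    using mult_le_mono2[OF pow_sum_le[OF scale_ge_2]] by (rule order_trans)
  then show ?thesis unfolding dominated_def by blast
qed

lemma dominated_mult:
  assumes "dominated V S" "dominated W T"
  shows "dominated (\<lambda>I. V I * W I) (\<lambda>I. S I * T I)"
proof -
  obtain c e where "\<And>I. S I \<le> V I * scale I ^ c" "\<And>I. T I \<le> W I * scale I ^ e"
    using assms unfolding dominated_def by blast
  then have "S I * T I \<le> (V I * scale I ^ c) * (W I * scale I ^ e)" for I by (intro mult_le_mono)
  then have "S I * T I \<le> V I * W I * scale I ^ (c + e)" for I by (simp add: power_add mult_ac)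
  then show ?thesis unfolding dominated_def by blast
qed

lemma dominated_weaken:
  assumes "dominated V T" "\<And>I. V I \<le> W I * scale I ^ e"
  shows "dominated W T"
proof -
  obtain c where "\<And>I. T I \<le> V I * scale I ^ c" using assms(1) unfolding dominated_def by blast
  moreover have "V I * scale I ^ c \<le> W I * scale I ^ (e + c)" for I
    using mult_le_mono1[OF assms(2)[of I], of "scale I ^ c"] by (simp add: power_add mult.assoc)
  ultimately show ?thesis unfolding dominated_def by (meson order_trans)
qed

lemma dominated_one: "dominated (\<lambda>_. 1) T \<Longrightarrow> (\<And>I. 0 < W I) \<Longrightarrow> dominated W T"
  by (erule dominated_weaken[where e = 0]) (simp add: Suc_le_eq)

lemma dominated_const: "(\<And>I. 0 < W I) \<Longrightarrow> dominated W (\<lambda>I. a)"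
proof (rule dominated_one)
  have "a \<le> 1 * scale I ^ a" for I using le_pow[OF scale_ge_2] by simp
  then show "dominated (\<lambda>_. 1) (\<lambda>I. a)" unfolding dominated_def by blast
qed

lemma dominated_self: "(\<And>I. 0 < W I) \<Longrightarrow> dominated W W"
  unfolding dominated_def by (rule exI[of _ 0]) simp

lemma dominated_power: "dominated (\<lambda>_. 1) (\<lambda>I. scale I ^ c)"
  unfolding dominated_def by (rule exI[of _ c]) simp

lemma frame_step:
  assumes "frame I d \<rho> loc q r" "q \<le> q'" "\<And>i. i < q \<Longrightarrow> r' i = r i"
  shows "frame I d \<rho> loc q' r'"
  using assms unfolding frame_def by (auto intro: less_le_trans)

lemma runsI:
  assumes "bitlen v \<le> T" "\<And>loc q r. frame I d \<rho> loc q r \<Longrightarrow>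
      \<exists>t r'. exec (C loc q) (r, mem I) t (r', mem I) \<and> r' q = v \<and> (\<forall>i<q. r' i = r i) \<and> t \<le> T"
  shows "runs I C d \<rho> v T"
  using assms unfolding runs_def by blast

lemma runsE:
  assumes "runs I C d \<rho> v T" "frame I d \<rho> loc q r"
  obtains t r' where "exec (C loc q) (r, mem I) t (r', mem I)" "r' q = v" "\<And>i. i < q \<Longrightarrow> r' i = r i" "t \<le> T"
  using assms unfolding runs_def by blast

lemma runs_bitlen: "runs I C d \<rho> v T \<Longrightarrow> bitlen v \<le> T"
  by (simp add: runs_def)

lemma computable_weaken:
  assumes "computable V d f" "\<And>I. V I \<le> W I * scale I ^ e"
  shows "computable W d f"
  using assms by (metis computableE computableI dominated_weaken)

lemma ptime_computable: "ptime d f \<Longrightarrow> (\<And>I. 0 < W I) \<Longrightarrow> computable W d f"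
  by (erule computable_weaken[where e = 0]) (simp add: Suc_le_eq)

lemma computable_lift:
  assumes f: "computable W d f" and d: "d \<le> d'"
  shows "computable W d' f"
proof -
  obtain C T where T: "\<And>b. dominated W (T b)" "\<And>b I \<rho>. admissible I d \<rho> b \<Longrightarrow> runs I C d \<rho> (f I \<rho>) (T b I)"
    using f by (rule computableE) blast
  have "frame I d' \<rho> loc q r \<Longrightarrow> frame I d \<rho> loc q r" for I \<rho> loc q r using d by (auto simp: frame_def)
  then have "runs I C d \<rho> v t \<Longrightarrow> runs I C d' \<rho> v t" for I \<rho> v t unfolding runs_def by blast
  moreover have "admissible I d' \<rho> b \<Longrightarrow> admissible I d \<rho> b" for I \<rho> b using d by (auto simp: admissible_def)
  ultimately show ?thesis using T by (intro computableI[of W T d' C]) auto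
qed

definition move :: "nat \<Rightarrow> nat \<Rightarrow> prog" where
  "move q x = Seq (Const q 0) (Op Add q x q)"

lemma exec_move: "x \<noteq> q \<Longrightarrow> exec (move q x) (r, m) (bitlen (r x) + 2) (r(q := r x), m)"
proof -
  assume "x \<noteq> q"
  moreover have "exec (move q x) (r, m) (bitlen 0 + (bitlen ((r(q := 0)) x) + bitlen ((r(q := 0)) q)))
      ((r(q := 0))(q := binop_val Add ((r(q := 0)) x) ((r(q := 0)) q)), m)"
    unfolding move_def by (rule exec.Seq[OF exec.Const exec.Op])
  ultimately show ?thesis by simp
qed

lemma ptime_reg:
  assumes "\<And>b. dominated (\<lambda>_. 1) (T b)" "\<And>b I \<rho>. admissible I d \<rho> b \<Longrightarrow> bitlen (f I \<rho>) \<le> T b I"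
    and x: "\<And>I \<rho> loc q r. frame I d \<rho> loc q r \<Longrightarrow> x loc < q \<and> r (x loc) = f I \<rho>"
  shows "ptime d f"
proof (rule computableI)
  show "dominated (\<lambda>_. 1) (\<lambda>I. T b I + 2)" for b by (intro dominated_add dominated_const assms) simp
  fix b I \<rho>
  assume ad: "admissible I d \<rho> b"
  show "runs I (\<lambda>loc q. move q (x loc)) d \<rho> (f I \<rho>) (T b I + 2)"
  proof (rule runsI)
    fix loc q r
    assume "frame I d \<rho> loc q r"
    from x[OF this] show "\<exists>t r'. exec (move q (x loc)) (r, mem I) t (r', mem I) \<and> r' q = f I \<rho> \<and>
        (\<forall>i<q. r' i = r i) \<and> t \<le> T b I + 2"
      using assms(2)[OF ad] exec_move[of "x loc" q r "mem I"]
      by (intro exI[of _ "bitlen (f I \<rho>) + 2"] exI[of _ "r(q := f I \<rho>)"]) auto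
  qed (use assms(2)[OF ad] in simp)
qed

lemma ptime_var: "j < d \<Longrightarrow> ptime d (\<lambda>I \<rho>. \<rho> j)"
  by (rule ptime_reg[OF dominated_power, where x = "\<lambda>loc. loc j"]) (auto simp: admissible_def frame_def)

lemma ptime_siz: "ptime d (\<lambda>I \<rho>. siz I)"
  by (rule ptime_reg[OF dominated_power[of 1], where x = "\<lambda>_. 0"])
    (auto intro!: order_trans[OF bitlen_le_Suc] simp: scale_def frame_def)

lemma ptime_len: "ptime d (\<lambda>I \<rho>. len I)"
  by (rule ptime_reg[OF dominated_power[of 1], where x = "\<lambda>_. 1"])
    (auto intro!: order_trans[OF bitlen_le_Suc] simp: scale_def frame_def)

lemma ptime_const: "ptime d (\<lambda>I \<rho>. a)"
proof (rule computableI)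
  show "dominated (\<lambda>_. 1) (\<lambda>I. bitlen a)" by (intro dominated_const) simp
  show "runs I (\<lambda>loc q. Const q a) d \<rho> a (bitlen a)" for I \<rho>
    using exec.Const[of _ a _ "mem I"] by (intro runsI) fastforce+
qed

lemma computable_binop:
  assumes f: "computable W d f" and g: "computable W d g"
  shows "computable W d (\<lambda>I \<rho>. binop_val h (f I \<rho>) (g I \<rho>))"
proof -
  obtain C T where T: "\<And>b. dominated W (T b)" "\<And>b I \<rho>. admissible I d \<rho> b \<Longrightarrow> runs I C d \<rho> (f I \<rho>) (T b I)"
    using f by (rule computableE) blast
  obtain C' T' where T': "\<And>b. dominated W (T' b)" "\<And>b I \<rho>. admissible I d \<rho> b \<Longrightarrow> runs I C' d \<rho> (g I \<rho>) (T' b I)"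
    using g by (rule computableE) blast
  define E where "E loc q = Seq (C loc q) (Seq (C' loc (Suc q)) (Op h q q (Suc q)))" for loc q
  show ?thesis
  proof (rule computableI)
    show "dominated W (\<lambda>I. T b I + (T' b I + (T b I + T' b I)))" for b by (intro dominated_add T T')
    fix b I \<rho>
    assume ad: "admissible I d \<rho> b"
    note R = T(2)[OF ad] and R' = T'(2)[OF ad]
    show "runs I E d \<rho> (binop_val h (f I \<rho>) (g I \<rho>)) (T b I + (T' b I + (T b I + T' b I)))"
    proof (rule runsI)
      show "bitlen (binop_val h (f I \<rho>) (g I \<rho>)) \<le> T b I + (T' b I + (T b I + T' b I))"
        using bitlen_binop[of h "f I \<rho>" "g I \<rho>"] runs_bitlen[OF R] runs_bitlen[OF R'] by linarith
      fix loc q r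
      assume fr: "frame I d \<rho> loc q r"
      obtain t r1 where 1: "exec (C loc q) (r, mem I) t (r1, mem I)" "r1 q = f I \<rho>" "\<And>i. i < q \<Longrightarrow> r1 i = r i" "t \<le> T b I"
        using runsE[OF R fr] by blast
      obtain t' r2 where 2: "exec (C' loc (Suc q)) (r1, mem I) t' (r2, mem I)" "r2 (Suc q) = g I \<rho>"
        "\<And>i. i < Suc q \<Longrightarrow> r2 i = r1 i" "t' \<le> T' b I"
        using runsE[OF R' frame_step[OF fr, of "Suc q" r1]] 1(3) by auto
      have "exec (E loc q) (r, mem I) (t + (t' + (bitlen (r2 q) + bitlen (r2 (Suc q)))))
          (r2(q := binop_val h (r2 q) (r2 (Suc q))), mem I)"
        unfolding E_def by (rule exec.Seq[OF 1(1) exec.Seq[OF 2(1) exec.Op]])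
      moreover have "r2 q = f I \<rho>" using 1(2) 2(3) by simp
      ultimately show "\<exists>t r'. exec (E loc q) (r, mem I) t (r', mem I) \<and> r' q = binop_val h (f I \<rho>) (g I \<rho>) \<and>
          (\<forall>i<q. r' i = r i) \<and> t \<le> T b I + (T' b I + (T b I + T' b I))"
        using 1(3,4) 2(2,3,4) runs_bitlen[OF R] runs_bitlen[OF R'] by (intro exI conjI) (assumption, auto)
    qed
  qed
qed

lemma ptime_mem:
  assumes "ptime d f"
  shows "ptime d (\<lambda>I \<rho>. mem I (f I \<rho>))"
proof -
  obtain C T where T: "\<And>b. dominated (\<lambda>_. 1) (T b)" "\<And>b I \<rho>. admissible I d \<rho> b \<Longrightarrow> runs I C d \<rho> (f I \<rho>) (T b I)"
    using assms by (rule computableE) blast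
  define E where "E loc q = Seq (C loc q) (Load q q)" for loc q
  show ?thesis
  proof (rule computableI)
    show "dominated (\<lambda>_. 1) (\<lambda>I. T b I + (T b I + 1))" for b by (intro dominated_add dominated_const T) simp
    fix b I \<rho>
    assume ad: "admissible I d \<rho> b"
    note R = T(2)[OF ad]
    have m: "bitlen (mem I (f I \<rho>)) = 1" using ad bitlen_mono[of "mem I (f I \<rho>)" 1] bitlen_pos[of "mem I (f I \<rho>)"]
      by (simp add: admissible_def binary_memory_def)
    show "runs I E d \<rho> (mem I (f I \<rho>)) (T b I + (T b I + 1))"
    proof (rule runsI)
      fix loc q r
      assume fr: "frame I d \<rho> loc q r"
      obtain t r1 where 1: "exec (C loc q) (r, mem I) t (r1, mem I)" "r1 q = f I \<rho>" "\<And>i. i < q \<Longrightarrow> r1 i = r i" "t \<le> T b I"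
        using runsE[OF R fr] by blast
      have "exec (E loc q) (r, mem I) (t + (bitlen (r1 q) + bitlen (mem I (r1 q)))) (r1(q := mem I (r1 q)), mem I)"
        unfolding E_def by (rule exec.Seq[OF 1(1) exec.Load])
      then show "\<exists>t r'. exec (E loc q) (r, mem I) t (r', mem I) \<and> r' q = mem I (f I \<rho>) \<and> (\<forall>i<q. r' i = r i) \<and>
          t \<le> T b I + (T b I + 1)"
        using 1 m runs_bitlen[OF R] by (intro exI conjI) (assumption, auto)
    qed (use m in simp)
  qed
qed

lemma computable_if:
  assumes p: "ptime d p" and f: "computable W d f" and g: "computable W d g" and W: "\<And>I. 0 < W I"
  shows "computable W d (\<lambda>I \<rho>. if p I \<rho> \<noteq> 0 then f I \<rho> else g I \<rho>)"
proof -
  obtain P S where S: "\<And>b. dominated (\<lambda>_. 1) (S b)" "\<And>b I \<rho>. admissible I d \<rho> b \<Longrightarrow> runs I P d \<rho> (p I \<rho>) (S b I)"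
    using p by (rule computableE) blast
  obtain C T where T: "\<And>b. dominated W (T b)" "\<And>b I \<rho>. admissible I d \<rho> b \<Longrightarrow> runs I C d \<rho> (f I \<rho>) (T b I)"
    using f by (rule computableE) blast
  obtain C' T' where T': "\<And>b. dominated W (T' b)" "\<And>b I \<rho>. admissible I d \<rho> b \<Longrightarrow> runs I C' d \<rho> (g I \<rho>) (T' b I)"
    using g by (rule computableE) blast
  define E where "E loc q = Seq (P loc q) (Cond q (C loc q) (C' loc q))" for loc q
  show ?thesis
  proof (rule computableI)
    show "dominated W (\<lambda>I. S b I + (S b I + (T b I + T' b I)))" for b
      by (intro dominated_add T T' dominated_one[OF S(1)] W)
    fix b I \<rho>
    assume ad: "admissible I d \<rho> b"
    let ?v = "if p I \<rho> \<noteq> 0 then f I \<rho> else g I \<rho>"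
    note RP = S(2)[OF ad] and R = T(2)[OF ad] and R' = T'(2)[OF ad]
    show "runs I E d \<rho> ?v (S b I + (S b I + (T b I + T' b I)))"
    proof (rule runsI)
      show "bitlen ?v \<le> S b I + (S b I + (T b I + T' b I))" using runs_bitlen[OF R] runs_bitlen[OF R'] by auto
      fix loc q r
      assume fr: "frame I d \<rho> loc q r"
      obtain t r1 where 1: "exec (P loc q) (r, mem I) t (r1, mem I)" "r1 q = p I \<rho>" "\<And>i. i < q \<Longrightarrow> r1 i = r i" "t \<le> S b I"
        using runsE[OF RP fr] by blast
      have fr1: "frame I d \<rho> loc q r1" by (rule frame_step[OF fr order_refl 1(3)])
      obtain t' r2 where 2: "exec (Cond q (C loc q) (C' loc q)) (r1, mem I) (bitlen (r1 q) + t') (r2, mem I)"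
          "r2 q = ?v" "\<And>i. i < q \<Longrightarrow> r2 i = r1 i" "t' \<le> T b I + T' b I"
      proof (cases "p I \<rho> = 0")
        case True
        then have "r1 q = 0" using 1(2) by simp
        then show ?thesis using runsE[OF R' fr1] True that exec.CondF[of r1 q "C' loc q"] by (metis trans_le_add2)
      next
        case False
        then have "r1 q \<noteq> 0" using 1(2) by simp
        then show ?thesis using runsE[OF R fr1] False that exec.CondT[of r1 q "C loc q"] by (metis trans_le_add1)
      qed
      have "exec (E loc q) (r, mem I) (t + (bitlen (r1 q) + t')) (r2, mem I)"
        unfolding E_def by (rule exec.Seq[OF 1(1) 2(1)])
      then show "\<exists>t r'. exec (E loc q) (r, mem I) t (r', mem I) \<and> r' q = ?v \<and> (\<forall>i<q. r' i = r i) \<and>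
          t \<le> S b I + (S b I + (T b I + T' b I))"
        using 1(2,3,4) 2(2,3,4) runs_bitlen[OF RP] by (intro exI conjI) (assumption, auto)
    qed
  qed
qed

lemma ptime_args:
  assumes "\<And>j. j < m \<Longrightarrow> ptime d (f j)"
  shows "\<exists>P T. (\<forall>b. dominated (\<lambda>_. 1) (T b)) \<and> (\<forall>b I \<rho>. admissible I d \<rho> b \<longrightarrow>
    (\<forall>j<m. bitlen (f j I \<rho>) \<le> T b I) \<and> (\<forall>loc q r. frame I d \<rho> loc q r \<longrightarrow>
      (\<exists>t r'. exec (P loc q) (r, mem I) t (r', mem I) \<and> (\<forall>j<m. r' (q + j) = f j I \<rho>) \<and>
         (\<forall>i<q. r' i = r i) \<and> t \<le> T b I)))"
  using assms
proof (induction m)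
  case 0
  \<comment> \<open>There is no empty program; writing 0 into the free register \<open>q\<close>
    stands in for it.\<close>
  have "\<exists>t r'. exec (Const q 0) (r, mem I) t (r', mem I) \<and> (\<forall>i<q. r' i = r i) \<and> t \<le> 1" for I r q
    using exec.Const[of q 0 r "mem I"] by fastforce
  moreover have "dominated (\<lambda>_. 1) (\<lambda>I. 1)" by (rule dominated_const) simp
  ultimately show ?case
    by (intro exI[of _ "\<lambda>loc q. Const q 0"] exI[of _ "\<lambda>b I. 1"]) simp
next
  case (Suc m)
  obtain P S where S: "\<And>b. dominated (\<lambda>_. 1) (S b)" and P: "\<And>b I \<rho>. admissible I d \<rho> b \<Longrightarrow>
    (\<forall>j<m. bitlen (f j I \<rho>) \<le> S b I) \<and> (\<forall>loc q r. frame I d \<rho> loc q r \<longrightarrow>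
      (\<exists>t r'. exec (P loc q) (r, mem I) t (r', mem I) \<and> (\<forall>j<m. r' (q + j) = f j I \<rho>) \<and>
         (\<forall>i<q. r' i = r i) \<and> t \<le> S b I))" using Suc.IH[OF Suc.prems[OF less_SucI]] by blast
  obtain C T where T: "\<And>b. dominated (\<lambda>_. 1) (T b)" "\<And>b I \<rho>. admissible I d \<rho> b \<Longrightarrow> runs I C d \<rho> (f m I \<rho>) (T b I)"
    by (rule computableE[OF Suc.prems[of m]]) auto
  define E where "E loc q = Seq (P loc q) (C loc (q + m))" for loc q
  have E: "\<exists>t r'. exec (E loc q) (r, mem I) t (r', mem I) \<and> (\<forall>j<Suc m. r' (q + j) = f j I \<rho>) \<and>
      (\<forall>i<q. r' i = r i) \<and> t \<le> S b I + T b I"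
    if ad: "admissible I d \<rho> b" and fr: "frame I d \<rho> loc q r" for b I \<rho> loc q r
  proof -
    obtain t r1 where 1: "exec (P loc q) (r, mem I) t (r1, mem I)" "\<forall>j<m. r1 (q + j) = f j I \<rho>"
      "\<forall>i<q. r1 i = r i" "t \<le> S b I" using P[OF ad] fr by blast
    obtain t' r2 where 2: "exec (C loc (q + m)) (r1, mem I) t' (r2, mem I)" "r2 (q + m) = f m I \<rho>"
      "\<And>i. i < q + m \<Longrightarrow> r2 i = r1 i" "t' \<le> T b I"
      using runsE[OF T(2)[OF ad] frame_step[OF fr, of "q + m" r1]] 1(3) by auto
    have "exec (E loc q) (r, mem I) (t + t') (r2, mem I)"
      unfolding E_def by (rule exec.Seq[OF 1(1) 2(1)])
    then show ?thesis using 1(2-4) 2(2-4) by (intro exI conjI) (assumption, auto simp: less_Suc_eq)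
  qed
  have bits: "\<forall>j<Suc m. bitlen (f j I \<rho>) \<le> S b I + T b I" if ad: "admissible I d \<rho> b" for b I \<rho>
    using P[OF ad] runs_bitlen[OF T(2)[OF ad]] by (auto simp: less_Suc_eq intro: trans_le_add1)
  have "dominated (\<lambda>_. 1) (\<lambda>I. S b I + T b I)" for b by (intro dominated_add S T)
  then show ?case using bits E by (intro exI[of _ E] exI[of _ "\<lambda>b I. S b I + T b I"] conjI allI impI) auto
qed

text \<open>The callee gets a numbering of its own: the arguments are placed in consecutive fresh
  registers, which become its variables. Their lengths are governed by the exponent
  \<open>c b\<close> instead of \<open>b\<close>.\<close>

lemma computable_call:
  assumes g: "computable W m g" and f: "\<And>j. j < m \<Longrightarrow> ptime d (f j)" and W: "\<And>I. 0 < W I"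
  shows "computable W d (\<lambda>I \<rho>. g I (\<lambda>j. f j I \<rho>))"
proof -
  obtain P S where S: "\<And>b. dominated (\<lambda>_. 1) (S b)" and P: "\<And>b I \<rho>. admissible I d \<rho> b \<Longrightarrow>
    (\<forall>j<m. bitlen (f j I \<rho>) \<le> S b I) \<and> (\<forall>loc q r. frame I d \<rho> loc q r \<longrightarrow>
      (\<exists>t r'. exec (P loc q) (r, mem I) t (r', mem I) \<and> (\<forall>j<m. r' (q + j) = f j I \<rho>) \<and>
         (\<forall>i<q. r' i = r i) \<and> t \<le> S b I))" using ptime_args[of m d f, OF f] by blast
  obtain c where c: "\<And>b I. S b I \<le> scale I ^ c b" using S unfolding dominated_def by (metis mult_1)
  obtain C T where T: "\<And>b. dominated W (T b)" "\<And>b I \<rho>. admissible I m \<rho> b \<Longrightarrow> runs I C m \<rho> (g I \<rho>) (T b I)"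
    using g by (rule computableE) blast
  define E where "E loc q = Seq (P loc (Suc q)) (Seq (C (\<lambda>j. Suc q + j) (Suc q + m)) (move q (Suc q + m)))" for loc q
  show ?thesis
  proof (rule computableI)
    show "dominated W (\<lambda>I. S b I + (T (c b) I + (T (c b) I + 2)))" for b
      by (intro dominated_add dominated_one[OF S] T dominated_const W)
    fix b I \<rho>
    assume ad: "admissible I d \<rho> b"
    let ?v = "g I (\<lambda>j. f j I \<rho>)"
    have "admissible I m (\<lambda>j. f j I \<rho>) (c b)"
      using P[OF ad] ad c[of b I] unfolding admissible_def by (meson order_trans)
    note R = T(2)[OF this]
    show "runs I E d \<rho> ?v (S b I + (T (c b) I + (T (c b) I + 2)))"
    proof (rule runsI)
      show "bitlen ?v \<le> S b I + (T (c b) I + (T (c b) I + 2))" using runs_bitlen[OF R] by linarith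
      fix loc q r
      assume fr: "frame I d \<rho> loc q r"
      then have "frame I d \<rho> loc (Suc q) r" by (rule frame_step) simp_all
      then obtain t r1 where 1: "exec (P loc (Suc q)) (r, mem I) t (r1, mem I)" "\<forall>j<m. r1 (Suc q + j) = f j I \<rho>"
        "\<forall>i<Suc q. r1 i = r i" "t \<le> S b I" using P[OF ad] by blast
      have "frame I m (\<lambda>j. f j I \<rho>) (\<lambda>j. Suc q + j) (Suc q + m) r1"
        using fr 1(2,3) by (auto simp: frame_def)
      then obtain t' r2 where 2: "exec (C (\<lambda>j. Suc q + j) (Suc q + m)) (r1, mem I) t' (r2, mem I)"
        "r2 (Suc q + m) = ?v" "\<And>i. i < Suc q + m \<Longrightarrow> r2 i = r1 i" "t' \<le> T (c b) I"
        using runsE[OF R] by blast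
      have "exec (E loc q) (r, mem I) (t + (t' + (bitlen (r2 (Suc q + m)) + 2))) (r2(q := r2 (Suc q + m)), mem I)"
        unfolding E_def by (rule exec.Seq[OF 1(1) exec.Seq[OF 2(1) exec_move]]) simp
      then show "\<exists>t r'. exec (E loc q) (r, mem I) t (r', mem I) \<and> r' q = ?v \<and> (\<forall>i<q. r' i = r i) \<and>
          t \<le> S b I + (T (c b) I + (T (c b) I + 2))"
        using 1(3,4) 2(2,3,4) runs_bitlen[OF R] by (intro exI conjI) (assumption, auto)
    qed
  qed
qed

text \<open>Register \<open>x\<close> counts down while the invariant counts up; each test of
  \<open>x\<close> costs at most \<open>bitlen n\<close>.\<close>

lemma exec_loop:
  assumes step: "\<And>i r. i < n \<Longrightarrow> J i r \<Longrightarrow> r x = n - i \<Longrightarrow>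
      \<exists>t r'. exec p (r, m) t (r', m) \<and> J (Suc i) r' \<and> r' x = n - Suc i \<and> t \<le> B"
    and J: "J i r" "i \<le> n" "r x = n - i"
  shows "\<exists>t r'. exec (While x p) (r, m) t (r', m) \<and> J n r' \<and> t \<le> (n - i) * (bitlen n + B) + 1"
  using J
proof (induction "n - i" arbitrary: i r)
  case 0
  then have "exec (While x p) (r, m) (bitlen (r x)) (r, m)" by (intro exec.WhileF) simp
  then show ?case using 0 by (intro exI[of _ "bitlen (r x)"] exI[of _ r]) auto
next
  case (Suc k)
  then have i: "i < n" by linarith
  obtain t r' where 1: "exec p (r, m) t (r', m)" "J (Suc i) r'" "r' x = n - Suc i" "t \<le> B"
    using step[OF i Suc.prems(1,3)] by blast
  have "k = n - Suc i" using Suc.hyps(2) by linarith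
  from Suc.hyps(1)[OF this 1(2) _ 1(3)] i
  obtain t' r'' where 2: "exec (While x p) (r', m) t' (r'', m)" "J n r''" "t' \<le> (n - Suc i) * (bitlen n + B) + 1"
    by auto
  have "exec (While x p) (r, m) (bitlen (r x) + t + t') (r'', m)"
    by (rule exec.WhileT[OF _ 1(1) 2(1)]) (use Suc.prems i in simp)
  moreover have "bitlen (r x) \<le> bitlen n" using Suc.prems by (intro bitlen_mono) simp
  then have "bitlen (r x) + t + t' \<le> (n - i) * (bitlen n + B) + 1"
  proof -
    have "n - i = Suc (n - Suc i)" using i by simp
    then have "(n - i) * (bitlen n + B) = bitlen n + B + (n - Suc i) * (bitlen n + B)" by (simp only: mult_Suc)
    then show ?thesis using \<open>bitlen (r x) \<le> bitlen n\<close> 1(4) 2(3) by linarith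
  qed
  ultimately show ?case using 2(2) by blast
qed

text \<open>The number of rounds, at most \<open>X\<close>, multiplies the weight \<open>W\<close>
  of one round. Assumption \<open>side\<close> says that the body sees counter and accumulator only
  through its two arguments. Assumption \<open>acc\<close> controls the length of the accumulator,
  which could otherwise double in every round although each round is cheap in terms of its
  input.\<close>

lemma computable_iter:
  assumes N: "ptime d N" and A: "ptime d A"
    and G: "computable W (Suc (Suc d)) (\<lambda>I \<rho>. G I \<rho> (\<rho> d) (\<rho> (Suc d)))"
    and side: "\<And>I \<rho> i a. G I (\<rho>(d := i, Suc d := a)) i a = G I \<rho> i a"
    and pos: "\<And>I. 0 < X I" "\<And>I. 0 < W I" and NX: "\<And>I \<rho>. N I \<rho> \<le> X I"
    and acc: "\<And>b. \<exists>j. \<forall>I \<rho> i. admissible I d \<rho> b \<longrightarrow> i \<le> N I \<rho> \<longrightarrow>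
      bitlen (iter (G I \<rho>) (A I \<rho>) i) \<le> scale I ^ j"
  shows "computable (\<lambda>I. X I * W I) d (\<lambda>I \<rho>. iter (G I \<rho>) (A I \<rho>) (N I \<rho>))"
proof -
  obtain CN S where S: "\<And>b. dominated (\<lambda>_. 1) (S b)" "\<And>b I \<rho>. admissible I d \<rho> b \<Longrightarrow> runs I CN d \<rho> (N I \<rho>) (S b I)"
    using N by (rule computableE) blast
  obtain CA S' where S': "\<And>b. dominated (\<lambda>_. 1) (S' b)" "\<And>b I \<rho>. admissible I d \<rho> b \<Longrightarrow> runs I CA d \<rho> (A I \<rho>) (S' b I)"
    using A by (rule computableE) blast
  obtain CG T where T: "\<And>b. dominated W (T b)" "\<And>b I \<rho>. admissible I (Suc (Suc d)) \<rho> b \<Longrightarrow>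
      runs I CG (Suc (Suc d)) \<rho> (G I \<rho> (\<rho> d) (\<rho> (Suc d))) (T b I)"
    using G by (rule computableE) blast
  obtain c where c: "\<And>b I. S b I \<le> scale I ^ c b" using S(1) unfolding dominated_def by (metis mult_1)
  obtain j where j: "\<And>b I \<rho> i. admissible I d \<rho> b \<Longrightarrow> i \<le> N I \<rho> \<Longrightarrow>
      bitlen (iter (G I \<rho>) (A I \<rho>) i) \<le> scale I ^ j b" using acc by metis
  \<comment> \<open>One exponent for the original variables, the counter and the accumulator
    together.\<close>
  define e where "e b = b + c b + j b" for b
  \<comment> \<open>Register layout: \<open>q\<close> accumulator, \<open>q + 1\<close> rounds left,
    \<open>q + 2\<close> counter, \<open>q + 3\<close> result of the body and then the constant
    1.\<close>
  define body where "body loc q = Seq (CG (loc(d := q + 2, Suc d := q)) (q + 3)) (Seq (move q (q + 3))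
      (Seq (Const (q + 3) 1) (Seq (Op Add (q + 2) (q + 2) (q + 3)) (Op Sub (q + 1) (q + 1) (q + 3)))))" for loc q
  define E where "E loc q = Seq (CA loc q) (Seq (CN loc (q + 1)) (Seq (Const (q + 2) 0)
      (While (q + 1) (body loc q))))" for loc q
  define B where "B b I = T (e b) I + (T (e b) I + (S b I + (S b I + 5)))" for b I
  show ?thesis
  proof (rule computableI)
    have XW: "0 < X I * W I" for I using pos[of I] by simp
    have "dominated W (B b)" for b
      unfolding B_def by (intro dominated_add T dominated_one[OF S(1)] dominated_const pos)
    then show "dominated (\<lambda>I. X I * W I) (\<lambda>I. S' b I + (S b I + (X I * (S b I + B b I) + 2)))" for b
      by (intro dominated_add dominated_one[OF S(1)] dominated_one[OF S'(1)] dominated_mult dominated_self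
          dominated_const pos XW)
    fix b I \<rho>
    assume ad: "admissible I d \<rho> b"
    let ?it = "iter (G I \<rho>) (A I \<rho>)" and ?n = "N I \<rho>"
    let ?T = "S' b I + (S b I + (X I * (S b I + B b I) + 2))"
    note RN = S(2)[OF ad] and RA = S'(2)[OF ad]
    have RG: "runs I CG (Suc (Suc d)) (\<rho>(d := i, Suc d := ?it i)) (?it (Suc i)) (T (e b) I)" if i: "i < ?n" for i
    proof -
      have pw: "scale I ^ x \<le> scale I ^ e b" if "x \<le> e b" for x
        using scale_ge_2[of I] that by (intro power_increasing) auto
      have "bitlen i \<le> scale I ^ c b" using bitlen_mono[of i ?n] runs_bitlen[OF RN] c[of b I] i by linarith
      moreover have "bitlen (?it i) \<le> scale I ^ j b" using j[OF ad, of i] i by simp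
      ultimately have "admissible I (Suc (Suc d)) (\<rho>(d := i, Suc d := ?it i)) (e b)"
        using ad pw[of b] pw[of "c b"] pw[of "j b"] by (auto simp: admissible_def e_def less_Suc_eq intro: order_trans)
      from T(2)[OF this] show ?thesis using side[of I \<rho> i "?it i"] by simp
    qed
    have loop: "?n * (bitlen ?n + B b I) \<le> X I * (S b I + B b I)"
      using NX runs_bitlen[OF RN] by (intro mult_le_mono add_le_mono) simp_all
    show "runs I E d \<rho> (?it ?n) ?T"
    proof (rule runsI)
      show "bitlen (?it ?n) \<le> ?T"
      proof (cases ?n)
        case 0
        then show ?thesis using runs_bitlen[OF RA] by simp
      next
        case (Suc i)
        have "bitlen (?it ?n) \<le> T (e b) I" using runs_bitlen[OF RG[of i]] Suc by simp
        also have "\<dots> \<le> ?n * (bitlen ?n + B b I)" unfolding Suc by (simp add: B_def)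
        finally show ?thesis using loop by linarith
      qed
      fix loc q r
      assume fr: "frame I d \<rho> loc q r"
      obtain t1 r1 where 1: "exec (CA loc q) (r, mem I) t1 (r1, mem I)" "r1 q = A I \<rho>" "\<And>i. i < q \<Longrightarrow> r1 i = r i"
        "t1 \<le> S' b I" using runsE[OF RA fr] by blast
      obtain t2 r2 where 2: "exec (CN loc (q + 1)) (r1, mem I) t2 (r2, mem I)" "r2 (q + 1) = ?n"
        "\<And>i. i < q + 1 \<Longrightarrow> r2 i = r1 i" "t2 \<le> S b I"
        using runsE[OF RN frame_step[OF fr, of "q + 1" r1]] 1(3) by auto
      define J where "J i s \<longleftrightarrow> s q = ?it i \<and> s (q + 2) = i \<and> (\<forall>i<q. s i = r i)" for i and s :: "nat \<Rightarrow> nat"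
      have step: "\<exists>t r'. exec (body loc q) (s, mem I) t (r', mem I) \<and> J (Suc i) r' \<and> r' (q + 1) = ?n - Suc i \<and> t \<le> B b I"
        if i: "i < ?n" and J: "J i s" and sx: "s (q + 1) = ?n - i" for i s
      proof -
        let ?loc = "loc(d := q + 2, Suc d := q)"
        have sq: "s q = ?it i" "s (q + 2) = i" and sr: "\<And>i. i < q \<Longrightarrow> s i = r i" using J by (auto simp: J_def)
        have "frame I (Suc (Suc d)) (\<rho>(d := i, Suc d := ?it i)) ?loc (q + 3) s"
          using frame_step[OF fr, of "q + 3" s] sq sr by (auto simp: frame_def less_Suc_eq)
        then obtain t s1 where 3: "exec (CG ?loc (q + 3)) (s, mem I) t (s1, mem I)" "s1 (q + 3) = ?it (Suc i)"
          "\<And>i. i < q + 3 \<Longrightarrow> s1 i = s i" "t \<le> T (e b) I" using runsE[OF RG[OF i]] by blast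
        let ?s2 = "s1(q := s1 (q + 3))"
        let ?s3 = "?s2(q + 3 := 1)"
        let ?s4 = "?s3(q + 2 := binop_val Add (?s3 (q + 2)) (?s3 (q + 3)))"
        let ?s5 = "?s4(q + 1 := binop_val Sub (?s4 (q + 1)) (?s4 (q + 3)))"
        have ex: "exec (body loc q) (s, mem I) (t + ((bitlen (s1 (q + 3)) + 2) + (bitlen 1 +
          ((bitlen (?s3 (q + 2)) + bitlen (?s3 (q + 3))) + (bitlen (?s4 (q + 1)) + bitlen (?s4 (q + 3))))))) (?s5, mem I)"
          unfolding body_def
          by (rule exec.Seq[OF 3(1) exec.Seq[OF exec_move exec.Seq[OF exec.Const exec.Seq[OF exec.Op exec.Op]]]]) simp
        have v: "?s3 (q + 2) = i" "?s3 (q + 3) = 1" "?s4 (q + 1) = ?n - i" "?s4 (q + 3) = 1"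
          using 3(2,3) sq sx by simp_all
        have "bitlen i \<le> S b I" "bitlen (?n - i) \<le> S b I"
          using bitlen_mono[of i ?n] bitlen_mono[of "?n - i" ?n] runs_bitlen[OF RN] i by linarith+
        moreover have "bitlen (s1 (q + 3)) \<le> T (e b) I" using runs_bitlen[OF RG[OF i]] 3(2) by simp
        ultimately have "t + ((bitlen (s1 (q + 3)) + 2) + (bitlen 1 +
          ((bitlen (?s3 (q + 2)) + bitlen (?s3 (q + 3))) + (bitlen (?s4 (q + 1)) + bitlen (?s4 (q + 3)))))) \<le> B b I"
          using 3(4) v[THEN arg_cong[of _ _ bitlen]] unfolding B_def bitlen_small by linarith
        moreover have "J (Suc i) ?s5" "?s5 (q + 1) = ?n - Suc i" using v 3(2,3) sr by (simp_all add: J_def)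
        ultimately show ?thesis using ex by blast
      qed
      let ?r3 = "r2(q + 2 := 0)"
      have "J 0 ?r3" "?r3 (q + 1) = ?n - 0" using 1(2,3) 2(2,3) by (simp_all add: J_def)
      then obtain t3 r4 where 3: "exec (While (q + 1) (body loc q)) (?r3, mem I) t3 (r4, mem I)" "J ?n r4"
        "t3 \<le> (?n - 0) * (bitlen ?n + B b I) + 1"
        using exec_loop[where J = J and i = 0 and n = ?n and x = "q + 1" and p = "body loc q" and m = "mem I" and B = "B b I", OF step] by blast
      have "exec (E loc q) (r, mem I) (t1 + (t2 + (bitlen 0 + t3))) (r4, mem I)"
        unfolding E_def by (rule exec.Seq[OF 1(1) exec.Seq[OF 2(1) exec.Seq[OF exec.Const 3(1)]]])
      then show "\<exists>t r'. exec (E loc q) (r, mem I) t (r', mem I) \<and> r' q = ?it ?n \<and> (\<forall>i<q. r' i = r i) \<and> t \<le> ?T"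
        using 1(4) 2(4) 3(2,3) loop by (intro exI conjI) (assumption, auto simp: J_def)
    qed
  qed
qed

section \<open>Polynomial time operations\<close>

text \<open>The value itself, not only its length, is polynomial. Loops and exponents in polynomial
  time code have to be of this kind.\<close>

definition bounded :: "(inst \<Rightarrow> (nat \<Rightarrow> nat) \<Rightarrow> nat) \<Rightarrow> bool" where
  "bounded f \<longleftrightarrow> (\<exists>j. \<forall>I \<rho>. f I \<rho> \<le> scale I ^ j)"

lemma boundedI: "(\<And>I \<rho>. f I \<rho> \<le> scale I ^ j) \<Longrightarrow> bounded f"
  unfolding bounded_def by blast

lemma bounded_siz: "bounded (\<lambda>I \<rho>. siz I)"
  by (rule boundedI[where j = 1]) (simp add: scale_def)

lemma bounded_Suc_len: "bounded (\<lambda>I \<rho>. Suc (len I))"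
  by (rule boundedI[where j = 1]) (simp add: scale_def)

lemma bounded_mult: "bounded f \<Longrightarrow> bounded g \<Longrightarrow> bounded (\<lambda>I \<rho>. f I \<rho> * g I \<rho>)"
  unfolding bounded_def by (metis mult_le_mono power_add)

lemma bounded_min: "bounded g \<Longrightarrow> bounded (\<lambda>I \<rho>. min (f I \<rho>) (g I \<rho>))"
  unfolding bounded_def by (meson min.coboundedI2)

lemma ptime_bitlen:
  assumes "ptime d f"
  shows "\<exists>c. \<forall>I \<rho>. admissible I d \<rho> b \<longrightarrow> bitlen (f I \<rho>) \<le> scale I ^ c"
  using assms unfolding computable_def dominated_def by (metis mult_1 order_trans runs_bitlen)

lemma computable_add: "computable W d f \<Longrightarrow> computable W d g \<Longrightarrow> computable W d (\<lambda>I \<rho>. f I \<rho> + g I \<rho>)"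
  and computable_diff: "computable W d f \<Longrightarrow> computable W d g \<Longrightarrow> computable W d (\<lambda>I \<rho>. f I \<rho> - g I \<rho>)"
  and computable_mult: "computable W d f \<Longrightarrow> computable W d g \<Longrightarrow> computable W d (\<lambda>I \<rho>. f I \<rho> * g I \<rho>)"
  and computable_div: "computable W d f \<Longrightarrow> computable W d g \<Longrightarrow> computable W d (\<lambda>I \<rho>. f I \<rho> div g I \<rho>)"
  using computable_binop[of W d f g Add] computable_binop[of W d f g Sub]
    computable_binop[of W d f g Mul] computable_binop[of W d f g Div] by simp_all

lemma computable_mod:
  assumes "computable W d f" "computable W d g"
  shows "computable W d (\<lambda>I \<rho>. f I \<rho> mod g I \<rho>)"
proof -
  have "computable W d (\<lambda>I \<rho>. f I \<rho> - f I \<rho> div g I \<rho> * g I \<rho>)"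
    using assms by (intro computable_diff computable_mult computable_div)
  then show ?thesis by (simp add: minus_div_mult_eq_mod)
qed

lemma ptime_Suc: "ptime d f \<Longrightarrow> ptime d (\<lambda>I \<rho>. Suc (f I \<rho>))"
  using computable_add[OF _ ptime_const[of d 1], of f] by simp

text \<open>Truth values are computed arithmetically: truncated subtraction gives the comparisons,
  multiplication the conjunction, subtraction from 1 the negation.\<close>

lemma
  shows ptime_conj: "ptime d (\<lambda>I \<rho>. of_bool (P I \<rho>)) \<Longrightarrow> ptime d (\<lambda>I \<rho>. of_bool (P' I \<rho>)) \<Longrightarrow>
      ptime d (\<lambda>I \<rho>. of_bool (P I \<rho> \<and> P' I \<rho>))"
    and ptime_not: "ptime d (\<lambda>I \<rho>. of_bool (P I \<rho>)) \<Longrightarrow> ptime d (\<lambda>I \<rho>. of_bool (\<not> P I \<rho>))"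
    and ptime_eq: "ptime d f \<Longrightarrow> ptime d g \<Longrightarrow> ptime d (\<lambda>I \<rho>. of_bool (f I \<rho> = g I \<rho>))"
    and ptime_le: "ptime d f \<Longrightarrow> ptime d g \<Longrightarrow> ptime d (\<lambda>I \<rho>. of_bool (f I \<rho> \<le> g I \<rho>))"
    and ptime_less: "ptime d f \<Longrightarrow> ptime d g \<Longrightarrow> ptime d (\<lambda>I \<rho>. of_bool (f I \<rho> < g I \<rho>))"
    and ptime_odd: "ptime d f \<Longrightarrow> ptime d (\<lambda>I \<rho>. of_bool (odd (f I \<rho>)))"
proof -
  show "ptime d (\<lambda>I \<rho>. of_bool (P I \<rho> \<and> P' I \<rho>))"
    if "ptime d (\<lambda>I \<rho>. of_bool (P I \<rho>))" "ptime d (\<lambda>I \<rho>. of_bool (P' I \<rho>))"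
    using computable_mult[OF that] by (simp add: of_bool_conj)
  show "ptime d (\<lambda>I \<rho>. of_bool (\<not> P I \<rho>))" if "ptime d (\<lambda>I \<rho>. of_bool (P I \<rho>))"
  proof -
    have "1 - of_bool p = (of_bool (\<not> p) :: nat)" for p by simp
    then show ?thesis using computable_diff[OF ptime_const[of d 1] that] by simp
  qed
  show "ptime d (\<lambda>I \<rho>. of_bool (f I \<rho> = g I \<rho>))" if "ptime d f" "ptime d g"
  proof -
    have "ptime d (\<lambda>I \<rho>. 1 - ((f I \<rho> - g I \<rho>) + (g I \<rho> - f I \<rho>)))"
      using that by (intro computable_diff computable_add ptime_const)
    moreover have "1 - ((a - b) + (b - a)) = of_bool (a = b)" for a b :: nat by auto
    ultimately show ?thesis by simp
  qed
  show "ptime d (\<lambda>I \<rho>. of_bool (f I \<rho> \<le> g I \<rho>))" if "ptime d f" "ptime d g"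
  proof -
    have "ptime d (\<lambda>I \<rho>. 1 - (f I \<rho> - g I \<rho>))"
      using that by (intro computable_diff ptime_const)
    moreover have "1 - (a - b) = of_bool (a \<le> b)" for a b :: nat by auto
    ultimately show ?thesis by simp
  qed
  show "ptime d (\<lambda>I \<rho>. of_bool (f I \<rho> < g I \<rho>))" if "ptime d f" "ptime d g"
  proof -
    have "ptime d (\<lambda>I \<rho>. 1 - (1 - (g I \<rho> - f I \<rho>)))"
      using that by (intro computable_diff ptime_const)
    moreover have "1 - (1 - (b - a)) = of_bool (a < b)" for a b :: nat by auto
    ultimately show ?thesis by simp
  qed
  show "ptime d (\<lambda>I \<rho>. of_bool (odd (f I \<rho>)))" if "ptime d f"
    using computable_mod[OF that ptime_const[of d 2]] by (simp add: of_bool_odd_eq_mod_2)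
qed

lemma ptime_disj:
  assumes "ptime d (\<lambda>I \<rho>. of_bool (P I \<rho>))" "ptime d (\<lambda>I \<rho>. of_bool (P' I \<rho>))"
  shows "ptime d (\<lambda>I \<rho>. of_bool (P I \<rho> \<or> P' I \<rho>))"
proof -
  have "ptime d (\<lambda>I \<rho>. of_bool (\<not> (\<not> P I \<rho> \<and> \<not> P' I \<rho>)))"
    by (intro ptime_not ptime_conj assms)
  then show ?thesis by (simp only: de_Morgan_conj not_not)
qed

lemma ptime_imp:
  assumes "ptime d (\<lambda>I \<rho>. of_bool (P I \<rho>))" "ptime d (\<lambda>I \<rho>. of_bool (P' I \<rho>))"
  shows "ptime d (\<lambda>I \<rho>. of_bool (P I \<rho> \<longrightarrow> P' I \<rho>))"
  unfolding imp_conv_disj by (intro ptime_disj ptime_not assms)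

lemma computable_If:
  assumes "ptime d (\<lambda>I \<rho>. of_bool (P I \<rho>))" "computable W d f" "computable W d g" "\<And>I. 0 < W I"
  shows "computable W d (\<lambda>I \<rho>. if P I \<rho> then f I \<rho> else g I \<rho>)"
  using computable_if[OF assms] by simp

lemma ptime_If:
  assumes "ptime d (\<lambda>I \<rho>. of_bool (P I \<rho>))" "ptime d f" "ptime d g"
  shows "ptime d (\<lambda>I \<rho>. if P I \<rho> then f I \<rho> else g I \<rho>)"
  using computable_If[OF assms] by simp

lemma ptime_if_bool:
  assumes "ptime d (\<lambda>I \<rho>. of_bool (P I \<rho>))" "ptime d (\<lambda>I \<rho>. of_bool (Q I \<rho>))" "ptime d (\<lambda>I \<rho>. of_bool (R I \<rho>))"
  shows "ptime d (\<lambda>I \<rho>. of_bool (if P I \<rho> then Q I \<rho> else R I \<rho>))"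
proof -
  have eq: "of_bool (if p then q else r) = (if p then of_bool q else of_bool r :: nat)" for p q r by (cases p) simp_all
  show ?thesis unfolding eq by (rule ptime_If[OF assms])
qed

lemma ptime_min: "ptime d f \<Longrightarrow> ptime d g \<Longrightarrow> ptime d (\<lambda>I \<rho>. min (f I \<rho>) (g I \<rho>))"
  unfolding min_def by (intro ptime_If ptime_le)

lemma ptime_iter:
  assumes N: "ptime d N" and A: "ptime d A"
    and G: "ptime (Suc (Suc d)) (\<lambda>I \<rho>. G I \<rho> (\<rho> d) (\<rho> (Suc d)))"
    and side: "\<And>I \<rho> i a. G I (\<rho>(d := i, Suc d := a)) i a = G I \<rho> i a"
    and NX: "bounded N"
    and acc: "\<And>b. \<exists>j. \<forall>I \<rho> i. admissible I d \<rho> b \<longrightarrow> i \<le> N I \<rho> \<longrightarrow>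
      bitlen (iter (G I \<rho>) (A I \<rho>) i) \<le> scale I ^ j"
  shows "ptime d (\<lambda>I \<rho>. iter (G I \<rho>) (A I \<rho>) (N I \<rho>))"
proof -
  obtain j where j: "\<And>I \<rho>. N I \<rho> \<le> scale I ^ j" using NX unfolding bounded_def by blast
  have "computable (\<lambda>I. scale I ^ j * 1) d (\<lambda>I \<rho>. iter (G I \<rho>) (A I \<rho>) (N I \<rho>))"
    by (rule computable_iter[OF N A G side _ _ j acc]) (simp_all add: scale_def)
  then show ?thesis by (rule computable_weaken[where e = j]) simp
qed

lemma ptime_iter_le:
  assumes "ptime d N" "ptime d A" "ptime (Suc (Suc d)) (\<lambda>I \<rho>. G I \<rho> (\<rho> d) (\<rho> (Suc d)))"
    "\<And>I \<rho> i a. G I (\<rho>(d := i, Suc d := a)) i a = G I \<rho> i a" "bounded N"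
    and B: "ptime d B" and le: "\<And>I \<rho> i. i \<le> N I \<rho> \<Longrightarrow> iter (G I \<rho>) (A I \<rho>) i \<le> B I \<rho>"
  shows "ptime d (\<lambda>I \<rho>. iter (G I \<rho>) (A I \<rho>) (N I \<rho>))"
proof (rule ptime_iter[OF assms(1-5)])
  fix b
  show "\<exists>j. \<forall>I \<rho> i. admissible I d \<rho> b \<longrightarrow> i \<le> N I \<rho> \<longrightarrow>
      bitlen (iter (G I \<rho>) (A I \<rho>) i) \<le> scale I ^ j"
    using ptime_bitlen[OF B, of b] bitlen_mono[OF le] by (meson order_trans)
qed

lemma ptime_count:
  assumes N: "ptime d N" and NX: "bounded N"
    and P: "ptime (Suc d) (\<lambda>I \<rho>. of_bool (P I \<rho> (\<rho> d)))"
    and side: "\<And>I \<rho> i a. P I (\<rho>(d := i, Suc d := a)) i = P I \<rho> i"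
  shows "ptime d (\<lambda>I \<rho>. \<Sum>i<N I \<rho>. of_bool (P I \<rho> i))"
proof -
  have sum: "(\<Sum>i<n. of_bool (Q i)) = iter (\<lambda>i a. a + of_bool (Q i)) 0 n" for Q and n :: nat
    by (induction n) simp_all
  show ?thesis unfolding sum
  proof (rule ptime_iter_le[OF N ptime_const _ _ NX N])
    show "ptime (Suc (Suc d)) (\<lambda>I \<rho>. \<rho> (Suc d) + of_bool (P I \<rho> (\<rho> d)))"
      by (intro computable_add ptime_var computable_lift[OF P]) simp_all
    have "iter (\<lambda>i a. a + of_bool (P I \<rho> i)) 0 i \<le> i" for I \<rho> i by (induction i) auto
    then show "i \<le> N I \<rho> \<Longrightarrow> iter (\<lambda>i a. a + of_bool (P I \<rho> i)) 0 i \<le> N I \<rho>" for I \<rho> i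
      using order_trans by blast
  qed (simp add: side)
qed

lemma ptime_all:
  assumes "ptime d N" "bounded N" "ptime (Suc d) (\<lambda>I \<rho>. of_bool (P I \<rho> (\<rho> d)))"
    "\<And>I \<rho> i a. P I (\<rho>(d := i, Suc d := a)) i = P I \<rho> i"
  shows "ptime d (\<lambda>I \<rho>. of_bool (\<forall>i<N I \<rho>. P I \<rho> i))"
proof -
  have "ptime d (\<lambda>I \<rho>. \<Sum>i<N I \<rho>. of_bool (\<not> P I \<rho> i))"
    by (intro ptime_count ptime_not assms) (simp add: assms(4))
  then have "ptime d (\<lambda>I \<rho>. of_bool ((\<Sum>i<N I \<rho>. of_bool (\<not> P I \<rho> i)) = (0::nat)))"
    by (rule ptime_eq[OF _ ptime_const])
  moreover have "(\<Sum>i<n. of_bool (\<not> Q i)) = (0::nat) \<longleftrightarrow> (\<forall>i<n. Q i)" for n and Q :: "nat \<Rightarrow> bool"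
    by (auto simp: sum_eq_0_iff simp del: sum_of_bool_eq)
  ultimately show ?thesis by (simp only:)
qed

lemma ptime_ex:
  assumes "ptime d N" "bounded N" "ptime (Suc d) (\<lambda>I \<rho>. of_bool (P I \<rho> (\<rho> d)))"
    "\<And>I \<rho> i a. P I (\<rho>(d := i, Suc d := a)) i = P I \<rho> i"
  shows "ptime d (\<lambda>I \<rho>. of_bool (\<exists>i<N I \<rho>. P I \<rho> i))"
proof -
  have "ptime d (\<lambda>I \<rho>. of_bool (\<not> (\<forall>i<N I \<rho>. \<not> P I \<rho> i)))"
    by (intro ptime_not ptime_all assms) (simp add: assms(4))
  then show ?thesis by simp
qed

lemma ptime_search:
  assumes N: "ptime d N" and NX: "bounded N" and A: "ptime d A"
    and P: "ptime (Suc d) (\<lambda>I \<rho>. of_bool (P I \<rho> (\<rho> d)))"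
    and side: "\<And>I \<rho> i a. P I (\<rho>(d := i, Suc d := a)) i = P I \<rho> i"
  shows "ptime d (\<lambda>I \<rho>. search (P I \<rho>) (A I \<rho>) (N I \<rho>))"
proof -
  have s: "search Q a n = iter (\<lambda>i a. if Q i then i else a) a n" for Q a n
    by (induction n) simp_all
  show ?thesis unfolding s
  proof (rule ptime_iter_le[OF N A _ _ NX computable_add[OF A N]])
    show "ptime (Suc (Suc d)) (\<lambda>I \<rho>. if P I \<rho> (\<rho> d) then \<rho> d else \<rho> (Suc d))"
      by (intro ptime_If ptime_var computable_lift[OF P]) simp_all
    have "iter (\<lambda>i a. if P I \<rho> i then i else a) (A I \<rho>) i \<le> A I \<rho> + i" for I \<rho> i by (induction i) auto
    then show "i \<le> N I \<rho> \<Longrightarrow> iter (\<lambda>i a. if P I \<rho> i then i else a) (A I \<rho>) i \<le> A I \<rho> + N I \<rho>" for I \<rho> i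
      by (meson add_le_cancel_left order_trans)
  qed (simp add: side)
qed

section \<open>Powers and bit tables\<close>

lemma bitlen_power: "bitlen (a ^ i) \<le> Suc i * bitlen a"
proof (induction i)
  case 0
  then show ?case using bitlen_pos[of a] by simp
next
  case (Suc i)
  then show ?case using bitlen_mult[of a "a ^ i"] by simp
qed

lemma ptime_power:
  assumes N: "ptime d N" and NX: "bounded N" and A: "ptime d A"
    and side: "\<And>I \<rho> i a. A I (\<rho>(d := i, Suc d := a)) = A I \<rho>"
  shows "ptime d (\<lambda>I \<rho>. A I \<rho> ^ N I \<rho>)"
proof -
  have s: "a ^ n = iter (\<lambda>i x. x * a) 1 n" for a n :: nat
    by (induction n) simp_all
  show ?thesis unfolding s
  proof (rule ptime_iter[OF N ptime_const _ _ NX])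
    show "ptime (Suc (Suc d)) (\<lambda>I \<rho>. \<rho> (Suc d) * A I \<rho>)"
      by (intro computable_mult ptime_var computable_lift[OF A]) simp_all
    fix b
    obtain e where e: "\<And>I \<rho>. admissible I d \<rho> b \<Longrightarrow> bitlen (A I \<rho>) \<le> scale I ^ e"
      using ptime_bitlen[OF A] by blast
    obtain j where j: "\<And>I \<rho>. N I \<rho> \<le> scale I ^ j" using NX unfolding bounded_def by blast
    have "bitlen (iter (\<lambda>i x. x * A I \<rho>) 1 i) \<le> scale I ^ (Suc j + e)"
      if "admissible I d \<rho> b" "i \<le> N I \<rho>" for I \<rho> i
    proof -
      have "Suc i \<le> scale I ^ Suc j"
        using that(2) j[of I \<rho>] pow_sum_le[OF scale_ge_2, of I 0 j] by simp
      then have "Suc i * bitlen (A I \<rho>) \<le> scale I ^ Suc j * scale I ^ e"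
        using e[OF that(1)] by (rule mult_le_mono)
      then show ?thesis using bitlen_power[of "A I \<rho>" i] unfolding s[symmetric] power_add by linarith
    qed
    then show "\<exists>j. \<forall>I \<rho> i. admissible I d \<rho> b \<longrightarrow> i \<le> N I \<rho> \<longrightarrow>
      bitlen (iter (\<lambda>i x. x * A I \<rho>) 1 i) \<le> scale I ^ j" by blast
  qed (simp add: side)
qed

text \<open>The accumulator is a table of \<open>Z I\<close> bits stored in one number; polynomially
  many bits are a polynomial length.\<close>

lemma ptime_iter_table:
  assumes "ptime d N" "ptime d A" "ptime (Suc (Suc d)) (\<lambda>I \<rho>. G I \<rho> (\<rho> d) (\<rho> (Suc d)))"
    "\<And>I \<rho> i a. G I (\<rho>(d := i, Suc d := a)) i a = G I \<rho> i a" "bounded N"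
    and Z: "ptime d (\<lambda>I \<rho>. Z I)" "bounded (\<lambda>I \<rho>. Z I)"
    and small: "\<And>I \<rho> i a. a < 2 ^ Z I \<Longrightarrow> G I \<rho> i a < 2 ^ Z I" "\<And>I \<rho>. A I \<rho> < 2 ^ Z I"
  shows "ptime d (\<lambda>I \<rho>. iter (G I \<rho>) (A I \<rho>) (N I \<rho>))"
proof (rule ptime_iter_le[OF assms(1-5) ptime_power[OF Z ptime_const]])
  have "iter (G I \<rho>) (A I \<rho>) i < 2 ^ Z I" for I \<rho> i by (induction i) (simp_all add: small)
  then show "iter (G I \<rho>) (A I \<rho>) i \<le> 2 ^ Z I" for I \<rho> i by (rule less_imp_le)
qed simp

definition tab :: "nat \<Rightarrow> (nat \<Rightarrow> bool) \<Rightarrow> nat" where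
  "tab N P = (\<Sum>i<N. of_bool (P i) * 2 ^ i)"

lemma tab_less: "tab N P < 2 ^ N"
  unfolding tab_def by (induction N) auto

lemma odd_tab_div: "i < N \<Longrightarrow> odd (tab N P div 2 ^ i) \<longleftrightarrow> P i"
proof (induction N)
  case (Suc N)
  have e: "tab (Suc N) P = tab N P + of_bool (P N) * 2 ^ N" by (simp add: tab_def)
  show ?case
  proof (cases "i = N")
    case True
    then show ?thesis using tab_less[of N P] unfolding e by simp
  next
    case False
    then have i: "i < N" using Suc.prems by simp
    then have "(2::nat) ^ N = 2 ^ i * 2 ^ (N - i)" by (simp flip: power_add)
    then have "tab (Suc N) P div 2 ^ i = tab N P div 2 ^ i + of_bool (P N) * 2 ^ (N - i)"
      unfolding e by (simp add: mult.left_commute)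
    then show ?thesis using Suc.IH[OF i] i by simp
  qed
qed simp

lemma ptime_tab:
  assumes N: "ptime d N" and NX: "bounded N"
    and P: "ptime (Suc d) (\<lambda>I \<rho>. of_bool (P I \<rho> (\<rho> d)))"
    and side: "\<And>I \<rho> i a. P I (\<rho>(d := i, Suc d := a)) i = P I \<rho> i"
    and sideN: "\<And>I \<rho> i a. N I (\<rho>(d := i, Suc d := a)) = N I \<rho>"
  shows "ptime d (\<lambda>I \<rho>. tab (N I \<rho>) (P I \<rho>))"
proof -
  \<comment> \<open>The clamp \<open>min i n\<close> changes nothing inside the range and makes the
    exponent bounded for every value of the counter variable.\<close>
  have s: "tab n Q = iter (\<lambda>i x. x + of_bool (Q i) * 2 ^ min i n) 0 n" for n Q
  proof -
    have "iter (\<lambda>i x. x + of_bool (Q i) * 2 ^ min i n) 0 m = tab m Q" if "m \<le> n" for m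
      using that by (induction m) (auto simp: tab_def)
    then show ?thesis by simp
  qed
  show ?thesis unfolding s
  proof (rule ptime_iter_le[OF N ptime_const _ _ NX ptime_power[OF N NX ptime_const]])
    show "ptime (Suc (Suc d)) (\<lambda>I \<rho>. \<rho> (Suc d) + of_bool (P I \<rho> (\<rho> d)) * 2 ^ min (\<rho> d) (N I \<rho>))"
      by (intro computable_add computable_mult ptime_var computable_lift[OF P] ptime_power ptime_min
          computable_lift[OF N] bounded_min NX ptime_const) simp_all
    have "iter (\<lambda>i x. x + of_bool (P I \<rho> i) * 2 ^ min i (N I \<rho>)) 0 i = tab i (P I \<rho>)" if "i \<le> N I \<rho>" for I \<rho> i
      using that by (induction i) (auto simp: tab_def)
    moreover have "tab i (P I \<rho>) \<le> 2 ^ N I \<rho>" if "i \<le> N I \<rho>" for I \<rho> i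
    proof -
      have "(2 :: nat) ^ i \<le> 2 ^ N I \<rho>" using that by (intro power_increasing) simp_all
      then show ?thesis using tab_less[of i "P I \<rho>"] by linarith
    qed
    ultimately show "i \<le> N I \<rho> \<Longrightarrow> iter (\<lambda>i x. x + of_bool (P I \<rho> i) * 2 ^ min i (N I \<rho>)) 0 i \<le> (2 :: nat) ^ N I \<rho>" for I \<rho> i
      by simp
  qed (simp_all add: side sideN)
qed

text \<open>Reducing modulo 2 in every round keeps the accumulator at one bit, so the sum may have
  superpolynomially many terms.\<close>

lemma computable_parity:
  assumes N: "ptime d N" and F: "computable W (Suc d) (\<lambda>I \<rho>. F I \<rho> (\<rho> d))"
    and side: "\<And>I \<rho> i a. F I (\<rho>(d := i, Suc d := a)) i = F I \<rho> i"
    and pos: "\<And>I. 0 < X I" "\<And>I. 0 < W I" and NX: "\<And>I \<rho>. N I \<rho> \<le> X I"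
  shows "computable (\<lambda>I. X I * W I) d (\<lambda>I \<rho>. (\<Sum>i<N I \<rho>. F I \<rho> i) mod 2)"
proof -
  have s: "(\<Sum>i<n. Q i) mod 2 = iter (\<lambda>i x. (x + Q i) mod 2) 0 n" for n :: nat and Q :: "nat \<Rightarrow> nat"
  proof (induction n)
    case (Suc n)
    then show ?case by (metis iter.simps(2) mod_add_left_eq sum.lessThan_Suc)
  qed simp
  show ?thesis unfolding s
  proof (rule computable_iter[OF N ptime_const _ _ pos NX])
    have v: "computable W (Suc (Suc d)) (\<lambda>I \<rho>. \<rho> (Suc d))" "computable W (Suc (Suc d)) (\<lambda>I \<rho>. 2)"
      using pos(2) by (auto intro!: ptime_computable ptime_var ptime_const)
    show "computable W (Suc (Suc d)) (\<lambda>I \<rho>. (\<rho> (Suc d) + F I \<rho> (\<rho> d)) mod 2)"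
      by (intro computable_mod computable_add v computable_lift[OF F]) simp
    have "bitlen (iter (\<lambda>i x. (x + F I \<rho> i) mod 2) 0 i) \<le> scale I ^ 0" for I \<rho> i
    proof -
      have "iter (\<lambda>i x. (x + F I \<rho> i) mod 2) 0 i \<le> 1" by (cases i) auto
      from bitlen_mono[OF this] show ?thesis by simp
    qed
    then show "\<exists>j. \<forall>I \<rho> i. admissible I d \<rho> b \<longrightarrow> i \<le> N I \<rho> \<longrightarrow>
      bitlen (iter (\<lambda>i x. (x + F I \<rho> i) mod 2) 0 i) \<le> scale I ^ j" for b by blast
  qed (simp add: side)
qed

section \<open>The program\<close>

text \<open>Procedures are analysed once, in standard variables, and then instantiated with
  arbitrary polynomial time arguments. Eight is the largest arity that occurs (for
  \<open>project\<close>); smaller calls are padded with copies of their first argument.\<close>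

lemma call8:
  assumes "computable W 8 (\<lambda>I \<rho>. g I (\<rho> 0) (\<rho> 1) (\<rho> 2) (\<rho> 3) (\<rho> 4) (\<rho> 5) (\<rho> 6) (\<rho> 7))" "ptime d a0" "ptime d a1" "ptime d a2" "ptime d a3" "ptime d a4" "ptime d a5" "ptime d a6" "ptime d a7" "\<And>I. 0 < W I"
  shows "computable W d (\<lambda>I \<rho>. g I (a0 I \<rho>) (a1 I \<rho>) (a2 I \<rho>) (a3 I \<rho>) (a4 I \<rho>) (a5 I \<rho>) (a6 I \<rho>) (a7 I \<rho>))"
proof -
  have "ptime d ([a0, a1, a2, a3, a4, a5, a6, a7] ! j)" if "j < 8" for j
    using that assms by (auto simp: less_Suc_eq numeral_eq_Suc)
  then show ?thesis
    using computable_call[OF assms(1), where f = "\<lambda>j. [a0, a1, a2, a3, a4, a5, a6, a7] ! j" and d = d] assms(10)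
    by (simp add: numeral_eq_Suc)
qed

lemma call2:
  assumes "computable W 2 (\<lambda>I \<rho>. g I (\<rho> 0) (\<rho> 1))" "ptime d a0" "ptime d a1" "\<And>I. 0 < W I"
  shows "computable W d (\<lambda>I \<rho>. g I (a0 I \<rho>) (a1 I \<rho>))"
  by (rule call8[where g = "\<lambda>I x y _ _ _ _ _ _. g I x y", OF computable_lift[OF assms(1)] assms(2,3,2,2,2,2,2,2,4)]) simp

lemma call3:
  assumes "computable W 3 (\<lambda>I \<rho>. g I (\<rho> 0) (\<rho> 1) (\<rho> 2))" "ptime d a0" "ptime d a1" "ptime d a2" "\<And>I. 0 < W I"
  shows "computable W d (\<lambda>I \<rho>. g I (a0 I \<rho>) (a1 I \<rho>) (a2 I \<rho>))"
  by (rule call8[where g = "\<lambda>I x y z _ _ _ _ _. g I x y z", OF computable_lift[OF assms(1)] assms(2,3,4,2,2,2,2,2,5)]) simp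

lemma call5:
  assumes "computable W 5 (\<lambda>I \<rho>. g I (\<rho> 0) (\<rho> 1) (\<rho> 2) (\<rho> 3) (\<rho> 4))" "ptime d a0" "ptime d a1" "ptime d a2" "ptime d a3" "ptime d a4" "\<And>I. 0 < W I"
  shows "computable W d (\<lambda>I \<rho>. g I (a0 I \<rho>) (a1 I \<rho>) (a2 I \<rho>) (a3 I \<rho>) (a4 I \<rho>))"
  by (rule call8[where g = "\<lambda>I x y z u v _ _ _. g I x y z u v", OF computable_lift[OF assms(1)] assms(2,3,4,5,6,2,2,2,7)]) simp

lemmas ptime_call2 = call2[where W = "\<lambda>_. 1", OF _ _ _ zero_less_one]
lemmas ptime_call3 = call3[where W = "\<lambda>_. 1", OF _ _ _ _ zero_less_one]
lemmas ptime_call5 = call5[where W = "\<lambda>_. 1", OF _ _ _ _ _ _ zero_less_one]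
lemmas ptime_call8 = call8[where W = "\<lambda>_. 1", OF _ _ _ _ _ _ _ _ _ zero_less_one]

lemmas ptime_rules =
  ptime_var ptime_const ptime_siz ptime_len ptime_Suc computable_add computable_diff computable_mult
  computable_div computable_mod ptime_min ptime_mem ptime_conj ptime_imp ptime_disj ptime_not ptime_eq ptime_le
  ptime_less ptime_odd ptime_if_bool ptime_If ptime_all ptime_ex ptime_count ptime_search ptime_power
  bounded_siz bounded_Suc_len bounded_mult bounded_min

section \<open>Procedures for the combinatorial predicates\<close>

abbreviation vars :: "inst \<Rightarrow> nat" where "vars I \<equiv> Suc (len I)"

lemma ptime_decode_base: "ptime 2 (\<lambda>I \<rho>. decode (vars I) (\<rho> 0) (\<rho> 1))"
proof -
  \<comment> \<open>An exponent must be bounded for all arguments, also where the guard fails; hence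
    the clamp \<open>min x N\<close>.\<close>
  have "decode N c x = (if x < N then c div N ^ min x N mod N else x)" for N c x
    by (simp add: decode_def digit_def min_def)
  then show ?thesis by (simp only:) (rule ptime_rules | (simp; fail))+
qed

lemmas ptime_decode = ptime_call2[where g = "\<lambda>I c x. decode (vars I) c x", OF ptime_decode_base]

lemma ptime_hair_base: "ptime 2 (\<lambda>I \<rho>. of_bool (hair (decode (vars I) (\<rho> 0)) (\<rho> 1)))"
  unfolding hair_def by (rule ptime_rules ptime_decode | (simp; fail))+

lemmas ptime_hair = ptime_call2[where g = "\<lambda>I c x. of_bool (hair (decode (vars I) c) x)", OF ptime_hair_base]

lemma ptime_tip_base: "ptime 2 (\<lambda>I \<rho>. of_bool (tip (decode (vars I) (\<rho> 0)) (\<rho> 1)))"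
  unfolding tip_def by (rule ptime_rules ptime_hair | (simp; fail))+

lemmas ptime_tip = ptime_call2[where g = "\<lambda>I c x. of_bool (tip (decode (vars I) c) x)", OF ptime_tip_base]

lemma ptime_hub_base: "ptime 2 (\<lambda>I \<rho>. of_bool (hub (decode (vars I) (\<rho> 0)) (\<rho> 1)))"
  unfolding hub_def by (rule ptime_rules ptime_hair ptime_tip ptime_decode | (simp; fail))+

lemmas ptime_hub = ptime_call2[where g = "\<lambda>I c x. of_bool (hub (decode (vars I) c) x)", OF ptime_hub_base]

lemma rank_sum: "rank M m = (\<Sum>i<m. of_bool (hub M i))"
  by (induction m) simp_all

lemma rank_le: "rank M m \<le> m"
  by (induction m) auto

lemma ptime_rank_base: "ptime 2 (\<lambda>I \<rho>. rank (decode (vars I) (\<rho> 0)) (min (\<rho> 1) (vars I)))"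
  unfolding rank_sum by (rule ptime_rules ptime_hub | (simp; fail))+

lemmas ptime_rank = ptime_call2[where g = "\<lambda>I c x. rank (decode (vars I) c) (min x (vars I))", OF ptime_rank_base]

lemma bounded_rank: "bounded (\<lambda>I \<rho>. rank (M I \<rho>) (min (x I \<rho>) (vars I)) div 3)"
proof (rule boundedI[where j = 1])
  fix I \<rho>
  have "rank (M I \<rho>) (min (x I \<rho>) (vars I)) div 3 \<le> rank (M I \<rho>) (min (x I \<rho>) (vars I))" by simp
  also have "\<dots> \<le> vars I" using rank_le min.cobounded2 by (rule order_trans)
  finally show "rank (M I \<rho>) (min (x I \<rho>) (vars I)) div 3 \<le> scale I ^ 1" by (simp add: scale_def)
qed

lemma ptime_stuck_base: "ptime 2 (\<lambda>I \<rho>. of_bool (stuck (decode (vars I) (\<rho> 0)) (\<rho> 1)))"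
  unfolding stuck_def by (rule ptime_rules ptime_decode | (simp; fail))+

lemmas ptime_stuck = ptime_call2[where g = "\<lambda>I c x. of_bool (stuck (decode (vars I) c) x)", OF ptime_stuck_base]

lemma ptime_valid: "ptime 4 (\<lambda>I \<rho>. of_bool (valid (vars I) (decode (vars I) (\<rho> 3))))"
  unfolding valid_def by (rule ptime_rules ptime_decode ptime_stuck | (simp; fail))+

text \<open>The whole constraint table is one natural number in a single register. Under logarithmic
  cost a polynomial number of bits has polynomial cost, so no array in memory is required. The index
  is the mixed radix number with digits \<open>x\<close>, \<open>y\<close>, \<open>u\<close>,
  \<open>v\<close>.\<close>

definition enc :: "nat \<Rightarrow> nat \<Rightarrow> csp \<Rightarrow> nat" where
  "enc N n R = tab (N * N * (n * n))
     (\<lambda>i. R (i div (n * n) div N) (i div (n * n) mod N) (i div n mod n) (i mod n))"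

definition dec :: "nat \<Rightarrow> nat \<Rightarrow> nat \<Rightarrow> csp" where
  "dec N n T = (\<lambda>x y u v. x < N \<and> y < N \<and> u < n \<and> v < n \<and>
     odd (T div 2 ^ ((x * N + y) * (n * n) + (u * n + v))))"

abbreviation code :: "inst \<Rightarrow> csp \<Rightarrow> nat" where "code I \<equiv> enc (vars I) (siz I)"

abbreviation csp_of :: "inst \<Rightarrow> nat \<Rightarrow> csp" where "csp_of I \<equiv> dec (vars I) (siz I)"

lemma pair_less: "x < a \<Longrightarrow> y < b \<Longrightarrow> x * b + y < a * (b::nat)"
proof -
  assume "x < a" "y < b"
  then have "x * b + y < Suc x * b" by simp
  also have "\<dots> \<le> a * b" using \<open>x < a\<close> by (intro mult_le_mono1) simp
  finally show ?thesis .
qed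

lemma dec_enc: "dec N n (enc N n R) = trunc N n R"
proof -
  have "odd (enc N n R div 2 ^ ((x * N + y) * (n * n) + (u * n + v))) \<longleftrightarrow> R x y u v"
    if "x < N" "y < N" "u < n" "v < n" for x y u v
  proof -
    define j where "j = u * n + v"
    define i where "i = (x * N + y) * (n * n) + j"
    have j: "j < n * n" using pair_less that by (simp add: j_def)
    then have i: "i < N * N * (n * n)"
      unfolding i_def using pair_less that by (metis (no_types, lifting))
    have "i div (n * n) = x * N + y" using j that by (simp add: i_def)
    moreover have "i div n = (x * N + y) * n + u" "i mod n = v"
      using that by (simp_all add: i_def j_def div_mult_self3 flip: mult.assoc add.assoc distrib_right)
    ultimately show ?thesis
      using odd_tab_div[OF i] that unfolding enc_def i_def[symmetric] j_def[symmetric] by simp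
  qed
  then show ?thesis by (auto simp: dec_def trunc_def fun_eq_iff)
qed

lemma ptime_enc:
  assumes "ptime (Suc d) (\<lambda>I \<rho>. of_bool (R I \<rho> (\<rho> d div (siz I * siz I) div vars I)
      (\<rho> d div (siz I * siz I) mod vars I) (\<rho> d div siz I mod siz I) (\<rho> d mod siz I)))"
    and "\<And>I \<rho> i a x y u v. R I (\<rho>(d := i, Suc d := a)) x y u v = R I \<rho> x y u v"
  shows "ptime d (\<lambda>I \<rho>. code I (R I \<rho>))"
  unfolding enc_def by (rule ptime_tab ptime_rules assms | (simp add: assms(2); fail))+

lemma ptime_dec_base:
  "ptime 5 (\<lambda>I \<rho>. of_bool (csp_of I (\<rho> 0) (\<rho> 1) (\<rho> 2) (\<rho> 3) (\<rho> 4)))"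
proof -
  have "dec N n T = (\<lambda>x y u v. x < N \<and> y < N \<and> u < n \<and> v < n \<and>
     odd (T div 2 ^ min ((x * N + y) * (n * n) + (u * n + v)) (N * N * (n * n))))" for N n T
  proof -
    have "min ((x * N + y) * (n * n) + (u * n + v)) (N * N * (n * n)) = (x * N + y) * (n * n) + (u * n + v)"
      if "x < N" "y < N" "u < n" "v < n" for x y u v
      using pair_less[OF pair_less[OF that(1,2)] pair_less[OF that(3,4)]] by simp
    then show ?thesis by (auto simp: dec_def fun_eq_iff)
  qed
  then show ?thesis by (simp only:) (rule ptime_rules | (simp; fail))+
qed

lemmas ptime_dec = ptime_call5[where g = "\<lambda>I T x y u v. of_bool (csp_of I T x y u v)",
    OF ptime_dec_base]

lemma ptime_linked_base: "ptime 3 (\<lambda>I \<rho>. of_bool (linked (siz I) (csp_of I (\<rho> 0)) (\<rho> 1) (\<rho> 2)))"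
  unfolding linked_def by (rule ptime_rules ptime_dec | (simp; fail))+

lemmas ptime_linked = ptime_call3[where g = "\<lambda>I T x y. of_bool (linked (siz I) (csp_of I T) x y)",
    OF ptime_linked_base]

lemma ptime_second_base: "ptime 2 (\<lambda>I \<rho>. second_partner (vars I) (siz I) (csp_of I (\<rho> 0)) (\<rho> 1))"
  unfolding second_partner_def by (rule ptime_rules ptime_linked | (simp; fail))+

lemmas ptime_second = ptime_call2[where g = "\<lambda>I T x. second_partner (vars I) (siz I) (csp_of I T) x",
    OF ptime_second_base]

lemma ptime_first_base: "ptime 2 (\<lambda>I \<rho>. first_partner (vars I) (siz I) (csp_of I (\<rho> 0)) (\<rho> 1))"
  unfolding first_partner_def by (rule ptime_rules ptime_linked ptime_second | (simp; fail))+

lemmas ptime_first = ptime_call2[where g = "\<lambda>I T x. first_partner (vars I) (siz I) (csp_of I T) x",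
    OF ptime_first_base]

lemma ptime_project_base: "ptime 8 (\<lambda>I \<rho>. of_bool (project (siz I) (csp_of I (\<rho> 0))
    (\<rho> 1) (\<rho> 2) (\<rho> 3) (\<rho> 4) (\<rho> 5) (\<rho> 6) (\<rho> 7)))"
  unfolding project_def by (rule ptime_rules ptime_dec | (simp; fail))+

lemmas ptime_project = ptime_call8[where g = "\<lambda>I T x a b y z u v.
    of_bool (project (siz I) (csp_of I T) x a b y z u v)", OF ptime_project_base]

lemma ptime_eliminate_base:
  "ptime 2 (\<lambda>I \<rho>. code I (eliminate (vars I) (siz I) (csp_of I (\<rho> 0)) (\<rho> 1)))"
  unfolding eliminate_def
  by (rule ptime_enc ptime_project ptime_first ptime_second ptime_rules | (simp; fail))+

lemmas ptime_eliminate = ptime_call2[where g = "\<lambda>I T x.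
    code I (eliminate (vars I) (siz I) (csp_of I T) x)", OF ptime_eliminate_base]

lemma ptime_pin_base:
  "ptime 3 (\<lambda>I \<rho>. code I (pin (csp_of I (\<rho> 0)) (\<rho> 1) (\<rho> 2)))"
  unfolding pin_def by (rule ptime_enc ptime_dec ptime_rules | (simp; fail))+

lemmas ptime_pin = ptime_call3[where g = "\<lambda>I T x g.
    code I (pin (csp_of I T) x g)", OF ptime_pin_base]

text \<open>The three passes carried out on encoded tables; decoding commutes with each of them. As
  before, \<open>min x N\<close> serves to bound the cost outside the range of the loop.\<close>

definition pins_table :: "(nat \<Rightarrow> nat) \<Rightarrow> nat \<Rightarrow> nat \<Rightarrow> nat \<Rightarrow> nat \<Rightarrow> nat" where
  "pins_table M N n g T = iter (\<lambda>x T. if hub M x \<and> rank M (min x N) mod 3 = 2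
     then enc N n (pin (dec N n T) x (g div n ^ (rank M (min x N) div 3) mod n)) else T) T N"

definition pass1_table :: "(nat \<Rightarrow> nat) \<Rightarrow> nat \<Rightarrow> nat \<Rightarrow> nat \<Rightarrow> nat" where
  "pass1_table M N n T = iter (\<lambda>x T. if hub M x then T else enc N n (eliminate N n (dec N n T) x)) T N"

definition pass2_table :: "nat \<Rightarrow> nat \<Rightarrow> nat \<Rightarrow> nat" where
  "pass2_table N n T = iter (\<lambda>x T. enc N n (eliminate N n (dec N n T) x)) T N"

lemma dec_pins_table: "dec N n (pins_table M N n g T) = pins M N n g (dec N n T) N"
proof -
  have "dec N n (iter (\<lambda>x T. if hub M x \<and> rank M (min x N) mod 3 = 2
     then enc N n (pin (dec N n T) x (g div n ^ (rank M (min x N) div 3) mod n)) else T) T m) =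
     pins M N n g (dec N n T) m" if "m \<le> N" for m
    using that by (induction m) (auto simp: pins_def pinned_def digit_def dec_enc)
  then show ?thesis by (simp add: pins_table_def)
qed

lemma dec_pass1_table: "dec N n (pass1_table M N n T) = pass1 M N n (dec N n T) N"
proof -
  have "dec N n (iter (\<lambda>x T. if hub M x then T else enc N n (eliminate N n (dec N n T) x)) T m) =
     pass1 M N n (dec N n T) m" for m
    by (induction m) (auto simp: pass1_def dec_enc)
  then show ?thesis by (simp add: pass1_table_def)
qed

lemma dec_pass2_table: "dec N n (pass2_table N n T) = pass2 N n (dec N n T) N"
proof -
  have "dec N n (iter (\<lambda>x T. enc N n (eliminate N n (dec N n T) x)) T m) = pass2 N n (dec N n T) m" for m
    by (induction m) (auto simp: pass2_def dec_enc)
  then show ?thesis by (simp add: pass2_table_def)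
qed

lemma enc_less: "enc N n R < 2 ^ (N * N * (n * n))"
  unfolding enc_def by (rule tab_less)

definition adjacent :: "inst \<Rightarrow> nat \<Rightarrow> nat \<Rightarrow> bool" where
  "adjacent I u v \<longleftrightarrow> mem I (u * siz I + v) = 1"

lemma ptime_fold_csp_base:
  "ptime 4 (\<lambda>I \<rho>. code I
     (fold_csp (adjacent I) (vars I - 1) (\<rho> 0) (\<rho> 1) (\<rho> 2) (decode (vars I) (\<rho> 3))))"
  unfolding fold_csp_def adjacent_def
  by (rule ptime_enc ptime_tip ptime_decode ptime_rules | (simp; fail))+

lemma enc_if_less:
  assumes "a < 2 ^ (N * N * (n * n))"
  shows "(if P then a else enc N n R) < 2 ^ (N * N * (n * n))"
    and "(if P then enc N n R else a) < 2 ^ (N * N * (n * n))"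
  using assms enc_less[of N n R] by (cases P; simp only: if_True if_False)+

text \<open>The bit bound is invariant because a round returns either its input or a fresh
  encoding.\<close>

lemma table_less:
  assumes "T < 2 ^ (N * N * (n * n))"
  shows "pins_table M N n g T < 2 ^ (N * N * (n * n))" "pass1_table M N n T < 2 ^ (N * N * (n * n))"
proof -
  have inv: "P a \<Longrightarrow> (\<And>i a. P a \<Longrightarrow> P (f i a)) \<Longrightarrow> P (iter f a m)" for P :: "nat \<Rightarrow> bool" and f a m
    by (induction m) auto
  show "pins_table M N n g T < 2 ^ (N * N * (n * n))"
    unfolding pins_table_def by (rule inv[where P = "\<lambda>T. T < 2 ^ (N * N * (n * n))"]) (rule assms enc_if_less, assumption?)+
  show "pass1_table M N n T < 2 ^ (N * N * (n * n))"
    unfolding pass1_table_def by (rule inv[where P = "\<lambda>T. T < 2 ^ (N * N * (n * n))"]) (rule assms enc_if_less, assumption?)+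
qed

lemma ptime_iter_csp:
  assumes "ptime d T" "\<And>I \<rho>. T I \<rho> < 2 ^ (vars I * vars I * (siz I * siz I))"
    and "ptime (Suc (Suc d)) (\<lambda>I \<rho>. G I \<rho> (\<rho> d) (\<rho> (Suc d)))"
    and "\<And>I \<rho> i a. G I (\<rho>(d := i, Suc d := a)) i a = G I \<rho> i a"
    and "\<And>I \<rho> i a. a < 2 ^ (vars I * vars I * (siz I * siz I)) \<Longrightarrow>
      G I \<rho> i a < 2 ^ (vars I * vars I * (siz I * siz I))"
  shows "ptime d (\<lambda>I \<rho>. iter (G I \<rho>) (T I \<rho>) (vars I))"
  by (rule ptime_iter_table[where Z = "\<lambda>I. vars I * vars I * (siz I * siz I)"] ptime_rules assms
      | assumption)+

lemma ptime_pins_table: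
  "ptime 5 (\<lambda>I \<rho>. pins_table (decode (vars I) (\<rho> 3)) (vars I) (siz I) (\<rho> 4)
     (code I (fold_csp (adjacent I) (vars I - 1) (\<rho> 0) (\<rho> 1) (\<rho> 2) (decode (vars I) (\<rho> 3)))))"
  unfolding pins_table_def
proof (rule ptime_iter_csp)
  show "ptime (Suc (Suc 5)) (\<lambda>I \<rho>. if hub (decode (vars I) (\<rho> 3)) (\<rho> 5) \<and>
       rank (decode (vars I) (\<rho> 3)) (min (\<rho> 5) (vars I)) mod 3 = 2
     then code I (pin (csp_of I (\<rho> (Suc 5))) (\<rho> 5)
       (\<rho> 4 div siz I ^ (rank (decode (vars I) (\<rho> 3)) (min (\<rho> 5) (vars I)) div 3) mod siz I)) else \<rho> (Suc 5))"
    by (rule ptime_pin ptime_hub ptime_rank bounded_rank ptime_rules | (simp; fail))+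
qed (rule computable_lift[OF ptime_fold_csp_base], simp, rule enc_less, simp, erule enc_if_less)

lemma ptime_pass1_table:
  assumes "ptime 5 T" "\<And>I \<rho>. T I \<rho> < 2 ^ (vars I * vars I * (siz I * siz I))"
  shows "ptime 5 (\<lambda>I \<rho>. pass1_table (decode (vars I) (\<rho> 3)) (vars I) (siz I) (T I \<rho>))"
  unfolding pass1_table_def
proof (rule ptime_iter_csp[OF assms])
  show "ptime (Suc (Suc 5)) (\<lambda>I \<rho>. if hub (decode (vars I) (\<rho> 3)) (\<rho> 5) then \<rho> (Suc 5)
     else code I (eliminate (vars I) (siz I) (csp_of I (\<rho> (Suc 5))) (\<rho> 5)))"
    by (rule ptime_eliminate ptime_hub ptime_rules | (simp; fail))+
qed (simp, erule enc_if_less)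

lemma ptime_pass2_table:
  assumes "ptime 5 T" "\<And>I \<rho>. T I \<rho> < 2 ^ (vars I * vars I * (siz I * siz I))"
  shows "ptime 5 (\<lambda>I \<rho>. pass2_table (vars I) (siz I) (T I \<rho>))"
  unfolding pass2_table_def
proof (rule ptime_iter_csp[OF assms])
  show "ptime (Suc (Suc 5)) (\<lambda>I \<rho>. code I (eliminate (vars I) (siz I)
      (csp_of I (\<rho> (Suc 5))) (\<rho> 5)))"
    by (rule ptime_eliminate ptime_rules | (simp; fail))+
qed (simp, rule enc_less)

lemma ptime_guess:
  "ptime 5 (\<lambda>I \<rho>. of_bool (guess (vars I) (siz I) (decode (vars I) (\<rho> 3)) (\<rho> 4)
     (trunc (vars I) (siz I) (fold_csp (adjacent I) (vars I - 1) (\<rho> 0) (\<rho> 1) (\<rho> 2) (decode (vars I) (\<rho> 3))))))"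
proof -
  define T where "T I \<rho> = pass2_table (vars I) (siz I) (pass1_table (decode (vars I) (\<rho> 3)) (vars I) (siz I)
    (pins_table (decode (vars I) (\<rho> 3)) (vars I) (siz I) (\<rho> 4)
      (code I (fold_csp (adjacent I) (vars I - 1) (\<rho> 0) (\<rho> 1) (\<rho> 2) (decode (vars I) (\<rho> 3))))))"
    for I and \<rho> :: "nat \<Rightarrow> nat"
  have T: "ptime 5 T"
    unfolding T_def by (intro ptime_pass2_table ptime_pass1_table ptime_pins_table table_less enc_less)
  have "ptime 2 (\<lambda>I \<rho>. of_bool (\<forall>x<vars I. \<forall>y<vars I. csp_of I (\<rho> 0) x y 0 0))"
    by (rule ptime_dec ptime_rules | (simp; fail))+
  \<comment> \<open>The final test depends on the table only; the second copy of \<open>T\<close>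
    fills a dummy argument of the binary call.\<close>
  from ptime_call2[where g = "\<lambda>I T _. of_bool (\<forall>x<vars I. \<forall>y<vars I. csp_of I T x y 0 0)", OF this T T]
  show ?thesis
    unfolding T_def dec_pass2_table dec_pass1_table dec_pins_table dec_enc guess_def accepts_def .
qed

text \<open>Number of codes times a bound on the number of guesses per code. The maximum keeps the
  weight positive for the graph without vertices.\<close>

definition weight :: "inst \<Rightarrow> nat" where
  "weight I = vars I ^ vars I * max 1 (siz I) ^ (vars I div 6)"

lemma weight_pos: "0 < weight I"
  by (simp add: weight_def less_max_iff_disj)

lemma computable_walk_parity:
  "computable weight 3 (\<lambda>I \<rho>. walk_parity (adjacent I) (siz I) (vars I) (\<rho> 0) (\<rho> 1) (\<rho> 2))"
proof -
  let ?X = "\<lambda>I :: inst. max 1 (siz I) ^ (vars I div 6)"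
  let ?M = "\<lambda>I c. decode (vars I) c"
  let ?f = "\<lambda>I \<rho> c g. of_bool (guess (vars I) (siz I) (?M I c) g
      (trunc (vars I) (siz I) (fold_csp (adjacent I) (vars I - 1) (\<rho> 0) (\<rho> 1) (\<rho> 2) (?M I c)))) :: nat"
  let ?n = "\<lambda>I c. if valid (vars I) (?M I c) then siz I ^ (rank (?M I c) (min (vars I) (vars I)) div 3) else 0"
  have "computable (\<lambda>I. ?X I * 1) 4 (\<lambda>I \<rho>. (\<Sum>g<?n I (\<rho> 3). ?f I \<rho> (\<rho> 3) g) mod 2)"
  proof (rule computable_parity)
    show "ptime 4 (\<lambda>I \<rho>. ?n I (\<rho> 3))"
      by (rule ptime_valid ptime_rank bounded_rank ptime_rules | (simp; fail))+
    show "ptime (Suc 4) (\<lambda>I \<rho>. ?f I \<rho> (\<rho> 3) (\<rho> 4))" using ptime_guess by simp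
    \<comment> \<open>This is where the exponent 1/6 enters the running time, through
      \<open>rank_bound\<close>.\<close>
    show "?n I (\<rho> 3) \<le> ?X I" for I and \<rho> :: "nat \<Rightarrow> nat"
    proof (cases "valid (vars I) (?M I (\<rho> 3))")
      case True
      interpret unstuck "?M I (\<rho> 3)" "len I" by (rule unstuck_decode[OF True])
      have "siz I ^ (rank (?M I (\<rho> 3)) (vars I) div 3) \<le> max 1 (siz I) ^ (rank (?M I (\<rho> 3)) (vars I) div 3)"
        by (rule power_mono) simp_all
      also have "\<dots> \<le> ?X I" using rank_bound by (intro power_increasing) simp_all
      finally show ?thesis using True by simp
    qed simp
  qed (simp_all add: less_max_iff_disj)
  moreover have Suc_3_eq: "Suc 3 = (4 :: nat)" by simp
  ultimately have inner: "computable (\<lambda>I. ?X I * 1) (Suc 3) (\<lambda>I \<rho>. (\<Sum>g<?n I (\<rho> 3). ?f I \<rho> (\<rho> 3) g) mod 2)"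
    by (simp only: Suc_3_eq)
  have "computable (\<lambda>I. vars I ^ vars I * (?X I * 1)) 3
      (\<lambda>I \<rho>. (\<Sum>c<vars I ^ vars I. (\<Sum>g<?n I c. ?f I \<rho> c g) mod 2) mod 2)"
  proof (rule computable_parity[where F = "\<lambda>I \<rho> c. (\<Sum>g<?n I c. ?f I \<rho> c g) mod 2"])
    show "ptime 3 (\<lambda>I \<rho>. vars I ^ vars I)"
      by (rule ptime_rules | (simp; fail))+
    show "computable (\<lambda>I. ?X I * 1) (Suc 3) (\<lambda>I \<rho>. (\<Sum>g<?n I (\<rho> 3). ?f I \<rho> (\<rho> 3) g) mod 2)"
      by (rule inner)
  qed (simp_all add: less_max_iff_disj)
  then show ?thesis
    unfolding walk_parity_def weight_def mod_sum_eq by (simp cong: if_cong)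
qed

lemmas walk_parity_call = call3[where W = weight and
  g = "\<lambda>I lo s t. walk_parity (adjacent I) (siz I) (vars I) lo s t", OF computable_walk_parity _ _ _ weight_pos]

text \<open>A path is read from its larger end, so that it is counted once; equality of the ends
  occurs for the path without edges.\<close>

definition path_parity :: "inst \<Rightarrow> nat" where
  "path_parity I = (\<Sum>s<siz I. (\<Sum>t<siz I. if t \<le> s then walk_parity (adjacent I) (siz I) (vars I) 0 s t
     else 0) mod 2) mod 2"

text \<open>Here \<open>x\<close> is the least vertex of the cycle and \<open>t < s\<close> are its
  neighbours, which fixes the orientation. What remains is a path on vertices above
  \<open>x\<close>, so \<open>len I\<close> is two less than the length of the cycle.\<close>

definition cycle_parity :: "inst \<Rightarrow> nat" where
  "cycle_parity I = (\<Sum>x<siz I. (\<Sum>s<siz I. (\<Sum>t<siz I.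
     if x < t \<and> t < s \<and> adjacent I x s \<and> adjacent I x t
     then walk_parity (adjacent I) (siz I) (vars I) (Suc x) s t else 0) mod 2) mod 2) mod 2"

text \<open>A sum over the vertices costs one factor \<open>scale I\<close>, which the polynomial
  part of the bound absorbs.\<close>

lemma computable_sum_siz:
  assumes F: "computable weight (Suc d) (\<lambda>I \<rho>. F I \<rho> (\<rho> d))"
    and side: "\<And>I \<rho> i a. F I (\<rho>(d := i, Suc d := a)) i = F I \<rho> i"
  shows "computable weight d (\<lambda>I \<rho>. (\<Sum>i<siz I. F I \<rho> i) mod 2)"
proof -
  have "computable (\<lambda>I. scale I * weight I) d (\<lambda>I \<rho>. (\<Sum>i<siz I. F I \<rho> i) mod 2)"
  proof (rule computable_parity[where F = F])
    show "computable weight (Suc d) (\<lambda>I \<rho>. F I \<rho> (\<rho> d))" by (rule F)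
  qed (simp_all add: ptime_siz[simplified] side scale_def weight_pos)
  then show ?thesis by (rule computable_weaken[where e = 1]) simp
qed

lemma computable_path: "computable weight 0 (\<lambda>I \<rho>. path_parity I)"
proof -
  have "computable weight (Suc (Suc 0)) (\<lambda>I \<rho>. if \<rho> (Suc 0) \<le> \<rho> 0
      then walk_parity (adjacent I) (siz I) (vars I) 0 (\<rho> 0) (\<rho> (Suc 0)) else 0)"
    by (intro computable_If walk_parity_call ptime_rules ptime_computable[OF ptime_const, of weight] weight_pos) simp_all
  then have "computable weight (Suc 0) (\<lambda>I \<rho>. (\<Sum>t<siz I. if t \<le> \<rho> 0
      then walk_parity (adjacent I) (siz I) (vars I) 0 (\<rho> 0) t else 0) mod 2)"
    by (rule computable_sum_siz[where F = "\<lambda>I \<rho> t. if t \<le> \<rho> 0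
      then walk_parity (adjacent I) (siz I) (vars I) 0 (\<rho> 0) t else 0"]) simp
  then show ?thesis unfolding path_parity_def
    by (rule computable_sum_siz[where F = "\<lambda>I \<rho> s. (\<Sum>t<siz I. if t \<le> s
      then walk_parity (adjacent I) (siz I) (vars I) 0 s t else 0) mod 2"]) (rule refl)
qed

lemma ptime_adjacent: "ptime d a \<Longrightarrow> ptime d b \<Longrightarrow> ptime d (\<lambda>I \<rho>. of_bool (adjacent I (a I \<rho>) (b I \<rho>)))"
  unfolding adjacent_def by (intro ptime_rules)

lemma computable_cycle: "computable weight 0 (\<lambda>I \<rho>. cycle_parity I)"
proof -
  define F where "F I x s t = (if x < t \<and> t < s \<and> adjacent I x s \<and> adjacent I x t
     then walk_parity (adjacent I) (siz I) (vars I) (Suc x) s t else 0)" for I x s t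
  have "computable weight (Suc (Suc (Suc 0))) (\<lambda>I \<rho>. F I (\<rho> 0) (\<rho> (Suc 0)) (\<rho> (Suc (Suc 0))))"
    unfolding F_def
    by (intro computable_If walk_parity_call ptime_adjacent ptime_rules ptime_computable[OF ptime_const, of weight] weight_pos)
      simp_all
  then have "computable weight (Suc (Suc 0)) (\<lambda>I \<rho>. (\<Sum>t<siz I. F I (\<rho> 0) (\<rho> (Suc 0)) t) mod 2)"
    by (rule computable_sum_siz[where F = "\<lambda>I \<rho> t. F I (\<rho> 0) (\<rho> (Suc 0)) t"]) simp
  then have "computable weight (Suc 0) (\<lambda>I \<rho>. (\<Sum>s<siz I. (\<Sum>t<siz I. F I (\<rho> 0) s t) mod 2) mod 2)"
    by (rule computable_sum_siz[where F = "\<lambda>I \<rho> s. (\<Sum>t<siz I. F I (\<rho> 0) s t) mod 2"]) simp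
  then show ?thesis unfolding cycle_parity_def F_def[symmetric]
    by (rule computable_sum_siz[where F = "\<lambda>I \<rho> x. (\<Sum>s<siz I. (\<Sum>t<siz I. F I x s t) mod 2) mod 2"]) (rule refl)
qed

lemma main_program:
  assumes "computable weight 0 (\<lambda>I \<rho>. f I)"
  shows "\<exists>p c. \<forall>I r. binary_memory I \<longrightarrow> r 0 = siz I \<longrightarrow> r 1 = len I \<longrightarrow>
    (\<exists>t r'. exec p (r, mem I) t (r', mem I) \<and> r' 0 = f I \<and> t \<le> 2 * (weight I * scale I ^ c) + 2)"
proof -
  obtain C T where T: "\<And>b. dominated weight (T b)" "\<And>b I \<rho>. admissible I 0 \<rho> b \<Longrightarrow> runs I C 0 \<rho> (f I) (T b I)"
    using assms by (rule computableE) blast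
  obtain c where c: "\<And>I. T 0 I \<le> weight I * scale I ^ c" using T(1)[of 0] unfolding dominated_def by blast
  \<comment> \<open>Registers 0 and 1 hold the input, so 2 is the first free one.\<close>
  let ?p = "Seq (C (\<lambda>_. 0) 2) (move 0 2)"
  have "\<exists>t r'. exec ?p (r, mem I) t (r', mem I) \<and> r' 0 = f I \<and> t \<le> 2 * (weight I * scale I ^ c) + 2"
    if bin: "binary_memory I" and r: "r 0 = siz I" "r 1 = len I" for I r
  proof -
    have R: "runs I C 0 (\<lambda>_. 0) (f I) (T 0 I)" using bin by (intro T(2)) (simp add: admissible_def)
    have "frame I 0 (\<lambda>_. 0) (\<lambda>_. 0) 2 r" using r by (simp add: frame_def)
    then obtain t r1 where 1: "exec (C (\<lambda>_. 0) 2) (r, mem I) t (r1, mem I)" "r1 2 = f I" "t \<le> T 0 I"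
      using runsE[OF R] by blast
    have "exec ?p (r, mem I) (t + (bitlen (r1 2) + 2)) (r1(0 := r1 2), mem I)"
      by (rule exec.Seq[OF 1(1) exec_move]) simp
    then show ?thesis using 1(2,3) runs_bitlen[OF R] c[of I] by (intro exI conjI) (assumption, auto)
  qed
  then show ?thesis by blast
qed

text \<open>The factor \<open>4 ^ (e + 1)\<close> comes from \<open>k = 1\<close>, where both sides
  agree; for \<open>k = 0\<close> the power of \<open>k\<close> is one. From 2 on,
  \<open>k + 1 \<le> k ^ 2\<close> and \<open>k + 3 \<le> k ^ 3\<close> turn everything into powers
  of \<open>k\<close>.\<close>

lemma power_bound:
  "(k + 1) ^ (k + 1) * (k + 3) ^ e \<le> 4 ^ (e + 1) * k ^ ((3 * e + 4) * k)"
proof -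
  consider "k = 0" | "k = 1" | "2 \<le> k" by linarith
  then show ?thesis
  proof cases
    case 1
    then show ?thesis using power_mono[of "3 :: nat" 4 e] by simp
  next
    case 2
    then show ?thesis by simp
  next
    case 3
    have k2: "k + 1 \<le> k ^ 2" using mult_le_mono1[OF 3, of k] 3 unfolding power2_eq_square by linarith
    have "2 * 2 * k \<le> k * k * k" using 3 by (intro mult_le_mono) auto
    then have k3: "k + 3 \<le> k ^ 3" using 3 unfolding power3_eq_cube by linarith
    have "(k + 1) ^ (k + 1) * (k + 3) ^ e \<le> (k ^ 2) ^ (k + 1) * (k ^ 3) ^ e"
      by (intro mult_le_mono power_mono k2 k3) simp_all
    also have "\<dots> = k ^ (2 * (k + 1) + 3 * e)" by (simp only: power_add power_mult)
    also have "\<dots> \<le> k ^ ((3 * e + 4) * k)"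
    proof (rule power_increasing)
      obtain d where "k = 2 + d" using le_Suc_ex[OF 3] by blast
      then show "2 * (k + 1) + 3 * e \<le> (3 * e + 4) * k" by (simp add: algebra_simps)
    qed (use 3 in simp)
    finally show ?thesis by (simp add: le_trans)
  qed
qed

text \<open>Covers both problems: \<open>K\<close> is \<open>k\<close> for paths and
  \<open>k - 2\<close> for cycles, and the slack \<open>k + 6\<close> pays for the two instructions
  that precede the cycle computation.\<close>

lemma time_bound:
  assumes K: "K \<le> k" and t: "t \<le> 2 * (weight (m, n, K) * scale (m, n, K) ^ c) + 2 + (k + 6)"
  shows "real t \<le> path_cycle_bound (4 ^ (c + 7)) (3 * (c + 6) + 4) (c + 7) n k"
proof -
  define N where "N = max 1 n"
  \<comment> \<open>The terms \<open>2 * q ^ c\<close> and \<open>q + 6\<close> are at most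
    \<open>q ^ Suc c\<close> and \<open>q ^ 4\<close>, and \<open>pow_sum_le\<close> adds one to the
    sum of the exponents.\<close>
  define e where "e = c + 6"
  define q where "q = n + k + 2"
  have q2: "2 \<le> q" by (simp add: q_def)
  have N1: "1 \<le> N" by (simp add: N_def)
  have w: "weight (m, n, K) \<le> (k + 1) ^ (k + 1) * N ^ ((k + 1) div 6)"
  proof -
    have "Suc K ^ Suc K \<le> (k + 1) ^ Suc K" using K by (intro power_mono) auto
    also have "\<dots> \<le> (k + 1) ^ (k + 1)" using K by (intro power_increasing) auto
    finally have "Suc K ^ Suc K \<le> (k + 1) ^ (k + 1)" .
    moreover have "N ^ (Suc K div 6) \<le> N ^ ((k + 1) div 6)"
      using K N1 by (intro power_increasing div_le_mono) auto
    ultimately show ?thesis unfolding weight_def N_def by (simp add: mult_le_mono)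
  qed
  have "scale (m, n, K) \<le> q" using K by (simp add: scale_def q_def)
  then have "scale (m, n, K) ^ c \<le> q ^ c" by (rule power_mono) simp
  then have 1: "weight (m, n, K) * scale (m, n, K) ^ c \<le> weight (m, n, K) * q ^ c" by (rule mult_le_mono2)
  have "2 * q ^ c \<le> q ^ Suc c" unfolding power_Suc by (rule mult_le_mono1[OF q2])
  moreover have "q + 6 \<le> q ^ 4"
  proof -
    have "2 * 2 * 2 * q \<le> q * q * q * q" using q2 by (intro mult_le_mono) auto
    then show ?thesis using q2 by (simp add: eval_nat_numeral)
  qed
  moreover have "q ^ Suc c + q ^ 4 \<le> q ^ e"
  proof -
    have "Suc (Suc c + 4) = e" by (simp add: e_def)
    then show ?thesis using pow_sum_le[OF q2, of "Suc c" 4] by (simp only:)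
  qed
  ultimately have "2 * q ^ c + (q + 6) \<le> q ^ e" by linarith
  then have "weight (m, n, K) * (2 * q ^ c + (q + 6)) \<le> weight (m, n, K) * q ^ e" by (rule mult_le_mono2)
  moreover have "q + 6 \<le> weight (m, n, K) * (q + 6)" using mult_le_mono1[of 1 "weight (m, n, K)" "q + 6"] weight_pos[of "(m, n, K)"] by simp
  ultimately have "t \<le> weight (m, n, K) * q ^ e" using t 1 unfolding distrib_left q_def by linarith
  also have "\<dots> \<le> (k + 1) ^ (k + 1) * N ^ ((k + 1) div 6) * (N * (k + 3)) ^ e"
  proof (intro mult_le_mono w power_mono)
    have "n + (k + 2) \<le> N + N * (k + 2)" using N1 mult_le_mono1[OF N1, of "k + 2"] by (intro add_le_mono) (simp_all add: N_def)
    then show "q \<le> N * (k + 3)" by (simp add: q_def algebra_simps)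
  qed simp
  also have "\<dots> = (k + 1) ^ (k + 1) * (k + 3) ^ e * N ^ ((k + 1) div 6 + e)"
    by (simp add: power_mult_distrib power_add mult_ac)
  also have "\<dots> \<le> 4 ^ (e + 1) * k ^ ((3 * e + 4) * k) * N ^ ((k + 1) div 6 + e)"
    by (rule mult_le_mono1[OF power_bound])
  finally have "real t \<le> real (4 ^ (e + 1) * k ^ ((3 * e + 4) * k) * N ^ ((k + 1) div 6 + e))"
    by (rule of_nat_mono)
  also have "\<dots> = real (4 ^ (e + 1)) * real k ^ ((3 * e + 4) * k) * real N powr real ((k + 1) div 6 + e)"
    using N1 by (simp only: of_nat_mult of_nat_power powr_realpow)
  also have "\<dots> \<le> real (4 ^ (e + 1)) * real k ^ ((3 * e + 4) * k) * real N powr (real k / 6 + real (e + 1))"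
  proof (rule mult_left_mono)
    \<comment> \<open>The additive constant \<open>e + 1\<close> instead of \<open>e\<close> pays
      for the shift from \<open>k\<close> to \<open>k + 1\<close> in the exponent.\<close>
    have "real ((k + 1) div 6) \<le> real (k + 1) / 6" by (metis of_nat_div_le_of_nat of_nat_numeral)
    then show "real N powr real ((k + 1) div 6 + e) \<le> real N powr (real k / 6 + real (e + 1))"
      using N1 by (intro powr_mono) auto
  qed simp
  finally show ?thesis by (simp add: path_cycle_bound_def e_def N_def add_ac)
qed

section \<open>Subgraphs as normalised maps\<close>

text \<open>Common form of paths and cycles: \<open>m\<close> edges, the \<open>i\<close>-th one
  joining position \<open>i\<close> to its successor \<open>\<sigma> i\<close>.\<close>

definition pattern_edges :: "nat \<Rightarrow> (nat \<Rightarrow> nat) \<Rightarrow> (nat \<Rightarrow> nat) \<Rightarrow> nat set set" where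
  "pattern_edges m \<sigma> v = (\<lambda>i. {v i, v (\<sigma> i)}) ` {..<m}"

definition pattern_image :: "nat \<Rightarrow> nat \<Rightarrow> (nat \<Rightarrow> nat) \<Rightarrow> (nat \<Rightarrow> nat) \<Rightarrow> nat ugraph" where
  "pattern_image N m \<sigma> v = (v ` {..<N}, pattern_edges m \<sigma> v)"

definition embeds :: "nat \<Rightarrow> nat \<Rightarrow> (nat \<Rightarrow> nat) \<Rightarrow> nat ugraph \<Rightarrow> (nat \<Rightarrow> nat) \<Rightarrow> bool" where
  "embeds N m \<sigma> G v \<longleftrightarrow> v \<in> {..<N} \<rightarrow>\<^sub>E verts G \<and> inj_on v {..<N} \<and> pattern_edges m \<sigma> v \<subseteq> edges G"

lemma pattern_edgesI: "i < m \<Longrightarrow> {v i, v (\<sigma> i)} \<in> pattern_edges m \<sigma> v"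
  by (simp add: pattern_edges_def)

lemma path_graph_eq: "path_graph k = pattern_image (Suc k) k Suc (\<lambda>i. i)"
  by (auto simp: path_graph_def pattern_image_def pattern_edges_def less_Suc_eq_le)

lemma cycle_graph_eq: "cycle_graph k = pattern_image k k (\<lambda>i. Suc i mod k) (\<lambda>i. i)"
  by (auto simp: cycle_graph_def pattern_image_def pattern_edges_def)

locale pattern =
  fixes N m :: nat and \<sigma> :: "nat \<Rightarrow> nat"
  assumes ends: "i < m \<Longrightarrow> i < N \<and> \<sigma> i < N \<and> \<sigma> i \<noteq> i"
begin

lemma pattern_image_cong:
  assumes "\<And>i. i < N \<Longrightarrow> v i = w i"
  shows "pattern_image N m \<sigma> v = pattern_image N m \<sigma> w"
proof -
  have "v ` {..<N} = w ` {..<N}" using assms by (intro image_cong) auto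
  moreover have "pattern_edges m \<sigma> v = pattern_edges m \<sigma> w"
    unfolding pattern_edges_def using assms ends by (intro image_cong) auto
  ultimately show ?thesis by (simp add: pattern_image_def)
qed

lemma pattern_neighbours:
  assumes inj: "inj_on g {..<N}" and i: "i < N" and e: "{g i, w} \<in> pattern_edges m \<sigma> g"
  shows "i < m \<and> w = g (\<sigma> i) \<or> (\<exists>j<m. i = \<sigma> j \<and> w = g j)"
proof -
  obtain j where j: "j < m" "{g i, w} = {g j, g (\<sigma> j)}" using e by (auto simp: pattern_edges_def)
  then consider "g i = g j" "w = g (\<sigma> j)" | "g i = g (\<sigma> j)" "w = g j" by (auto simp: doubleton_eq_iff)
  then show ?thesis
    using inj_onD[OF inj, of i j] inj_onD[OF inj, of i "\<sigma> j"] i j(1) ends[OF j(1)] by cases auto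
qed

text \<open>Relabelling by an automorphism of the pattern. Preservation of edges is asked of
  \<open>\<rho>\<close> and of its inverse \<open>\<rho>'\<close>, so that one inclusion, used for
  both maps, gives equality of the images.\<close>

lemma pattern_symmetry:
  assumes inj: "inj_on g {..<N}" and \<rho>: "\<And>i. i < N \<Longrightarrow> \<rho> i < N \<and> \<rho>' i < N \<and> \<rho> (\<rho>' i) = i"
    and e: "\<And>i. i < m \<Longrightarrow> \<exists>j<m. {\<rho> i, \<rho> (\<sigma> i)} = {j, \<sigma> j}"
    and e': "\<And>i. i < m \<Longrightarrow> \<exists>j<m. {\<rho>' i, \<rho>' (\<sigma> i)} = {j, \<sigma> j}"
  shows "inj_on (\<lambda>i. g (\<rho> i)) {..<N}"
    and "pattern_image N m \<sigma> (\<lambda>i. g (\<rho> i)) = pattern_image N m \<sigma> g"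
proof -
  have sub: "pattern_edges m \<sigma> (\<lambda>i. u (\<rho> i)) \<subseteq> pattern_edges m \<sigma> u"
    if e: "\<And>i. i < m \<Longrightarrow> \<exists>j<m. {\<rho> i, \<rho> (\<sigma> i)} = {j, \<sigma> j}" for u \<rho> :: "nat \<Rightarrow> nat"
  proof
    fix x assume "x \<in> pattern_edges m \<sigma> (\<lambda>i. u (\<rho> i))"
    then obtain i where i: "i < m" "x = u ` {\<rho> i, \<rho> (\<sigma> i)}" by (auto simp: pattern_edges_def)
    obtain j where "j < m" "{\<rho> i, \<rho> (\<sigma> i)} = {j, \<sigma> j}" using e[OF i(1)] by blast
    then show "x \<in> pattern_edges m \<sigma> u" using i(2) by (simp add: pattern_edges_def)
  qed
  have img: "\<rho> ` {..<N} = {..<N}"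
  proof -
    have "i \<in> \<rho> ` {..<N}" if "i < N" for i using \<rho>[OF that] by (intro image_eqI[of _ _ "\<rho>' i"]) auto
    then show ?thesis using \<rho> by auto
  qed
  have "(\<lambda>i. g (\<rho> i)) ` {..<N} = g ` \<rho> ` {..<N}" by (simp add: image_image)
  then have verts: "(\<lambda>i. g (\<rho> i)) ` {..<N} = g ` {..<N}" by (simp only: img)
  have "pattern_edges m \<sigma> g = pattern_edges m \<sigma> (\<lambda>i. g (\<rho> (\<rho>' i)))"
    unfolding pattern_edges_def using \<rho> ends by (intro image_cong) auto
  then have "pattern_edges m \<sigma> (\<lambda>i. g (\<rho> i)) = pattern_edges m \<sigma> g"
    using sub[where \<rho> = \<rho> and u = g, OF e] sub[where \<rho> = \<rho>' and u = "\<lambda>i. g (\<rho> i)", OF e'] by simp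
  then show "pattern_image N m \<sigma> (\<lambda>i. g (\<rho> i)) = pattern_image N m \<sigma> g"
    using verts by (simp add: pattern_image_def)
  have "card ((\<lambda>i. g (\<rho> i)) ` {..<N}) = card {..<N}" using verts card_image[OF inj] by simp
  then show "inj_on (\<lambda>i. g (\<rho> i)) {..<N}" by (intro eq_card_imp_inj_on) auto
qed

lemma subgraph_pattern_image:
  assumes v: "v \<in> extensional {..<N}" and inj: "inj_on v {..<N}"
    and G: "simple_graph G"
  shows "subgraph (pattern_image N m \<sigma> v) G \<longleftrightarrow> embeds N m \<sigma> G v"
proof -
  have "card {v i, v (\<sigma> i)} = 2" if "i < m" for i
    using inj_onD[OF inj, of i "\<sigma> i"] ends[OF that] by (auto simp: card_insert_if)
  then show ?thesis using v inj ends
    by (auto simp: subgraph_def simple_graph_def pattern_image_def embeds_def pattern_edges_def PiE_def)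
qed

text \<open>A subgraph isomorphic to the pattern is an orbit of embeddings under the automorphisms
  of the pattern. The normal form \<open>P\<close> selects one representative: \<open>ex\<close>
  says at least one, \<open>unique\<close> at most one.\<close>

lemma count_pattern:
  assumes G: "simple_graph G"
    and cong: "\<And>v w. (\<And>i. i < N \<Longrightarrow> v i = w i) \<Longrightarrow> P v \<Longrightarrow> P w"
    and ex: "\<And>g. inj_on g {..<N} \<Longrightarrow> \<exists>h. inj_on h {..<N} \<and> P h \<and> pattern_image N m \<sigma> h = pattern_image N m \<sigma> g"
    and unique: "\<And>v w i. inj_on v {..<N} \<Longrightarrow> inj_on w {..<N} \<Longrightarrow> P v \<Longrightarrow> P w \<Longrightarrow>
      pattern_image N m \<sigma> v = pattern_image N m \<sigma> w \<Longrightarrow> i < N \<Longrightarrow> v i = w i"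
  shows "count_subgraphs (pattern_image N m \<sigma> (\<lambda>i. i)) G = card {v. embeds N m \<sigma> G v \<and> P v}"
proof -
  let ?H = "pattern_image N m \<sigma> (\<lambda>i. i)"
  have inj: "inj_on (pattern_image N m \<sigma>) {v. embeds N m \<sigma> G v \<and> P v}"
  proof (rule inj_onI)
    fix v w assume vw: "v \<in> {v. embeds N m \<sigma> G v \<and> P v}" "w \<in> {v. embeds N m \<sigma> G v \<and> P v}"
      and "pattern_image N m \<sigma> v = pattern_image N m \<sigma> w"
    then have "v i = w i" if "i < N" for i using unique[of v w i] that by (auto simp: embeds_def)
    then show "v = w" using vw by (intro extensionalityI[of _ "{..<N}"]) (auto simp: embeds_def PiE_def)
  qed
  have "pattern_image N m \<sigma> ` {v. embeds N m \<sigma> G v \<and> P v} = {S. subgraph S G \<and> graph_iso ?H S}"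
  proof (intro equalityI subsetI)
    fix S assume "S \<in> pattern_image N m \<sigma> ` {v. embeds N m \<sigma> G v \<and> P v}"
    then obtain v where v: "embeds N m \<sigma> G v" "S = pattern_image N m \<sigma> v" by blast
    have "graph_iso ?H S"
      unfolding graph_iso_def v(2) using v(1)
      by (intro exI[of _ v]) (simp add: pattern_image_def embeds_def bij_betw_def pattern_edges_def image_image)
    then show "S \<in> {S. subgraph S G \<and> graph_iso ?H S}"
      using v subgraph_pattern_image[OF _ _ G, of v] by (auto simp: embeds_def PiE_def)
  next
    fix S assume "S \<in> {S. subgraph S G \<and> graph_iso ?H S}"
    then have S: "subgraph S G" and "graph_iso ?H S" by auto
    then obtain f where f: "bij_betw f {..<N} (verts S)" "edges S = (\<lambda>e. f ` e) ` pattern_edges m \<sigma> (\<lambda>i. i)"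
      by (auto simp: graph_iso_def pattern_image_def)
    have Sf: "S = pattern_image N m \<sigma> f"
      using f by (simp add: pattern_image_def prod_eq_iff bij_betw_def pattern_edges_def image_image)
    obtain h where h: "inj_on h {..<N}" "P h" "pattern_image N m \<sigma> h = S"
      using ex[of f] f(1) Sf by (auto simp: bij_betw_def)
    define v where "v = restrict h {..<N}"
    have Sv: "S = pattern_image N m \<sigma> v" unfolding h(3)[symmetric] v_def by (rule pattern_image_cong) simp
    have "inj_on v {..<N}" using h(1) by (simp add: v_def inj_on_def)
    then have "embeds N m \<sigma> G v" using subgraph_pattern_image[OF _ _ G, of v] S Sv by (simp add: v_def)
    moreover have "P v" by (rule cong[OF _ h(2)]) (simp add: v_def)
    ultimately show "S \<in> pattern_image N m \<sigma> ` {v. embeds N m \<sigma> G v \<and> P v}" using Sv by blast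
  qed
  from card_image[OF inj, unfolded this] show ?thesis unfolding count_subgraphs_def .
qed

end

section \<open>Normal forms of paths and cycles\<close>

lemma path_reverse:
  assumes inj: "inj_on v {..<Suc k}"
  shows "inj_on (\<lambda>i. v (k - i)) {..<Suc k}"
    and "pattern_image (Suc k) k Suc (\<lambda>i. v (k - i)) = pattern_image (Suc k) k Suc v"
proof -
  interpret pattern "Suc k" k Suc by unfold_locales auto
  have "\<exists>j<k. {k - i, k - Suc i} = {j, Suc j}" if "i < k" for i
    using that by (intro exI[of _ "k - Suc i"]) (auto simp: Suc_diff_Suc)
  then show "inj_on (\<lambda>i. v (k - i)) {..<Suc k}"
    and "pattern_image (Suc k) k Suc (\<lambda>i. v (k - i)) = pattern_image (Suc k) k Suc v"
    by (intro pattern_symmetry[where \<rho>' = "\<lambda>i. k - i", OF inj]; simp)+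
qed

text \<open>From the start, the next vertex is always the neighbour not visited in the step
  before.\<close>

lemma path_determined:
  assumes v: "inj_on v {..<Suc k}" and w: "inj_on w {..<Suc k}" and eq: "pattern_edges k Suc v = pattern_edges k Suc w"
    and start: "v 0 = w 0" and i: "i < Suc k"
  shows "v i = w i"
  using i
proof (induction i rule: less_induct)
  case (less i)
  interpret pattern "Suc k" k Suc by unfold_locales auto
  show ?case
  proof (cases i)
    case 0
    then show ?thesis using start by simp
  next
    case (Suc j)
    then have j: "j < k" "v j = w j" using less by auto
    have "{w j, v (Suc j)} \<in> pattern_edges k Suc w" using pattern_edgesI[OF j(1), of v Suc] eq j(2) by simp
    then consider "v (Suc j) = w (Suc j)" | l where "j = Suc l" "v (Suc j) = w l"
      using pattern_neighbours[OF w, of j "v (Suc j)"] j(1) by auto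
    then show ?thesis
    proof cases
      case 2
      then have "v (Suc j) = v l" using less.IH[of l] Suc less.prems by simp
      then have "Suc j = l" using inj_onD[OF v, of "Suc j" l] j(1) 2(1) by simp
      then show ?thesis using 2(1) by simp
    qed (use Suc in simp)
  qed
qed

lemma count_paths:
  assumes G: "simple_graph G"
  shows "count_subgraphs (path_graph k) G = card {v. embeds (Suc k) k Suc G v \<and> v k \<le> v 0}"
proof -
  interpret pattern "Suc k" k Suc by unfold_locales auto
  show ?thesis unfolding path_graph_eq
  proof (rule count_pattern[OF G])
    show "\<exists>h. inj_on h {..<Suc k} \<and> h k \<le> h 0 \<and> pattern_image (Suc k) k Suc h = pattern_image (Suc k) k Suc g"
      if "inj_on g {..<Suc k}" for g
      using that path_reverse[OF that] by (cases "g k \<le> g 0") (auto intro: exI[of _ "\<lambda>i. g (k - i)"])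
    fix v w i
    assume iv: "inj_on v {..<Suc k}" and iw: "inj_on w {..<Suc k}" and ord: "v k \<le> v 0" "w k \<le> w 0"
      and eq: "pattern_image (Suc k) k Suc v = pattern_image (Suc k) k Suc w" and i: "i < Suc k"
    have ee: "pattern_edges k Suc v = pattern_edges k Suc w" and "v ` {..<Suc k} = w ` {..<Suc k}"
      using eq by (auto simp: pattern_image_def)
    then obtain j where j: "j < Suc k" "w 0 = v j" by (metis imageE imageI lessThan_iff zero_less_Suc)
    have nb: "x = w 1" if "{v j, x} \<in> pattern_edges k Suc v" for x
      using pattern_neighbours[OF iw, of 0 x] that ee j(2) by simp
    have "v 0 = w 0"
    proof (cases "j = 0")
      case False
      \<comment> \<open>The end \<open>w 0\<close> has the single neighbour \<open>w 1\<close>,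
        whereas an inner position of \<open>v\<close> has two.\<close>
      have "\<not> j < k"
      proof
        assume jk: "j < k"
        have "v (Suc j) = w 1" by (intro nb pattern_edgesI jk)
        moreover have "{v j, v (j - 1)} \<in> pattern_edges k Suc v"
          using pattern_edgesI[of "j - 1" k v Suc] False jk by (simp add: insert_commute)
        then have "v (j - 1) = w 1" by (rule nb)
        moreover have "j - 1 < Suc k" "Suc j \<noteq> j - 1" using jk by auto
        ultimately show False using inj_onD[OF iv, of "Suc j" "j - 1"] jk by simp
      qed
      then have "j = k" using j(1) by simp
      \<comment> \<open>So \<open>w\<close> is \<open>v\<close> reversed, and the two order
        conditions force the end vertices to agree.\<close>
      have "pattern_edges k Suc (\<lambda>i. v (k - i)) = pattern_edges k Suc w"
        using path_reverse(2)[OF iv] ee by (simp add: pattern_image_def)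
      from path_determined[OF path_reverse(1)[OF iv] iw this, of k]
      show ?thesis using \<open>j = k\<close> j(2) ord by simp
    qed (use j in simp)
    then show "v i = w i" by (rule path_determined[OF iv iw ee _ i])
  qed auto
qed

text \<open>The least vertex in front excludes all rotations but one, the comparison of its two
  neighbours excludes the reflection.\<close>

definition normal_cycle :: "nat \<Rightarrow> (nat \<Rightarrow> nat) \<Rightarrow> bool" where
  "normal_cycle k g \<longleftrightarrow> (\<forall>i<k. 0 < i \<longrightarrow> g 0 < g i) \<and> g (k - 1) < g 1"

lemma count_cycles:
  assumes G: "simple_graph G" and k: "3 \<le> k"
  shows "count_subgraphs (cycle_graph k) G = card {g. embeds k k (\<lambda>i. Suc i mod k) G g \<and> normal_cycle k g}"
proof -
  have Suc_mod: "i < k \<Longrightarrow> Suc i mod k = (if Suc i = k then 0 else Suc i)" for i by auto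
  interpret pattern k k "\<lambda>i. Suc i mod k" by unfold_locales (use k in \<open>auto simp: Suc_mod\<close>)
  show ?thesis unfolding cycle_graph_eq
  proof (rule count_pattern[OF G])
    show "normal_cycle k w" if "\<And>i. i < k \<Longrightarrow> v i = w i" "normal_cycle k v" for v w
      using that k by (simp add: normal_cycle_def)
    fix f :: "nat \<Rightarrow> nat"
    assume injf: "inj_on f {..<k}"
    define a where "a = arg_min_on f {..<k}"
    have a: "a < k" "\<And>i. i < k \<Longrightarrow> f a \<le> f i"
      using arg_min_if_finite[of "{..<k}" f] k by (auto simp: a_def not_less lessThan_empty_iff)
    define g where "g = (\<lambda>i. f ((i + a) mod k))"
    \<comment> \<open>Rotation by \<open>b\<close> undoes the rotation by \<open>a\<close>.\<close>
    define b where "b = k - a"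
    have rot: "\<exists>j<k. {(i + b) mod k, (Suc i mod k + b) mod k} = {j, Suc j mod k}" for i b
      using k by (intro exI[of _ "(i + b) mod k"]) (simp add: mod_simps)
    have unwind_rot: "(i + a) mod k < k \<and> (i + b) mod k < k \<and> ((i + b) mod k + a) mod k = i" if "i < k" for i
    proof -
      have "(i + b + a) mod k = i" using a(1) that by (simp add: b_def)
      then show ?thesis using that by (simp add: mod_simps)
    qed
    note g = pattern_symmetry[where \<rho> = "\<lambda>i. (i + a) mod k" and \<rho>' = "\<lambda>i. (i + b) mod k",
        OF injf unwind_rot rot rot, folded g_def]
    have ref: "\<exists>j<k. {(k - i) mod k, (k - Suc i mod k) mod k} = {j, Suc j mod k}" if "i < k" for i
      using that by (intro exI[of _ "k - Suc i"]) (auto simp: Suc_mod Suc_diff_Suc)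
    have unwind_ref: "(k - i) mod k < k \<and> (k - i) mod k < k \<and> (k - (k - i) mod k) mod k = i" if "i < k" for i
      using that by (cases "i = 0") auto
    define h where "h = (\<lambda>i. g ((k - i) mod k))"
    note h = pattern_symmetry[where \<rho> = "\<lambda>i. (k - i) mod k" and \<rho>' = "\<lambda>i. (k - i) mod k",
        OF g(1) unwind_ref ref ref, folded h_def]
    have min: "g 0 < g i" if "i < k" "0 < i" for i
    proof -
      have "g 0 \<le> g i" using a unwind_rot[OF that(1)] by (simp add: g_def)
      moreover have "g 0 \<noteq> g i" using inj_onD[OF g(1), of 0 i] that by auto
      ultimately show ?thesis by simp
    qed
    \<comment> \<open>Here \<open>3 \<le> k\<close> matters: the neighbours of position 0 are
      distinct, so the rotated cycle or its reflection is normal.\<close>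
    have "g (k - 1) \<noteq> g 1" using inj_onD[OF g(1), of "k - 1" 1] k by auto
    then have "normal_cycle k g \<or> normal_cycle k h" using min k by (auto simp: normal_cycle_def h_def)
    then show "\<exists>h. inj_on h {..<k} \<and> normal_cycle k h \<and>
        pattern_image k k (\<lambda>i. Suc i mod k) h = pattern_image k k (\<lambda>i. Suc i mod k) f"
      using g h by auto
  next
    fix g h i
    assume ig: "inj_on g {..<k}" and ih: "inj_on h {..<k}" and "normal_cycle k g" "normal_cycle k h"
      and eq: "pattern_image k k (\<lambda>i. Suc i mod k) g = pattern_image k k (\<lambda>i. Suc i mod k) h" and i: "i < k"
    then have ng: "\<And>i. i < k \<Longrightarrow> 0 < i \<Longrightarrow> g 0 < g i" "g (k - 1) < g 1"
      and nh: "\<And>i. i < k \<Longrightarrow> 0 < i \<Longrightarrow> h 0 < h i" "h (k - 1) < h 1" by (auto simp: normal_cycle_def)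
    let ?E = "\<lambda>g. pattern_edges k (\<lambda>i. Suc i mod k) g"
    have ee: "?E g = ?E h" and vv: "g ` {..<k} = h ` {..<k}" using eq by (auto simp: pattern_image_def)
    have nb: "w = g (Suc j mod k) \<or> w = g (if j = 0 then k - 1 else j - 1)" if jw: "j < k" "{g j, w} \<in> ?E g" for j w
    proof -
      consider "w = g (Suc j mod k)" | l where "l < k" "j = Suc l mod k" "w = g l"
        using pattern_neighbours[OF ig jw] by blast
      then show ?thesis
      proof cases
        case 2
        then show ?thesis unfolding Suc_mod[OF 2(1)] by (cases "Suc l = k") auto
      qed simp
    qed
    have zero: "g 0 = h 0"
    proof -
      have "g 0 \<in> h ` {..<k}" "h 0 \<in> g ` {..<k}" using vv k by auto
      then obtain i j where "i < k" "g 0 = h i" "j < k" "h 0 = g j" by auto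
      then have "j = 0 \<or> g 0 < h 0" "i = 0 \<or> h 0 < g 0" "i = 0 \<longrightarrow> g 0 = h 0" "j = 0 \<longrightarrow> h 0 = g 0"
        using ng(1)[of j] nh(1)[of i] by (simp_all only: bot_nat_0.not_eq_extremum) blast+
      then show ?thesis by linarith
    qed
    \<comment> \<open>Both \<open>h 1\<close> and \<open>h (k - 1)\<close> are cycle neighbours of
      \<open>g 0\<close>, and in both maps the larger neighbour stands at position 1.\<close>
    have one: "h 1 = g 1"
    proof -
      have "{g 0, h 1} \<in> ?E g" using pattern_edgesI[of 0 k h "\<lambda>i. Suc i mod k"] k zero ee by simp
      then have a: "h 1 = g 1 \<or> h 1 = g (k - 1)" using nb[of 0 "h 1"] k by simp
      have "{h (k - 1), h 0} \<in> ?E h" using pattern_edgesI[of "k - 1" k h "\<lambda>i. Suc i mod k"] k by simp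
      then have "{g 0, h (k - 1)} \<in> ?E g" using zero ee by (simp add: insert_commute)
      then have b: "h (k - 1) = g 1 \<or> h (k - 1) = g (k - 1)" using nb[of 0 "h (k - 1)"] k by simp
      show ?thesis using a b nh(2) ng(2) by auto
    qed
    show "g i = h i"
      using i
    proof (induction i rule: less_induct)
      case (less i)
      consider "i = 0" | "i = 1" | j where "i = Suc j" "0 < j" by (cases i) auto
      then show ?case
      proof cases
        case 3
        have jk: "j < k" "Suc j < k" using less.prems 3 by auto
        have "{h j, h (Suc j)} \<in> ?E h" using pattern_edgesI[of j k h "\<lambda>i. Suc i mod k"] jk by simp
        then have "{g j, h (Suc j)} \<in> ?E g" using less.IH[of j] 3 jk ee by simp
        then have "h (Suc j) = g (Suc j) \<or> h (Suc j) = g (j - 1)" using nb[of j "h (Suc j)"] 3 jk by simp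
        moreover have "g (j - 1) = h (j - 1)" using less.IH[of "j - 1"] 3 jk by simp
        ultimately show ?thesis using inj_onD[OF ih, of "Suc j" "j - 1"] 3 jk by auto
      qed (use zero one in simp_all)
    qed
  qed
qed

section \<open>Correctness and running time\<close>

definition matrix :: "nat ugraph \<Rightarrow> nat \<Rightarrow> nat" where
  "matrix G = (\<lambda>a. if a < card (verts G) * card (verts G) \<and>
     {a div card (verts G), a mod card (verts G)} \<in> edges G then 1 else 0)"

lemma input_state_eq: "input_state G k = ((\<lambda>_. 0)(0 := card (verts G), 1 := k), matrix G)"
  by (simp add: input_state_def matrix_def Let_def)

lemma card_fibres:
  fixes n :: nat
  assumes "finite A" "\<And>x. x \<in> A \<Longrightarrow> f x < n"
  shows "card A = (\<Sum>s<n. card {x \<in> A. f x = s})"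
proof -
  have "(\<Sum>s<n. \<Sum>x\<in>{x \<in> A. f x = s}. 1) = (\<Sum>x\<in>A. 1 :: nat)"
    by (rule sum.group) (use assms in auto)
  then show ?thesis by simp
qed

context
  fixes G :: "nat ugraph" and n :: nat
  assumes G: "simple_graph G" and V: "verts G = {..<n}"
begin

lemma adjacent_matrix: "u < n \<Longrightarrow> v < n \<Longrightarrow> adjacent (matrix G, n, K) u v \<longleftrightarrow> {u, v} \<in> edges G"
  using pair_less[of u n v n] by (simp add: adjacent_def matrix_def V)

text \<open>Irreflexivity is wanted for all numbers; for those that are no vertices the index lies
  beyond the stored matrix, where the entry is 0.\<close>

lemma not_adjacent_self: "\<not> adjacent (matrix G, n, K) u u"
proof (cases "u < n")
  case True
  have "{u} \<notin> edges G" using G by (auto simp: simple_graph_def)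
  then show ?thesis using adjacent_matrix[OF True True] by simp
next
  case False
  then have "\<not> u * n + u < n * n" using mult_le_mono1[of n u n] by linarith
  then show ?thesis by (simp add: adjacent_def matrix_def V del: not_less)
qed

definition inner_paths :: "nat \<Rightarrow> nat \<Rightarrow> nat \<Rightarrow> nat \<Rightarrow> (nat \<Rightarrow> nat) set" where
  "inner_paths K lo s t = {v \<in> walk_maps K {lo..<n} (adjacent (matrix G, n, K)) s t. inj_on v {..K}}"

lemma walk_parity_inner_paths:
  "s < n \<Longrightarrow> walk_parity (adjacent (matrix G, n, K)) n (Suc K) lo s t = card (inner_paths K lo s t) mod 2"
  unfolding inner_paths_def
  by (rule walk_parity_correct) (auto simp: adjacent_matrix not_adjacent_self insert_commute)

lemma inner_pathsD:
  assumes "v \<in> inner_paths K lo s t"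
  shows "i \<le> K \<Longrightarrow> lo \<le> v i \<and> v i < n" "\<not> i \<le> K \<Longrightarrow> v i = undefined" "v 0 = s" "v K = t"
    "i < K \<Longrightarrow> {v i, v (Suc i)} \<in> edges G" "inj_on v {..K}"
proof -
  have w: "v \<in> walk_maps K {lo..<n} (adjacent (matrix G, n, K)) s t" "inj_on v {..K}"
    using assms by (auto simp: inner_paths_def)
  show r: "i \<le> K \<Longrightarrow> lo \<le> v i \<and> v i < n" for i using w(1) by (auto simp: walk_maps_def PiE_def Pi_def)
  show "\<not> i \<le> K \<Longrightarrow> v i = undefined" "v 0 = s" "v K = t" "inj_on v {..K}"
    using w by (auto simp: walk_maps_def PiE_def extensional_def)
  show "i < K \<Longrightarrow> {v i, v (Suc i)} \<in> edges G"
    using w(1) r[of i] r[of "Suc i"] adjacent_matrix by (auto simp: walk_maps_def)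
qed

lemma inner_pathsI:
  assumes "\<And>i. i \<le> K \<Longrightarrow> lo \<le> v i \<and> v i < n" "\<And>i. \<not> i \<le> K \<Longrightarrow> v i = undefined" "v 0 = s" "v K = t"
    "\<And>i. i < K \<Longrightarrow> {v i, v (Suc i)} \<in> edges G" "inj_on v {..K}"
  shows "v \<in> inner_paths K lo s t"
  using assms adjacent_matrix by (auto simp: inner_paths_def walk_maps_def PiE_def Pi_def extensional_def)

lemma path_parity_correct: "path_parity (matrix G, n, k) = count_subgraphs (path_graph k) G mod 2"
proof -
  let ?P = "{v. embeds (Suc k) k Suc G v \<and> v k \<le> v 0}"
  have fin: "finite ?P"
    by (rule finite_subset[OF _ finite_PiE[of "{..<Suc k}" "\<lambda>_. verts G"]]) (auto simp: embeds_def pattern_edges_def less_Suc_eq_le lessThan_Suc_atMost V)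
  have less: "v i < n" if "v \<in> ?P" "i \<le> k" for v i using that by (auto simp: embeds_def pattern_edges_def less_Suc_eq_le lessThan_Suc_atMost V PiE_def Pi_def)
  have "path_parity (matrix G, n, k) =
      (\<Sum>s<n. (\<Sum>t<n. (if t \<le> s then card (inner_paths k 0 s t) else 0) mod 2) mod 2) mod 2"
    unfolding path_parity_def
    by (intro arg_cong[where f = "\<lambda>x. x mod 2"] sum.cong refl) (auto simp: walk_parity_inner_paths)
  also have "\<dots> = (\<Sum>s<n. \<Sum>t<n. if t \<le> s then card (inner_paths k 0 s t) else 0) mod 2"
    by (simp only: mod_sum_eq)
  also have "(\<Sum>s<n. \<Sum>t<n. if t \<le> s then card (inner_paths k 0 s t) else 0) =
      (\<Sum>s<n. \<Sum>t<n. card {v \<in> {v \<in> ?P. v 0 = s}. v k = t})"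
  proof (intro sum.cong refl)
    fix s t
    have "{v \<in> {v \<in> ?P. v 0 = s}. v k = t} = (if t \<le> s then inner_paths k 0 s t else {})"
      by (auto simp: embeds_def pattern_edges_def less_Suc_eq_le lessThan_Suc_atMost V PiE_def Pi_def extensional_def inner_pathsD intro!: inner_pathsI)
    then show "(if t \<le> s then card (inner_paths k 0 s t) else 0) = card {v \<in> {v \<in> ?P. v 0 = s}. v k = t}"
      by simp
  qed
  also have "\<dots> = (\<Sum>s<n. card {v \<in> ?P. v 0 = s})"
    by (intro sum.cong refl card_fibres[symmetric]) (use less in \<open>auto intro: finite_subset[OF _ fin]\<close>)
  also have "\<dots> = card ?P"
    by (intro card_fibres[symmetric]) (use fin less in auto)
  finally show ?thesis by (simp only: count_paths[OF G])
qed

text \<open>Deleting the least vertex turns a normalised cycle into a path above \<open>x\<close>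
  from \<open>s\<close> to \<open>t\<close>; shifting positions by one and putting \<open>x\<close>
  back at position 0 are inverse to each other.\<close>

lemma card_cycles_through:
  assumes k: "3 \<le> k"
  shows "card {g. (embeds k k (\<lambda>i. Suc i mod k) G g \<and> normal_cycle k g) \<and> g 0 = x \<and> g 1 = s \<and> g (k - 1) = t} =
    (if x < t \<and> t < s \<and> {x, s} \<in> edges G \<and> {x, t} \<in> edges G then card (inner_paths (k - 2) (Suc x) s t) else 0)"
proof -
  let ?C = "{g. (embeds k k (\<lambda>i. Suc i mod k) G g \<and> normal_cycle k g) \<and> g 0 = x \<and> g 1 = s \<and> g (k - 1) = t}"
  \<comment> \<open>Two edges disappear together with the least vertex.\<close>
  define K where "K = k - 2"
  have kK: "k = Suc (Suc K)" "0 < K" using k by (simp_all add: K_def)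
  have g: "x < t" "t < s" "{x, s} \<in> edges G" "{x, t} \<in> edges G" if "g \<in> ?C" for g
  proof -
    have e: "pattern_edges k (\<lambda>i. Suc i mod k) g \<subseteq> edges G" using that by (simp add: embeds_def)
    show "x < t" "t < s" using that kK by (auto simp: normal_cycle_def)
    show "{x, s} \<in> edges G" using pattern_edgesI[of 0 k g "\<lambda>i. Suc i mod k"] e that kK by auto
    have "{g (k - 1), g 0} \<in> edges G" using pattern_edgesI[of "k - 1" k g "\<lambda>i. Suc i mod k"] e kK by auto
    then show "{x, t} \<in> edges G" using that by (simp add: insert_commute)
  qed
  show ?thesis
  proof (cases "x < t \<and> t < s \<and> {x, s} \<in> edges G \<and> {x, t} \<in> edges G")
    case False
    then have C: "?C = {}" using g by blast
    show ?thesis unfolding C if_not_P[OF False] by simp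
  next
    case True
    have xn: "x < n" using True G V by (auto simp: simple_graph_def)
    have "bij_betw (\<lambda>g. restrict (\<lambda>i. g (Suc i)) {..K}) ?C (inner_paths K (Suc x) s t)"
    proof (rule bij_betw_byWitness[where f' = "\<lambda>v i. if i = 0 then x else if i < k then v (i - 1) else undefined"])
      show "\<forall>g\<in>?C. (\<lambda>i. if i = 0 then x else if i < k then restrict (\<lambda>i. g (Suc i)) {..K} (i - 1) else undefined) = g"
        using kK by (auto simp: fun_eq_iff embeds_def PiE_def extensional_def)
      show "\<forall>v\<in>inner_paths K (Suc x) s t. restrict (\<lambda>i. if Suc i = 0 then x else if Suc i < k then v (Suc i - 1) else undefined) {..K} = v"
        using kK by (auto simp: fun_eq_iff inner_pathsD(2) restrict_def less_Suc_eq_le)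
      show "(\<lambda>g. restrict (\<lambda>i. g (Suc i)) {..K}) ` ?C \<subseteq> inner_paths K (Suc x) s t"
      proof clarify
        fix g assume c: "embeds k k (\<lambda>i. Suc i mod k) G g" "normal_cycle k g" "x = g 0" "s = g 1" "t = g (k - 1)"
        have e: "pattern_edges k (\<lambda>i. Suc i mod k) g \<subseteq> edges G" and inj: "inj_on g {..<k}" using c(1) by (auto simp: embeds_def)
        show "restrict (\<lambda>i. g (Suc i)) {..K} \<in> inner_paths K (Suc (g 0)) (g 1) (g (k - 1))"
        proof (rule inner_pathsI)
          show "Suc (g 0) \<le> restrict (\<lambda>i. g (Suc i)) {..K} i \<and> restrict (\<lambda>i. g (Suc i)) {..K} i < n" if "i \<le> K" for i
            using that c kK V by (auto simp: normal_cycle_def embeds_def PiE_def Pi_def Suc_le_eq)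
          show "{restrict (\<lambda>i. g (Suc i)) {..K} i, restrict (\<lambda>i. g (Suc i)) {..K} (Suc i)} \<in> edges G" if "i < K" for i
            using that pattern_edgesI[of "Suc i" k g "\<lambda>i. Suc i mod k"] e kK by auto
          show "inj_on (restrict (\<lambda>i. g (Suc i)) {..K}) {..K}"
          proof (rule inj_onI)
            fix i j
            assume "i \<in> {..K}" "j \<in> {..K}" "restrict (\<lambda>i. g (Suc i)) {..K} i = restrict (\<lambda>i. g (Suc i)) {..K} j"
            then show "i = j" using inj_onD[OF inj, of "Suc i" "Suc j"] kK by simp
          qed
        qed (use kK in auto)
      qed
      show "(\<lambda>v i. if i = 0 then x else if i < k then v (i - 1) else undefined) ` inner_paths K (Suc x) s t \<subseteq> ?C"
      proof
        fix h assume "h \<in> (\<lambda>v i. if i = 0 then x else if i < k then v (i - 1) else undefined) ` inner_paths K (Suc x) s t"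
        then obtain v where v: "v \<in> inner_paths K (Suc x) s t"
          and h: "h = (\<lambda>i. if i = 0 then x else if i < k then v (i - 1) else undefined)" by blast
        note D = inner_pathsD[OF v]
        have h0: "h 0 = x" and hS: "\<And>i. i \<le> K \<Longrightarrow> h (Suc i) = v i" using kK by (auto simp: h)
        have h1: "h 1 = s" and hk: "h (k - 1) = t" using hS[of 0] hS[of K] D(3,4) kK by auto
        have "inj_on h {..<k}"
        proof (rule inj_onI)
          fix i j assume a: "i \<in> {..<k}" "j \<in> {..<k}" "h i = h j"
          have pos: "x < h (Suc i)" if "i \<le> K" for i using D(1)[OF that] hS[OF that] by simp
          show "i = j"
          proof (cases i; cases j)
            fix i' j' assume ij: "i = Suc i'" "j = Suc j'"
            then have "i' \<le> K" "j' \<le> K" using a kK by auto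
            then show "i = j" using a ij hS inj_onD[OF D(6), of i' j'] by simp
          next
            fix j' assume ij: "i = 0" "j = Suc j'"
            then show "i = j" using a kK h0 pos[of j'] by simp
          next
            fix i' assume ij: "i = Suc i'" "j = 0"
            then show "i = j" using a kK h0 pos[of i'] by simp
          qed simp
        qed
        moreover have "pattern_edges k (\<lambda>i. Suc i mod k) h \<subseteq> edges G"
        proof
          fix e assume "e \<in> pattern_edges k (\<lambda>i. Suc i mod k) h"
          then obtain i where i: "i < k" "e = {h i, h (Suc i mod k)}" by (auto simp: pattern_edges_def)
          consider "i = 0" | "i = k - 1" | j where "i = Suc j" "j < K" using i(1) kK by (cases i) (auto simp: less_Suc_eq)
          then show "e \<in> edges G"
          proof cases
            case 1
            then show ?thesis using i(2) h0 h1 True kK by simp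
          next
            case 2
            then have "Suc i mod k = 0" using kK by simp
            then show ?thesis using i(2) 2 h0 hk True by (simp add: insert_commute)
          next
            case 3
            then have "Suc i mod k = Suc (Suc j)" using kK by simp
            then show ?thesis using i(2) 3 hS D(5) by simp
          qed
        qed
        moreover have "h \<in> {..<k} \<rightarrow>\<^sub>E verts G"
        proof -
          have "h i < n" if "i < k" for i
            using that xn D(1)[of "i - 1"] kK by (auto simp: h)
          then show ?thesis using kK V by (auto simp: h)
        qed
        moreover have "normal_cycle k h"
          unfolding normal_cycle_def
        proof (intro conjI allI impI)
          show "h 0 < h i" if "i < k" "0 < i" for i
          proof -
            have "i - 1 \<le> K" "Suc (i - 1) = i" using that kK by linarith+
            then show ?thesis using h0 hS[of "i - 1"] D(1)[of "i - 1"] by simp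
          qed
          show "h (k - 1) < h 1" using h1 hk True by simp
        qed
        ultimately show "h \<in> ?C" using h0 h1 hk by (simp add: embeds_def)
      qed
    qed
    from bij_betw_same_card[OF this] show ?thesis using True by (simp add: K_def)
  qed
qed

lemma cycle_parity_correct:
  assumes k: "3 \<le> k"
  shows "cycle_parity (matrix G, n, k - 2) = count_subgraphs (cycle_graph k) G mod 2"
proof -
  let ?C = "{g. embeds k k (\<lambda>i. Suc i mod k) G g \<and> normal_cycle k g}"
  let ?f = "\<lambda>x s t. if x < t \<and> t < s \<and> {x, s} \<in> edges G \<and> {x, t} \<in> edges G
    then card (inner_paths (k - 2) (Suc x) s t) else 0"
  have fin: "finite ?C"
    by (rule finite_subset[OF _ finite_PiE[of "{..<k}" "\<lambda>_. verts G"]]) (auto simp: embeds_def V)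
  have less: "g i < n" if "g \<in> ?C" "i < k" for g i using that by (auto simp: embeds_def V PiE_def Pi_def)
  have "cycle_parity (matrix G, n, k - 2) =
      (\<Sum>x<n. (\<Sum>s<n. (\<Sum>t<n. ?f x s t mod 2) mod 2) mod 2) mod 2"
    unfolding cycle_parity_def
    by (intro arg_cong[where f = "\<lambda>x. x mod 2"] sum.cong refl)
      (auto simp: walk_parity_inner_paths adjacent_matrix)
  also have "\<dots> = (\<Sum>x<n. \<Sum>s<n. \<Sum>t<n. ?f x s t) mod 2"
    by (simp only: mod_sum_eq)
  also have "(\<Sum>x<n. \<Sum>s<n. \<Sum>t<n. ?f x s t) =
      (\<Sum>x<n. \<Sum>s<n. \<Sum>t<n. card {g \<in> {g \<in> {g \<in> ?C. g 0 = x}. g 1 = s}. g (k - 1) = t})"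
    by (intro sum.cong refl) (simp add: card_cycles_through[OF k, symmetric] conj_assoc)
  also have "\<dots> = (\<Sum>x<n. \<Sum>s<n. card {g \<in> {g \<in> ?C. g 0 = x}. g 1 = s})"
    by (intro sum.cong refl card_fibres[symmetric]) (use less k in \<open>auto intro: finite_subset[OF _ fin]\<close>)
  also have "\<dots> = (\<Sum>x<n. card {g \<in> ?C. g 0 = x})"
    by (intro sum.cong refl card_fibres[symmetric]) (use less k in \<open>auto intro: finite_subset[OF _ fin]\<close>)
  also have "\<dots> = card ?C"
    by (intro card_fibres[symmetric]) (use fin less k in auto)
  finally show ?thesis by (simp only: count_cycles[OF G k])
qed

end

lemma binary_matrix: "binary_memory (matrix G, n, K)"
  by (simp add: binary_memory_def matrix_def)

theorem theorem1p5:
  shows "(\<exists>p a b c. solves_in_time p UNIV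
            (\<lambda>G k. count_subgraphs (path_graph k) G mod 2) (path_cycle_bound a b c)) \<and>
         (\<exists>p a b c. solves_in_time p {3..}
            (\<lambda>G k. count_subgraphs (cycle_graph k) G mod 2) (path_cycle_bound a b c))"
proof
  obtain p c where p: "\<And>I r. binary_memory I \<Longrightarrow> r 0 = siz I \<Longrightarrow> r 1 = len I \<Longrightarrow>
    \<exists>t r'. exec p (r, mem I) t (r', mem I) \<and> r' 0 = path_parity I \<and> t \<le> 2 * (weight I * scale I ^ c) + 2"
    using main_program[OF computable_path] by blast
  have "solves_in_time p UNIV (\<lambda>G k. count_subgraphs (path_graph k) G mod 2)
      (path_cycle_bound (4 ^ (c + 7)) (3 * (c + 6) + 4) (c + 7))"
    unfolding solves_in_time_def
  proof (intro allI ballI impI)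
    fix G :: "nat ugraph" and k :: nat
    assume G: "simple_graph G \<and> verts G = {..<card (verts G)}"
    let ?n = "card (verts G)"
    let ?I = "(matrix G, ?n, k)"
    obtain t r where tr: "exec p (input_state G k) t (r, matrix G)" "r 0 = path_parity ?I"
      "t \<le> 2 * (weight ?I * scale ?I ^ c) + 2"
      using p[OF binary_matrix[of G ?n k], of "(\<lambda>_. 0)(0 := ?n, 1 := k)"] by (auto simp: input_state_eq)
    have "r 0 = count_subgraphs (path_graph k) G mod 2" using tr(2) path_parity_correct[of G ?n k] G by simp
    moreover have "real t \<le> path_cycle_bound (4 ^ (c + 7)) (3 * (c + 6) + 4) (c + 7) ?n k"
      using tr(3) by (intro time_bound[of k k t "matrix G"]) auto
    ultimately show "\<exists>t r m. exec p (input_state G k) t (r, m) \<and> r 0 = count_subgraphs (path_graph k) G mod 2 \<and>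
        real t \<le> path_cycle_bound (4 ^ (c + 7)) (3 * (c + 6) + 4) (c + 7) ?n k" using tr(1) by blast
  qed
  then show "\<exists>p a b c. solves_in_time p UNIV
      (\<lambda>G k. count_subgraphs (path_graph k) G mod 2) (path_cycle_bound a b c)" by blast
next
  obtain p c where p: "\<And>I r. binary_memory I \<Longrightarrow> r 0 = siz I \<Longrightarrow> r 1 = len I \<Longrightarrow>
    \<exists>t r'. exec p (r, mem I) t (r', mem I) \<and> r' 0 = cycle_parity I \<and> t \<le> 2 * (weight I * scale I ^ c) + 2"
    using main_program[OF computable_cycle] by blast
  \<comment> \<open>Register 1 is lowered to the length of the path left after deleting the least
    vertex. The 2 remaining in register 2 is harmless, since \<open>p\<close> is correct for
    arbitrary contents of the other registers.\<close>
  let ?p = "Seq (Const 2 2) (Seq (Op Sub 1 1 2) p)"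
  have "solves_in_time ?p {3..} (\<lambda>G k. count_subgraphs (cycle_graph k) G mod 2)
      (path_cycle_bound (4 ^ (c + 7)) (3 * (c + 6) + 4) (c + 7))"
    unfolding solves_in_time_def
  proof (intro allI ballI impI)
    fix G :: "nat ugraph" and k :: nat
    assume k: "k \<in> {3..}" and G: "simple_graph G \<and> verts G = {..<card (verts G)}"
    let ?n = "card (verts G)"
    let ?I = "(matrix G, ?n, k - 2)"
    let ?r = "((\<lambda>_. 0)(0 := ?n, 1 := k))(2 := 2) :: nat \<Rightarrow> nat"
    let ?r' = "?r(1 := binop_val Sub (?r 1) (?r 2))"
    obtain t r where tr: "exec p (?r', matrix G) t (r, matrix G)" "r 0 = cycle_parity ?I"
      "t \<le> 2 * (weight ?I * scale ?I ^ c) + 2"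
      using p[OF binary_matrix[of G ?n "k - 2"], of ?r'] by auto
    have ex: "exec ?p (input_state G k) (bitlen 2 + ((bitlen (?r 1) + bitlen (?r 2)) + t)) (r, matrix G)"
      unfolding input_state_eq by (rule exec.Seq[OF exec.Const exec.Seq[OF exec.Op tr(1)]])
    have "bitlen 2 \<le> 2" by (subst bitlen_le_iff) simp_all
    then have "bitlen 2 + ((bitlen (?r 1) + bitlen (?r 2)) + t) \<le> 2 * (weight ?I * scale ?I ^ c) + 2 + (k + 6)"
      using tr(3) bitlen_le_Suc[of k] by simp
    then have "real (bitlen 2 + ((bitlen (?r 1) + bitlen (?r 2)) + t)) \<le>
        path_cycle_bound (4 ^ (c + 7)) (3 * (c + 6) + 4) (c + 7) ?n k"
      by (rule time_bound[rotated]) simp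
    moreover have "r 0 = count_subgraphs (cycle_graph k) G mod 2"
      using tr(2) cycle_parity_correct[of G ?n k] G k by simp
    ultimately show "\<exists>t r m. exec ?p (input_state G k) t (r, m) \<and> r 0 = count_subgraphs (cycle_graph k) G mod 2 \<and>
        real t \<le> path_cycle_bound (4 ^ (c + 7)) (3 * (c + 6) + 4) (c + 7) ?n k" using ex by blast
  qed
  then show "\<exists>p a b c. solves_in_time p {3..}
      (\<lambda>G k. count_subgraphs (cycle_graph k) G mod 2) (path_cycle_bound a b c)" by blast
qed

end
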